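(* Let $x,y,z$ be non-negative integers and let $\mathbf a=(a_1,\dots,a_m)$, $\mathbf b=(b_1,\dots,b_n)$ be two sequences of non-negative integers. Put $\mu=2\lfloor\frac{m+1}{2}\rfloor$, $\mu'=2\lceil\frac{m-1}{2}\rceil$, $\nu=2\lfloor\frac{n+1}{2}\rfloor$, $\nu'=2\lceil\frac{n-1}{2}\rceil$, and $$\mathbf t^{+}=(a_1,\dots,a_{\mu'},\,a_{\mu'+1}+x+y+b_{\nu},\,b_{\nu-1},\dots,b_1),\qquad \mathbf t^{-}=(0,a_1+1,a_2,\dots,a_{\mu-1},\,a_{\mu}+x+y+b_{\nu'+1},\,b_{\nu'},\dots,b_1,z).$$ Then $$M(NR^{(1)}_{x,y,z}(\mathbf a;\mathbf b))=\frac{M(NR^{(1)}_{x+y,0,z}(\mathbf a;\mathbf b))\,M(NR^{(1)}_{0,y,z}(\mathbf a;\mathbf b))}{M(NR^{(1)}_{y,0,z}(\mathbf a;\mathbf b))}\cdot\frac{T(x+1,2a+b+2y+z,y)\,T(x+a+1,b+2y+z,y)}{T(1,2a+b+2y+z,y)\,T(a+1,b+2y+z,y)}$$ $$=2^{a_1-y}\,Q(\mathbf t^{+})\,K'(\mathbf t^{-})\cdot\frac{(a+y)!}{a!}\cdot\frac{H_2(2e_a+2o_b+1)\,H_2(2o_a+2e_b+2z+2)}{H_2(2e_a+2o_b+2y+1)\,H_2(2o_a+2e_b+2y+2z+2)}\cdot\frac{H(2a+b+2y+z+1)\,H(b+y+z)}{H(2a+b+y+z+1)\,H(b+z)}$$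 $$\cdot\frac{T(x+1,2a+b+2y+z,y)\,T(x+a+1,b+2y+z,y)}{T(1,2a+b+2y+z,y)\,T(a+1,b+2y+z,y)}.$$
   Context: Lattice and tilings. For real $u,k$ let $[u;k]$ be the point of the plane with Cartesian coordinates $(u,\frac{\sqrt3}{2}k)$. The triangular lattice has as vertices all $[u;k]$ with $k\in\mathbb Z$, $u-k/2\in\mathbb Z$; its faces are unit equilateral triangles, up-pointing or down-pointing. A region is a finite union of unit triangles. A lozenge is the union of two unit triangles sharing an edge; it is vertical if that edge is horizontal. A tiling of a region is a covering of it by lozenges contained in it, without gaps or overlaps. $M(R)$ is the sum of the weights of all tilings of $R$, the weight of a tiling being the product of the weights of its lozenges; lozenges have weight $1$ unless stated otherwise; $M(\emptyset)=1$. Sequences. $a=\sum a_i$, $b=\sum b_j$; $o_a,e_a$ are the sums of the $a_i$ with $i$ odd, resp. even; $o_b,e_b$ likewise. $a_i=0$ for $i>m$, $b_j=0$ for $j>n$; an empty sequence is treated as the one-term sequence $(0)$. Functions. $H(n)=\prod_{i=0}^{n-1}i!$; $H_2(n)=\prod_{i=1}^{\lfloor n/2\rfloor}(n-2i)!$; for $n\ge0$, $(x)_n=x(x+1)\cdots(x+n-1)$ ($1$ for $n=0$); $T(x,n,m)=\prod_{i=0}^{m-1}(x+i)_{n-2i}$. Empty products are $1$. Quartered hexagons. For a sequence $\mathbf t=(t_1,\dots,t_{2l})$ of non-negative integers let $s_k=t_1+\dots+t_k$, $o_t=\sum_{i\text{ odd}}t_i$, $e_t=\sum_{i\text{ even}}t_i$.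 $Q(\mathbf t)$: take the region bounded by the base from $[0;0]$ to $[o_t+e_t;0]$, the segment from $[o_t+e_t;0]$ to $[o_t;2e_t]$, the north side from $[o_t;2e_t]$ to $[0;2e_t]$, and the west zigzag through $[0;0],[-\frac12;1],[0;2],[-\frac12;3],\dots,[0;2e_t]$; remove from it, for each $1\le i\le l$, the up-pointing triangle with base from $[s_{2i-1};0]$ to $[s_{2i};0]$. $Q(\mathbf t)$ is the number of tilings of the resulting region. $K'(\mathbf t)$ (for $e_t\ge1$): take the region bounded by the base from $[0;0]$ to $[o_t+e_t;0]$, the segment from $[o_t+e_t;0]$ to $[o_t+\frac12;2e_t-1]$, the north side from there to $[\frac12;2e_t-1]$, and the west zigzag through $[0;0],[\frac12;1],[0;2],[\frac12;3],\dots,[\frac12;2e_t-1]$; remove the same up-pointing triangles; give weight $\frac12$ to each vertical lozenge whose two western (left) sides both lie on the west zigzag. $K'(\mathbf t)$ is $M$ of this weighted region. The region $NR^{(1)}_{x,y,z}(\mathbf a;\mathbf b)$. Let $L=x+y+a+b$, $A=2(y+e_a+o_b)$, $B=2(y+z+o_a+e_b)+1$, and let $\ell$ be the line $k=0$. Upper part: bounded by $\ell$ between $[0;0]$ and $[L;0]$, the segment from $[L;0]$ to $[L-\frac A2;A]$, the horizontal north side at height $k=A$, and the west zigzag through the points $[\alpha(k);k]$, $0\le k\le A$, with $\alpha(k)=0$ for $k$ even and $-\frac12$ for $k$ odd. Lower part: bounded by $\ell$ between $[-1;0]$ and $[L;0]$, the segments from $[L;0]$ to $[L+\frac z2;-z]$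 and from there to $[L+z-\frac B2;-B]$, the horizontal south side at $k=-B$, and the west zigzag through $[\beta(k);-k]$, $0\le k\le B$, with $\beta(k)=-1$ for $k$ even and $-\frac12$ for $k$ odd. The region is the union of the two parts (lozenges may cross $\ell$) after removing: (i) from the lower part, everything at points $[u;-k]$ with $u<a_1-k/2$ (the down-pointing half triangle); (ii) for $2\le i\le m$, the triangle of side $a_i$ having a side on $\ell$ from $[a_1+\dots+a_{i-1};0]$ to $[a_1+\dots+a_i;0]$, up-pointing (above $\ell$) if $i$ is even, down-pointing (below $\ell$) if $i$ is odd; (iii) for $1\le j\le n$, the triangle of side $b_j$ having a side on $\ell$ from $[L-b_1-\dots-b_j;0]$ to $[L-b_1-\dots-b_{j-1};0]$, up-pointing (above $\ell$) if $j$ is odd, down-pointing (below $\ell$) if $j$ is even. Each vertical lozenge whose two western (left) sides both lie on the lower west zigzag has weight $\frac12$; all others have weight $1$. *)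

theory Defs
  imports Complex_Main "HOL-Library.Disjoint_Sets"
begin

section \<open>Lattice, regions and tilings\<close>

text \<open>
  The pair (u, k) stands for the point [u;k] of the plane, whose Cartesian coordinates are
  (u, k * sqrt 3 / 2). Only points at integer heights k are needed: a unit triangle is represented
  by the set of its three vertices, and all region boundaries are straight between consecutive
  integer heights. Within each strip between two consecutive heights the polygons below are convex
  with boundary along lattice lines, so a unit triangle lies in such a polygon iff its vertices do.
\<close>

type_synonym point = "real \<times> int"
type_synonym triangle = "point set"
type_synonym lozenge = "triangle set"

definition lattice :: "point set" where
  "lattice = {(u, k). u - of_int k / 2 \<in> \<int>}"

text \<open>The up- and the down-pointing unit triangle with horizontal side from [u;k] to [u+1;k].\<close>

definition up :: "real \<Rightarrow> int \<Rightarrow> triangle" where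
  "up u k = {(u, k), (u + 1, k), (u + 1/2, k + 1)}"

definition down :: "real \<Rightarrow> int \<Rightarrow> triangle" where
  "down u k = {(u, k), (u + 1, k), (u + 1/2, k - 1)}"

definition unit_triangles :: "triangle set" where
  "unit_triangles = {up u k |u k. (u, k) \<in> lattice} \<union> {down u k |u k. (u, k) \<in> lattice}"

text \<open>A region is given by the finite set of its unit triangles; \<open>cells S\<close> are those in a polygon S.\<close>

definition cells :: "point set \<Rightarrow> triangle set" where
  "cells S = {T \<in> unit_triangles. T \<subseteq> S}"

text \<open>Two distinct unit triangles share an edge iff they have exactly two common vertices.\<close>

definition lozenges :: "lozenge set" where
  "lozenges = {{T, T'} |T T'. T \<in> unit_triangles \<and> T' \<in> unit_triangles \<and> card (T \<inter> T') = 2}"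

definition tilings :: "triangle set \<Rightarrow> lozenge set set" where
  "tilings R = {P. partition_on R P \<and> P \<subseteq> lozenges}"

definition M :: "(lozenge \<Rightarrow> real) \<Rightarrow> triangle set \<Rightarrow> real" where
  "M w R = (\<Sum>P\<in>tilings R. \<Prod>l\<in>P. w l)"

text \<open>The edges of the zigzag through the points [f k; k] for p \<open>\<le>\<close> k \<open>\<le>\<close> q.\<close>

definition zigzag :: "(int \<Rightarrow> real) \<Rightarrow> int \<Rightarrow> int \<Rightarrow> point set set" where
  "zigzag f p q = {{(f k, k), (f (k + 1), k + 1)} |k. p \<le> k \<and> k < q}"

text \<open>
  A vertical lozenge is {\<open>up u k, down u k\<close>}; its western sides join [u;k] to [u+1/2;k+1] and to
  [u+1/2;k-1].
\<close>

definition west_weight :: "point set set \<Rightarrow> lozenge \<Rightarrow> real" where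
  "west_weight Z l =
    (if \<exists>u k. l = {up u k, down u k} \<and>
        {(u, k), (u + 1/2, k + 1)} \<in> Z \<and> {(u, k), (u + 1/2, k - 1)} \<in> Z
     then 1/2 else 1)"

text \<open>Triangles of side s with a side on the line k = 0 from [p;0] to [p+s;0].\<close>

definition up_tri :: "nat \<Rightarrow> nat \<Rightarrow> point set" where
  "up_tri p s = {(u, k). 0 \<le> k \<and> real p + of_int k / 2 \<le> u \<and> u \<le> real p + real s - of_int k / 2}"

definition down_tri :: "nat \<Rightarrow> nat \<Rightarrow> point set" where
  "down_tri p s = {(u, k). k \<le> 0 \<and> real p - of_int k / 2 \<le> u \<and> u \<le> real p + real s + of_int k / 2}"

section \<open>Sequences\<close>

text \<open>Sequences are lists indexed from 1; terms beyond the end are 0, and [] counts as [0].\<close>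

definition entry :: "nat list \<Rightarrow> nat \<Rightarrow> nat" where
  "entry a i = (if 1 \<le> i \<and> i \<le> length a then a ! (i - 1) else 0)"

definition seq_length :: "nat list \<Rightarrow> nat" where
  "seq_length a = max 1 (length a)"

definition odd_sum :: "nat list \<Rightarrow> nat" where
  "odd_sum a = (\<Sum>i | i \<in> {1..length a} \<and> odd i. entry a i)"

definition even_sum :: "nat list \<Rightarrow> nat" where
  "even_sum a = (\<Sum>i | i \<in> {1..length a} \<and> even i. entry a i)"

definition psum :: "nat list \<Rightarrow> nat \<Rightarrow> nat" where
  "psum a k = (\<Sum>i\<in>{1..k}. entry a i)"

definition mu :: "nat \<Rightarrow> nat" where
  "mu m = 2 * nat \<lfloor>(real m + 1) / 2\<rfloor>"

definition mu' :: "nat \<Rightarrow> nat" where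
  "mu' m = 2 * nat \<lceil>(real m - 1) / 2\<rceil>"

definition t_plus :: "nat \<Rightarrow> nat \<Rightarrow> nat list \<Rightarrow> nat list \<Rightarrow> nat list" where
  "t_plus x y a b =
    (let \<mu>' = mu' (seq_length a); \<nu> = mu (seq_length b) in
      map (entry a) [1..<\<mu>' + 1] @ [entry a (\<mu>' + 1) + x + y + entry b \<nu>]
        @ map (entry b) (rev [1..<\<nu>]))"

definition t_minus :: "nat \<Rightarrow> nat \<Rightarrow> nat \<Rightarrow> nat list \<Rightarrow> nat list \<Rightarrow> nat list" where
  "t_minus x y z a b =
    (let \<mu> = mu (seq_length a); \<nu>' = mu' (seq_length b) in
      [0, entry a 1 + 1] @ map (entry a) [2..<\<mu>] @ [entry a \<mu> + x + y + entry b (\<nu>' + 1)]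
        @ map (entry b) (rev [1..<\<nu>' + 1]) @ [z])"

section \<open>Product functions\<close>

definition H :: "nat \<Rightarrow> real" where
  "H n = (\<Prod>i<n. fact i)"

definition H2 :: "nat \<Rightarrow> real" where
  "H2 n = (\<Prod>i\<in>{1..n div 2}. fact (n - 2 * i))"

text \<open>Only meaningful if 2 * (m - 1) \<open>\<le>\<close> n, so that the subtraction does not truncate.\<close>

definition T :: "nat \<Rightarrow> nat \<Rightarrow> nat \<Rightarrow> real" where
  "T x n m = (\<Prod>i<m. pochhammer (real x + real i) (n - 2 * i))"

section \<open>Quartered hexagons\<close>

definition dents :: "nat list \<Rightarrow> triangle set" where
  "dents t = (\<Union>i\<in>{1..length t div 2}. cells (up_tri (psum t (2 * i - 1)) (entry t (2 * i))))"

definition west_Q :: "int \<Rightarrow> real" where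
  "west_Q k = (if even k then 0 else - 1/2)"

definition region_Q :: "nat list \<Rightarrow> triangle set" where
  "region_Q t =
    cells {(u, k). 0 \<le> k \<and> k \<le> 2 * int (even_sum t) \<and> west_Q k \<le> u \<and>
      u \<le> real (odd_sum t + even_sum t) - of_int k / 2} - dents t"

definition Q :: "nat list \<Rightarrow> nat" where
  "Q t = card (tilings (region_Q t))"

definition west_K :: "int \<Rightarrow> real" where
  "west_K k = (if even k then 0 else 1/2)"

definition region_K :: "nat list \<Rightarrow> triangle set" where
  "region_K t =
    cells {(u, k). 0 \<le> k \<and> k \<le> 2 * int (even_sum t) - 1 \<and> west_K k \<le> u \<and>
      u \<le> real (odd_sum t + even_sum t) - of_int k / 2} - dents t"

definition K' :: "nat list \<Rightarrow> real" where
  "K' t = M (west_weight (zigzag west_K 0 (2 * int (even_sum t) - 1))) (region_K t)"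

section \<open>The regions NR\<close>

definition NR_L :: "nat \<Rightarrow> nat \<Rightarrow> nat list \<Rightarrow> nat list \<Rightarrow> nat" where
  "NR_L x y a b = x + y + sum_list a + sum_list b"

definition NR_A :: "nat \<Rightarrow> nat list \<Rightarrow> nat list \<Rightarrow> nat" where
  "NR_A y a b = 2 * (y + even_sum a + odd_sum b)"

definition NR_B :: "nat \<Rightarrow> nat \<Rightarrow> nat list \<Rightarrow> nat list \<Rightarrow> nat" where
  "NR_B y z a b = 2 * (y + z + odd_sum a + even_sum b) + 1"

definition NR_alpha :: "int \<Rightarrow> real" where
  "NR_alpha k = (if even k then 0 else - 1/2)"

definition NR_beta :: "int \<Rightarrow> real" where
  "NR_beta k = (if even k then - 1 else - 1/2)"

definition NR_upper :: "nat \<Rightarrow> nat \<Rightarrow> nat list \<Rightarrow> nat list \<Rightarrow> point set" where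
  "NR_upper x y a b =
    {(u, k). 0 \<le> k \<and> k \<le> int (NR_A y a b) \<and> NR_alpha k \<le> u \<and>
      u \<le> real (NR_L x y a b) - of_int k / 2}"

text \<open>
  Here k is the (non-positive) height itself, not the depth. The east boundary bends at depth z:
  of the two bounds on u, the first is the binding one down to depth z, the second one below it.
\<close>

definition NR_lower :: "nat \<Rightarrow> nat \<Rightarrow> nat \<Rightarrow> nat list \<Rightarrow> nat list \<Rightarrow> point set" where
  "NR_lower x y z a b =
    {(u, k). - int (NR_B y z a b) \<le> k \<and> k \<le> 0 \<and> NR_beta k \<le> u \<and>
      u \<le> real (NR_L x y a b) - of_int k / 2 \<and>
      u \<le> real (NR_L x y a b) + real z + of_int k / 2}"

text \<open>
  The polygon contains its boundary line, but \<open>cells\<close> picks exactly the unit triangles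
  to the west of that line.
\<close>

definition NR_half_triangle :: "nat list \<Rightarrow> point set" where
  "NR_half_triangle a = {(u, k). k \<le> 0 \<and> u \<le> real (entry a 1) + of_int k / 2}"

definition NR_removed_a :: "nat list \<Rightarrow> triangle set" where
  "NR_removed_a a =
    (\<Union>i\<in>{2..seq_length a}.
      cells ((if even i then up_tri else down_tri) (psum a (i - 1)) (entry a i)))"

definition NR_removed_b :: "nat \<Rightarrow> nat list \<Rightarrow> triangle set" where
  "NR_removed_b L b =
    (\<Union>j\<in>{1..seq_length b}.
      cells ((if odd j then up_tri else down_tri) (L - psum b j) (entry b j)))"

definition NR :: "nat \<Rightarrow> nat \<Rightarrow> nat \<Rightarrow> nat list \<Rightarrow> nat list \<Rightarrow> triangle set" where
  "NR x y z a b =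
    (cells (NR_upper x y a b) \<union> cells (NR_lower x y z a b))
      - cells (NR_half_triangle a) - NR_removed_a a - NR_removed_b (NR_L x y a b) b"

definition M_NR :: "nat \<Rightarrow> nat \<Rightarrow> nat \<Rightarrow> nat list \<Rightarrow> nat list \<Rightarrow> real" where
  "M_NR x y z a b = M (west_weight (zigzag NR_beta (- int (NR_B y z a b)) 0)) (NR x y z a b)"

end

theory Submission
  imports Defs "Jordan_Normal_Form.Determinant"
begin

text \<open>
  Cut the region along the line $k = 0$ and sum over the set $S$ of positions of the lozenges crossing
  it. Each side is then a quartered hexagon with dents along its base. Peeling off horizontal strips
  turns its matching number into a determinant whose rows are, up to constants, odd (above) or even
  (below) polynomials in the position of a dent, hence into a product over pairs of differences of
  squared positions. By counting, $S$ has exactly $y$ elements. The up-pointing and down-pointing dents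
  of the ferns fill two intervals that do not depend on how they are divided into the two kinds.
  Hence the factors joining $S$ to the ferns depend only on the lengths $a$, $x + y$ and $b + z$, and
  the factors within the ferns give the numbers $Q$ and $K'$. What remains is a discrete Selberg sum
  over $S$, which Cauchy-Binet turns into a Hankel determinant of quotients of factorials. For the
  first equality note that $Q$ and $K'$ depend on $x$ and $y$ only through $x + y$, that the sum is
  trivial for $y = 0$, and that $x$ enters its value only through the factors $T$.
\<close>

section \<open>Weighted perfect matchings\<close>

text \<open>Counted from the north, the west zigzags of the upper part and of the reflected lower
  part step alike, so one recursion serves both; they differ in the parity of the number of strips
  and in the weight. At an odd height, rows with all weights 1 would be symmetric about the position
  -1/2. The weight 1/2 halves the western end term of every second summation and moves the centre to
  0. Above the line, at an even height, the rows are odd in i + 1. Since the lower base starts one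
  unit further west, position i above is position i + 1 below, and the centres coincide: only
  therefore do both sides involve the same squares. The first lower position is always a dent, which
  explains 0, a_1 + 1 at the head of t^-. It contributes s^2 to the weight of a crossing position s;
  with the factor s of the odd rows this gives the cube in \<open>selberg_weight\<close>. In 2^(a_1
  - y), the part 2^(a_1) makes up for forced lozenges of weight 1/2 which the determinant counts
  inside the half triangle but the region lacks, and 2^(-y) comes from the 1/2 in the one-variable
  Selberg sums.\<close>

definition weighted_matchings :: "'c set set \<Rightarrow> ('c set \<Rightarrow> real) \<Rightarrow> 'c set \<Rightarrow> real" where
  "weighted_matchings E w R = (\<Sum>P | partition_on R P \<and> P \<subseteq> E. \<Prod>l\<in>P. w l)"

text \<open>The set of admissible edges is a parameter because the counting is done on abstract
  cells and carried over to lozenges only at the end.\<close>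

lemma M_eq_weighted_matchings: "M w R = weighted_matchings lozenges w R"
  by (simp add: M_def weighted_matchings_def tilings_def)

lemma finite_partitions: "finite R \<Longrightarrow> finite {P. partition_on R P \<and> P \<subseteq> E}"
  by (rule finite_subset[of _ "Pow (Pow R)"]) (auto simp: partition_on_def)

lemma finite_partition: "finite R \<Longrightarrow> partition_on R P \<Longrightarrow> finite P"
  by (meson finite_elements)

lemma partition_on_unique:
  assumes "partition_on R P" "l \<in> P" "l' \<in> P" "p \<in> l" "p \<in> l'"
  shows "l = l'"
proof (rule ccontr)
  assume "l \<noteq> l'"
  then have "l \<inter> l' = {}"
    using assms(1-3) unfolding partition_on_def disjoint_def by blast
  then show False using assms by blast
qed

lemma partition_on_Un:
  assumes "partition_on R P" "partition_on R' P'" "R \<inter> R' = {}"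
  shows "partition_on (R \<union> R') (P \<union> P')"
  using assms disjoint_union[of P P'] by (auto simp: partition_on_def)

lemma partition_on_Diff:
  assumes "partition_on R P" "l \<in> P"
  shows "partition_on (R - l) (P - {l})"
proof -
  have "p \<notin> l" if "p \<in> l'" "l' \<in> P - {l}" for p l'
    using partition_on_unique[of R P l' l p] assms that by auto
  then have "\<Union>(P - {l}) = R - l"
    using partition_onD1[OF assms(1)] assms(2) by auto
  moreover have "disjoint (P - {l})"
    using partition_onD2[OF assms(1)] by (auto simp: disjoint_def)
  ultimately show ?thesis
    using partition_onD3[OF assms(1)] by (auto simp: partition_on_def)
qed

lemma weighted_matchings_empty [simp]: "weighted_matchings E w {} = 1"
proof -
  have "{P. partition_on {} P \<and> P \<subseteq> E} = {{}}"
    by (auto simp: partition_on_def)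
  then show ?thesis by (simp add: weighted_matchings_def)
qed

text \<open>Exactly one edge of a matching covers v, and the remaining edges match what this edge
  leaves.\<close>

lemma weighted_matchings_expand:
  assumes "finite R" "v \<in> R"
  shows "weighted_matchings E w R = (\<Sum>l | l \<in> E \<and> v \<in> l \<and> l \<subseteq> R. w l * weighted_matchings E w (R - l))"
proof -
  let ?L = "{l. l \<in> E \<and> v \<in> l \<and> l \<subseteq> R}"
  let ?P = "\<lambda>R. {P. partition_on R P \<and> P \<subseteq> E}"
  have fL: "finite ?L" by (rule finite_subset[of _ "Pow R"]) (use assms in auto)
  \<comment> \<open>An edge through v cannot occur once v is removed; this makes
    \<open>insert l\<close> injective and splits its weight off the product.\<close>
  have nin: "l \<notin> P" if "l \<in> ?L" "P \<in> ?P (R - l)" for l P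
  proof
    assume "l \<in> P"
    then have "v \<in> \<Union>P" using that by blast
    also have "\<Union>P = R - l" using that by (auto dest: partition_onD1)
    finally show False using that by simp
  qed
  have un: "?P R = (\<Union>l\<in>?L. insert l ` ?P (R - l))"
  proof (intro equalityI subsetI)
    fix P assume P: "P \<in> ?P R"
    then have RP: "R = \<Union>P" using partition_onD1 by blast
    then obtain l where l: "l \<in> P" "v \<in> l" using assms by blast
    have "partition_on (R - l) (P - {l})"
      using P l by (auto intro: partition_on_Diff)
    moreover have "P = insert l (P - {l})" using l by auto
    moreover have "l \<in> ?L" using P l RP by auto
    ultimately show "P \<in> (\<Union>l\<in>?L. insert l ` ?P (R - l))" using P
      by (intro UN_I[of l] image_eqI[of _ _ "P - {l}"]) auto
  next
    fix P assume "P \<in> (\<Union>l\<in>?L. insert l ` ?P (R - l))"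
    then obtain l P' where l: "l \<in> ?L" "P' \<in> ?P (R - l)" "P = insert l P'" by blast
    have "partition_on R (insert l P')"
      using partition_on_Un[OF partition_on_space[of l] , of "R - l" P'] l
      by (auto simp: Un_absorb1)
    then show "P \<in> ?P R" using l by auto
  qed
  have "weighted_matchings E w R = (\<Sum>l\<in>?L. \<Sum>P\<in>insert l ` ?P (R - l). \<Prod>l\<in>P. w l)"
    unfolding weighted_matchings_def un
  proof (rule sum.UNION_disjoint)
    show "\<forall>i\<in>?L. \<forall>j\<in>?L. i \<noteq> j \<longrightarrow> insert i ` ?P (R - i) \<inter> insert j ` ?P (R - j) = {}"
    proof (intro ballI impI)
      fix i j assume ij: "i \<in> ?L" "j \<in> ?L" "i \<noteq> j"
      show "insert i ` ?P (R - i) \<inter> insert j ` ?P (R - j) = {}"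
      proof (rule ccontr)
        assume "insert i ` ?P (R - i) \<inter> insert j ` ?P (R - j) \<noteq> {}"
        then obtain P1 P2 where P: "P1 \<in> ?P (R - i)" "P2 \<in> ?P (R - j)" "insert i P1 = insert j P2"
          by blast
        then have "i \<in> P2" using ij by auto
        then have "i \<subseteq> R - j" using partition_onD1[of "R - j" P2] P by auto
        then show False using ij by auto
      qed
    qed
    show "\<forall>i\<in>?L. finite (insert i ` ?P (R - i))"
      using assms by (intro ballI finite_imageI finite_partitions) auto
  qed (rule fL)
  also have "\<dots> = (\<Sum>l\<in>?L. w l * weighted_matchings E w (R - l))"
  proof (rule sum.cong[OF refl])
    fix l assume l: "l \<in> ?L"
    have inj: "inj_on (insert l) (?P (R - l))"
      using nin[OF l] by (intro inj_onI) (simp add: insert_ident)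
    have "(\<Sum>P\<in>insert l ` ?P (R - l). \<Prod>l\<in>P. w l) = (\<Sum>P\<in>?P (R - l). \<Prod>l\<in>insert l P. w l)"
      by (subst sum.reindex[OF inj]) simp
    also have "\<dots> = (\<Sum>P\<in>?P (R - l). w l * (\<Prod>l\<in>P. w l))"
    proof (rule sum.cong[OF refl])
      fix P assume P: "P \<in> ?P (R - l)"
      have "finite P" by (rule finite_partition[of "R - l"]) (use P assms in auto)
      then show "(\<Prod>l\<in>insert l P. w l) = w l * (\<Prod>l\<in>P. w l)"
        using nin[OF l P] by simp
    qed
    finally show "(\<Sum>P\<in>insert l ` ?P (R - l). \<Prod>l\<in>P. w l) = w l * weighted_matchings E w (R - l)"
      by (simp add: weighted_matchings_def sum_distrib_left)
  qed
  finally show ?thesis .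
qed

lemma weighted_matchings_expand_edges:
  assumes "finite R" "v \<in> R" "finite L"
    and "\<And>l. l \<in> E \<Longrightarrow> v \<in> l \<Longrightarrow> l \<subseteq> R \<Longrightarrow> l \<in> L"
    and "\<And>l. l \<in> L \<Longrightarrow> l \<in> E \<and> v \<in> l \<and> l \<subseteq> R"
  shows "weighted_matchings E w R = (\<Sum>l\<in>L. w l * weighted_matchings E w (R - l))"
proof -
  have "{l. l \<in> E \<and> v \<in> l \<and> l \<subseteq> R} = L" using assms(4,5) by blast
  then show ?thesis using weighted_matchings_expand[OF assms(1,2)] by simp
qed

text \<open>Induction by expansion at one vertex, so that no partition has to be transported. Since
  edges have two elements, the two edge sets need only be compared on pairs of vertices of
  R.\<close>

lemma weighted_matchings_image:
  assumes "finite R" "inj_on f R"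
    and "\<And>l. l \<in> E \<Longrightarrow> card l = 2" and "\<And>l. l \<in> E' \<Longrightarrow> card l = 2"
    and "\<And>s t. s \<in> R \<Longrightarrow> t \<in> R \<Longrightarrow> {f s, f t} \<in> E' \<longleftrightarrow> {s, t} \<in> E"
    and "\<And>s t. s \<in> R \<Longrightarrow> t \<in> R \<Longrightarrow> {s, t} \<in> E \<Longrightarrow> w' {f s, f t} = w {s, t}"
  shows "weighted_matchings E' w' (f ` R) = weighted_matchings E w R"
  using assms(1,2,5,6)
proof (induction "card R" arbitrary: R rule: less_induct)
  case less
  show ?case
  proof (cases "R = {}")
    case False
    then obtain v where v: "v \<in> R" by auto
    let ?L = "{l. l \<in> E \<and> v \<in> l \<and> l \<subseteq> R}"
    let ?L' = "{l. l \<in> E' \<and> f v \<in> l \<and> l \<subseteq> f ` R}"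
    have L': "?L' = (`) f ` ?L"
    proof (intro equalityI subsetI)
      fix l assume l: "l \<in> ?L'"
      then have "card l = 2" using assms(4) by auto
      with l obtain p q where pq: "l = {p, q}" "p \<noteq> q" by (auto simp: card_2_iff)
      with l obtain s t where st: "s \<in> R" "t \<in> R" "l = {f s, f t}" by auto
      have "{s, t} \<in> E" using less.prems(3)[OF st(1,2)] st l by auto
      moreover have "v \<in> {s, t}" using l st v less.prems(2) by (auto simp: inj_on_def)
      ultimately have "{s, t} \<in> ?L" using st by auto
      then show "l \<in> (`) f ` ?L" using st by (intro image_eqI[of _ _ "{s, t}"]) auto
    next
      fix l assume "l \<in> (`) f ` ?L"
      then obtain l0 where l0: "l = f ` l0" "l0 \<in> ?L" by auto
      then have "card l0 = 2" using assms(3) by auto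
      with l0 obtain p q where pq: "l0 = {p, q}" by (auto simp: card_2_iff)
      then show "l \<in> ?L'" using l0 less.prems(3)[of p q] by auto
    qed
    have inj: "inj_on ((`) f) ?L"
      by (rule inj_on_subset[OF inj_on_image_Pow[OF less.prems(2)]]) auto
    have "weighted_matchings E' w' (f ` R) = (\<Sum>l\<in>?L'. w' l * weighted_matchings E' w' (f ` R - l))"
      by (rule weighted_matchings_expand) (use less.prems v in auto)
    also have "\<dots> = (\<Sum>l\<in>?L. w' (f ` l) * weighted_matchings E' w' (f ` R - f ` l))"
      unfolding L' by (subst sum.reindex[OF inj]) simp
    also have "\<dots> = (\<Sum>l\<in>?L. w l * weighted_matchings E w (R - l))"
    proof (rule sum.cong[OF refl])
      fix l assume l: "l \<in> ?L"
      then have "card l = 2" using assms(3) by auto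
      with l obtain p q where pq: "l = {p, q}" by (auto simp: card_2_iff)
      have "f ` R - f ` l = f ` (R - l)"
        using less.prems(2) l by (auto simp: inj_on_def)
      moreover have "weighted_matchings E' w' (f ` (R - l)) = weighted_matchings E w (R - l)"
      proof (rule less.hyps)
        show "card (R - l) < card R" using l v less.prems(1)
          by (metis (no_types, lifting) Diff_iff card_seteq finite_Diff leI mem_Collect_eq subset_iff Diff_subset)
      qed (use less.prems in \<open>auto simp: inj_on_def\<close>)
      moreover have "w' (f ` l) = w l" using less.prems(4)[of p q] pq l by auto
      ultimately show "w' (f ` l) * weighted_matchings E' w' (f ` R - f ` l) = w l * weighted_matchings E w (R - l)"
        by simp
    qed
    also have "\<dots> = weighted_matchings E w R"
      by (rule weighted_matchings_expand[symmetric]) (use less.prems v in auto)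
    finally show ?thesis .
  qed simp
qed

text \<open>Cutting R into A and B: a matching is determined by the edges across the cut
  and by a matching of what they leave of either side.\<close>

lemma weighted_matchings_cut:
  assumes "finite A" "finite B" "A \<inter> B = {}" "{} \<notin> E"
    and "\<And>l. l \<in> E \<Longrightarrow> l \<subseteq> A \<union> B \<Longrightarrow> l \<in> C \<longleftrightarrow> \<not> l \<subseteq> A \<and> \<not> l \<subseteq> B"
    and "C \<subseteq> E" "\<And>l. l \<in> C \<Longrightarrow> l \<subseteq> A \<union> B" and "disjoint C"
  shows "weighted_matchings E w (A \<union> B) =
    (\<Sum>X\<in>Pow C. (\<Prod>l\<in>X. w l) * (weighted_matchings E w (A - \<Union>X) * weighted_matchings E w (B - \<Union>X)))"
proof -
  let ?P = "\<lambda>R. {P. partition_on R P \<and> P \<subseteq> E}"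
  have fC: "finite C"
    by (rule finite_subset[of _ "Pow (A \<union> B)"]) (use assms(1,2,7) in blast, use assms(1,2) in simp)
  have "weighted_matchings E w (A \<union> B) = (\<Sum>X\<in>Pow C. \<Sum>P\<in>{P \<in> ?P (A \<union> B). P \<inter> C = X}. \<Prod>l\<in>P. w l)"
    unfolding weighted_matchings_def
    by (rule sum.group[symmetric]) (use assms fC in \<open>auto intro: finite_partitions\<close>)
  also have "\<dots> = (\<Sum>X\<in>Pow C. (\<Prod>l\<in>X. w l) * (weighted_matchings E w (A - \<Union>X) * weighted_matchings E w (B - \<Union>X)))"
  proof (rule sum.cong[OF refl])
    fix X assume X: "X \<in> Pow C"
    let ?f = "\<lambda>(P1, P2). X \<union> P1 \<union> P2"
    let ?D = "?P (A - \<Union>X) \<times> ?P (B - \<Union>X)"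
    have Xne: "{} \<notin> X" using X assms by auto
    have Xcr: "\<not> l \<subseteq> A \<and> \<not> l \<subseteq> B \<and> l \<subseteq> A \<union> B" if "l \<in> X" for l
      using that X assms(5)[of l] assms(6,7) by auto
    have sep: "P1 \<inter> C = {}" "P2 \<inter> C = {}" "P1 \<inter> P2 = {}" "X \<inter> P1 = {}" "X \<inter> P2 = {}"
        "\<forall>l\<in>P1. l \<subseteq> A \<and> \<not> l \<subseteq> B" "\<forall>l\<in>P2. l \<subseteq> B \<and> \<not> l \<subseteq> A" "finite P1" "finite P2"
      if P: "partition_on (A - \<Union>X) P1" "P1 \<subseteq> E" "partition_on (B - \<Union>X) P2" "P2 \<subseteq> E" for P1 P2
    proof -
      have 1: "l \<subseteq> A \<and> l \<noteq> {}" if "l \<in> P1" for l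
        using that P(1) by (auto simp: partition_on_def)
      have 2: "l \<subseteq> B \<and> l \<noteq> {}" if "l \<in> P2" for l
        using that P(3) by (auto simp: partition_on_def)
      have AB: "\<not> l \<subseteq> B" if "l \<subseteq> A" "l \<noteq> {}" for l
        using Int_greatest[of l A B] that assms(3) by (metis subset_empty)
      have BA: "\<not> l \<subseteq> A" if "l \<subseteq> B" "l \<noteq> {}" for l
        using Int_greatest[of l A B] that assms(3) by (metis subset_empty)
      show "\<forall>l\<in>P1. l \<subseteq> A \<and> \<not> l \<subseteq> B" using 1 AB by simp
      show "\<forall>l\<in>P2. l \<subseteq> B \<and> \<not> l \<subseteq> A" using 2 BA by simp
      show "P1 \<inter> P2 = {}"
      proof (rule equals0I)
        fix l assume "l \<in> P1 \<inter> P2"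
        then show False using 1[of l] 2[of l] AB[of l] by simp
      qed
      show 4: "P1 \<inter> C = {}"
      proof (rule ccontr)
        assume "P1 \<inter> C \<noteq> {}"
        then obtain l where l: "l \<in> P1" "l \<in> C" by auto
        then show False using 1[OF l(1)] assms(5)[of l] assms(7)[of l] P(2) by auto
      qed
      show 5: "P2 \<inter> C = {}"
      proof (rule ccontr)
        assume "P2 \<inter> C \<noteq> {}"
        then obtain l where l: "l \<in> P2" "l \<in> C" by auto
        then show False using 2[OF l(1)] assms(5)[of l] assms(7)[of l] P(4) by auto
      qed
      show "X \<inter> P1 = {}" "X \<inter> P2 = {}" using 4 5 X by auto
      show "finite P1" by (rule finite_partition[OF _ P(1)]) (use assms in simp)
      show "finite P2" by (rule finite_partition[OF _ P(3)]) (use assms in simp)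
    qed
    \<comment> \<open>The inverse sorts the edges by the side that contains them; edges across the
      cut lie in neither and are exactly X.\<close>
    have bij: "bij_betw ?f ?D {P \<in> ?P (A \<union> B). P \<inter> C = X}"
    proof (rule bij_betwI[where g = "\<lambda>P. ({l\<in>P. l \<subseteq> A}, {l\<in>P. l \<subseteq> B})"])
      show "?f \<in> ?D \<rightarrow> {P \<in> ?P (A \<union> B). P \<inter> C = X}"
      proof (clarsimp, intro conjI)
        fix P1 P2 assume P: "partition_on (A - \<Union>X) P1" "P1 \<subseteq> E" "partition_on (B - \<Union>X) P2" "P2 \<subseteq> E"
        note s = sep[OF P]
        have XAB: "\<Union>X \<subseteq> A \<union> B" using Xcr by (auto simp: Union_subsetI)
        have "disjoint X" using X assms(8) by (auto simp: disjoint_def)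
        then have "partition_on (\<Union>X) X" using Xne by (auto simp: partition_on_def)
        then have "partition_on (\<Union>X \<union> (A - \<Union>X)) (X \<union> P1)"
          by (rule partition_on_Un[OF _ P(1)]) auto
        then have "partition_on ((\<Union>X \<union> (A - \<Union>X)) \<union> (B - \<Union>X)) (X \<union> P1 \<union> P2)"
          by (rule partition_on_Un[OF _ P(3)]) (use assms(3) in auto)
        moreover have "(\<Union>X \<union> (A - \<Union>X)) \<union> (B - \<Union>X) = A \<union> B" using XAB by auto
        ultimately show "partition_on (A \<union> B) (X \<union> P1 \<union> P2)" by simp
        show "X \<subseteq> E" using X assms by auto
        show "(X \<union> P1 \<union> P2) \<inter> C = X" using s(1,2) X by auto
      qed
      show "(\<lambda>P. ({l\<in>P. l \<subseteq> A}, {l\<in>P. l \<subseteq> B})) \<in> {P \<in> ?P (A \<union> B). P \<inter> C = X} \<rightarrow> ?D"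
      proof
        fix P assume "P \<in> {P \<in> ?P (A \<union> B). P \<inter> C = X}"
        then have P: "\<Union>P = A \<union> B" "disjoint P" "{} \<notin> P" "P \<subseteq> E" "P \<inter> C = X"
          by (auto simp: partition_on_def)
        have tri: "l \<in> X \<or> l \<subseteq> A \<or> l \<subseteq> B" if "l \<in> P" for l
        proof -
          have "l \<in> E" "l \<subseteq> A \<union> B" using that P(1,4) by auto
          then show ?thesis using assms(5)[of l] P(5) that by auto
        qed
        have dj: "l = l'" if "l \<in> P" "l' \<in> P" "p \<in> l" "p \<in> l'" for l l' p
          using disjointD[OF P(2) that(1,2)] that(3,4) by auto
        have "\<Union>{l\<in>P. l \<subseteq> A} = A - \<Union>X"
        proof (intro equalityI subsetI)
          fix p assume "p \<in> \<Union>{l\<in>P. l \<subseteq> A}"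
          then obtain l where l: "l \<in> P" "l \<subseteq> A" "p \<in> l" by auto
          then have "p \<notin> l'" if "l' \<in> X" for l' using dj[of l l' p] Xcr[OF that] that P by auto
          then show "p \<in> A - \<Union>X" using l by auto
        next
          fix p assume p: "p \<in> A - \<Union>X"
          then obtain l where l: "l \<in> P" "p \<in> l" using P(1) by blast
          then have "l \<subseteq> A" using tri[of l] p assms(3) by auto
          then show "p \<in> \<Union>{l\<in>P. l \<subseteq> A}" using l by auto
        qed
        moreover have "\<Union>{l\<in>P. l \<subseteq> B} = B - \<Union>X"
        proof (intro equalityI subsetI)
          fix p assume "p \<in> \<Union>{l\<in>P. l \<subseteq> B}"
          then obtain l where l: "l \<in> P" "l \<subseteq> B" "p \<in> l" by auto
          then have "p \<notin> l'" if "l' \<in> X" for l' using dj[of l l' p] Xcr[OF that] that P by auto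
          then show "p \<in> B - \<Union>X" using l by auto
        next
          fix p assume p: "p \<in> B - \<Union>X"
          then obtain l where l: "l \<in> P" "p \<in> l" using P(1) by blast
          then have "l \<subseteq> B" using tri[of l] p assms(3) by auto
          then show "p \<in> \<Union>{l\<in>P. l \<subseteq> B}" using l by auto
        qed
        ultimately show "({l\<in>P. l \<subseteq> A}, {l\<in>P. l \<subseteq> B}) \<in> ?D"
          using P by (auto simp: partition_on_def disjoint_def)
      qed
      fix Q assume Q: "Q \<in> ?D"
      then obtain P1 P2 where Qe: "Q = (P1, P2)"
        and P: "partition_on (A - \<Union>X) P1" "P1 \<subseteq> E" "partition_on (B - \<Union>X) P2" "P2 \<subseteq> E" by auto
      note s = sep[OF P]
      have "{l \<in> X \<union> P1 \<union> P2. l \<subseteq> A} = P1" "{l \<in> X \<union> P1 \<union> P2. l \<subseteq> B} = P2"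
        using s(6,7) Xcr by auto
      then show "(\<lambda>P. ({l\<in>P. l \<subseteq> A}, {l\<in>P. l \<subseteq> B})) (?f Q) = Q" by (simp add: Qe)
    next
      fix P assume "P \<in> {P \<in> ?P (A \<union> B). P \<inter> C = X}"
      then have P: "\<Union>P = A \<union> B" "P \<subseteq> E" "P \<inter> C = X"
        by (auto simp: partition_on_def)
      have tri: "l \<in> X \<or> l \<subseteq> A \<or> l \<subseteq> B" if "l \<in> P" for l
      proof -
        have "l \<in> E" "l \<subseteq> A \<union> B" using that P(1,2) by auto
        then show ?thesis using assms(5)[of l] P(3) that by auto
      qed
      show "?f ({l\<in>P. l \<subseteq> A}, {l\<in>P. l \<subseteq> B}) = P" using tri P(3) by auto
    qed
    have "(\<Sum>P\<in>{P \<in> ?P (A \<union> B). P \<inter> C = X}. \<Prod>l\<in>P. w l) = (\<Sum>(P1, P2)\<in>?D. \<Prod>l\<in>X \<union> P1 \<union> P2. w l)"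
      by (subst sum.reindex_bij_betw[OF bij, symmetric]) (simp add: case_prod_unfold)
    also have "\<dots> = (\<Sum>(P1, P2)\<in>?D. (\<Prod>l\<in>X. w l) * ((\<Prod>l\<in>P1. w l) * (\<Prod>l\<in>P2. w l)))"
    proof (rule sum.cong[OF refl], clarify)
      fix P1 P2 assume P: "partition_on (A - \<Union>X) P1" "P1 \<subseteq> E" "partition_on (B - \<Union>X) P2" "P2 \<subseteq> E"
      have s: "P1 \<inter> P2 = {}" "X \<inter> P1 = {}" "X \<inter> P2 = {}" "finite P1" "finite P2"
        using sep[OF P] by auto
      have "finite X" using X fC by (auto intro: finite_subset)
      then show "(\<Prod>l\<in>X \<union> P1 \<union> P2. w l) = (\<Prod>l\<in>X. w l) * ((\<Prod>l\<in>P1. w l) * (\<Prod>l\<in>P2. w l))"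
        using s by (subst prod.union_disjoint; (subst prod.union_disjoint)?) auto
    qed
    also have "\<dots> = (\<Prod>l\<in>X. w l) * (weighted_matchings E w (A - \<Union>X) * weighted_matchings E w (B - \<Union>X))"
      unfolding weighted_matchings_def sum_product sum.cartesian_product
      by (simp add: sum_distrib_left case_prod_unfold)
    finally show "(\<Sum>P\<in>{P \<in> ?P (A \<union> B). P \<inter> C = X}. \<Prod>l\<in>P. w l) =
      (\<Prod>l\<in>X. w l) * (weighted_matchings E w (A - \<Union>X) * weighted_matchings E w (B - \<Union>X))" .
  qed
  finally show ?thesis .
qed

text \<open>The edges of F are forced one after the other, in the order of their rank rk.\<close>

lemma weighted_matchings_forced:
  assumes "finite R" "{} \<notin> E" "F \<subseteq> E" "\<Union>F \<subseteq> R"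
    and dj: "disjoint F"
    and ex: "\<And>l. l \<in> F \<Longrightarrow> \<exists>t\<in>l. \<forall>l'\<in>E. t \<in> l' \<longrightarrow> l' \<subseteq> R \<longrightarrow> l' \<noteq> l \<longrightarrow>
       (\<exists>l''\<in>F. rk l'' < (rk l :: nat) \<and> l'' \<inter> l' \<noteq> {})"
  shows "weighted_matchings E w R = (\<Prod>l\<in>F. w l) * weighted_matchings E w (R - \<Union>F)"
proof -
  let ?P = "\<lambda>R. {P. partition_on R P \<and> P \<subseteq> E}"
  have fF: "finite F" by (rule finite_subset[of _ "Pow R"]) (use assms in auto)
  \<comment> \<open>Induction on the rank. If another edge covered the witness t, it would meet a
    forced edge of smaller rank, which is already in P and hence equal to it; that forced edge would
    then meet l.\<close>
  have in_all: "l \<in> P" if P: "P \<in> ?P R" and "l \<in> F" for P l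
    using \<open>l \<in> F\<close>
  proof (induction "rk l" arbitrary: l rule: less_induct)
    case less
    obtain t where t: "t \<in> l" and *: "\<forall>l'\<in>E. t \<in> l' \<longrightarrow> l' \<subseteq> R \<longrightarrow> l' \<noteq> l \<longrightarrow>
       (\<exists>l''\<in>F. rk l'' < rk l \<and> l'' \<inter> l' \<noteq> {})"
      using ex[OF less.prems] by blast
    have "t \<in> R" using t less.prems assms(4) by blast
    then obtain l' where l': "l' \<in> P" "t \<in> l'" using P by (auto simp: partition_on_def)
    show ?case
    proof (rule ccontr)
      assume "l \<notin> P"
      then have "l' \<noteq> l" using l' by auto
      moreover have "l' \<in> E" "l' \<subseteq> R" using P l' by (auto simp: partition_on_def)
      ultimately have "\<exists>l''\<in>F. rk l'' < rk l \<and> l'' \<inter> l' \<noteq> {}" using *[rule_format, of l'] l'(2) by simp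
      then obtain l'' where l'': "l'' \<in> F" "rk l'' < rk l" "l'' \<inter> l' \<noteq> {}" by (elim bexE conjE)
      then have "l'' \<in> P" using less.hyps[OF l''(2,1)] by simp
      moreover obtain p where "p \<in> l''" "p \<in> l'" using l'' by blast
      ultimately have "l'' = l'" using l' P partition_on_unique[of R P l'' l' p] by simp
      then have "t \<in> l''" using l' by simp
      then have "l \<inter> l'' \<noteq> {}" using t by blast
      then have "l'' = l" using disjointD[OF dj less.prems l''(1)] by auto
      then show False using l'' by simp
    qed
  qed
  have ne: "{} \<notin> F" using assms by auto
  have notF: "l \<notin> F" if "P \<in> ?P (R - \<Union>F)" "l \<in> P" for l P
  proof
    assume "l \<in> F"
    moreover have "l \<subseteq> R - \<Union>F" "l \<noteq> {}" using that by (auto simp: partition_on_def)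
    ultimately show False by blast
  qed
  have bij: "bij_betw (\<lambda>P. F \<union> P) (?P (R - \<Union>F)) (?P R)"
  proof (rule bij_betwI[where g = "\<lambda>P. P - F"])
    show "(\<lambda>P. F \<union> P) \<in> ?P (R - \<Union>F) \<rightarrow> ?P R"
    proof
      fix P assume P: "P \<in> ?P (R - \<Union>F)"
      have "partition_on (\<Union>F) F" using dj ne by (auto simp: partition_on_def)
      then have "partition_on (\<Union>F \<union> (R - \<Union>F)) (F \<union> P)"
        by (rule partition_on_Un) (use P in auto)
      moreover have "\<Union>F \<union> (R - \<Union>F) = R" using assms(4) by auto
      ultimately show "F \<union> P \<in> ?P R" using P assms(3) by auto
    qed
    show "(\<lambda>P. P - F) \<in> ?P R \<rightarrow> ?P (R - \<Union>F)"
    proof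
      fix P assume P: "P \<in> ?P R"
      have "F \<subseteq> P" using in_all[OF P] by blast
      have dP: "\<And>l l' p. l \<in> P \<Longrightarrow> l' \<in> P \<Longrightarrow> p \<in> l \<Longrightarrow> p \<in> l' \<Longrightarrow> l = l'"
        by (rule partition_on_unique[of R P]) (use P in auto)
      have uP: "\<Union>P = R" using P by (auto simp: partition_on_def)
      have "\<Union>(P - F) = R - \<Union>F"
      proof (intro equalityI subsetI)
        fix p assume "p \<in> \<Union>(P - F)"
        then obtain l where l: "l \<in> P" "l \<notin> F" "p \<in> l" by auto
        then have "p \<notin> l'" if "l' \<in> F" for l' using dP[of l l' p] \<open>F \<subseteq> P\<close> that by auto
        then show "p \<in> R - \<Union>F" using l uP by auto
      qed (use uP in blast)
      then show "P - F \<in> ?P (R - \<Union>F)"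
        using partition_onD2[of R P] partition_onD3[of R P] P
        by (simp add: partition_on_def pairwise_def subset_iff)
    qed
    show "(F \<union> P) - F = P" if "P \<in> ?P (R - \<Union>F)" for P
    proof -
      show ?thesis using notF[OF that] by auto
    qed
    show "F \<union> (P - F) = P" if "P \<in> ?P R" for P
    proof -
      have "F \<subseteq> P" using in_all[OF that] by blast
      then show ?thesis by auto
    qed
  qed
  have "weighted_matchings E w R = (\<Sum>P\<in>?P (R - \<Union>F). \<Prod>l\<in>F \<union> P. w l)"
    unfolding weighted_matchings_def by (rule sum.reindex_bij_betw[OF bij, symmetric])
  also have "\<dots> = (\<Sum>P\<in>?P (R - \<Union>F). (\<Prod>l\<in>F. w l) * (\<Prod>l\<in>P. w l))"
  proof (rule sum.cong[OF refl], rule prod.union_disjoint[OF fF])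
    fix P assume P: "P \<in> ?P (R - \<Union>F)"
    show "finite P" by (rule finite_partition[of "R - \<Union>F"]) (use P assms(1) in auto)
    show "F \<inter> P = {}" using notF[OF P] by auto
  qed
  finally show ?thesis by (simp add: weighted_matchings_def sum_distrib_left)
qed

section \<open>Determinants and the Cauchy-Binet formula\<close>

text \<open>Entries are a function of two indices, so that rows can be replaced and entries
  rewritten without carrying matrix dimensions along.\<close>

definition fdet :: "nat \<Rightarrow> (nat \<Rightarrow> nat \<Rightarrow> real) \<Rightarrow> real" where
  "fdet n f = det (mat n n (\<lambda>(i, j). f i j))"

lemma fdet_leibniz:
  "fdet n f = (\<Sum>p | p permutes {0..<n}. signof p * (\<Prod>i\<in>{0..<n}. f i (p i)))"
proof -
  have "fdet n f = (\<Sum>p | p permutes {0..<n}. signof p * (\<Prod>i\<in>{0..<n}. mat n n (\<lambda>(i, j). f i j) $$ (i, p i)))"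
    unfolding fdet_def by (rule det_def') simp
  also have "\<dots> = (\<Sum>p | p permutes {0..<n}. signof p * (\<Prod>i\<in>{0..<n}. f i (p i)))"
  proof (intro sum.cong refl arg_cong2[of _ _ _ _ "(*)"] prod.cong)
    fix p i assume "p \<in> {p. p permutes {0..<n}}" "i \<in> {0..<n}"
    then have "i < n" "p i < n" using permutes_in_image[of p "{0..<n}" i] by auto
    then show "mat n n (\<lambda>(i, j). f i j) $$ (i, p i) = f i (p i)" by simp
  qed
  finally show ?thesis .
qed

lemma fdet_cong:
  "(\<And>i j. i < n \<Longrightarrow> j < n \<Longrightarrow> f i j = g i j) \<Longrightarrow> fdet n f = fdet n g"
  unfolding fdet_def by (intro arg_cong[of _ _ det] cong_mat) auto

lemma fdet_0 [simp]: "fdet 0 f = 1"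
  by (simp add: fdet_def det_dim_zero)

lemma fdet_row_lin:
  assumes "k < n"
  shows "fdet n (f(k := \<lambda>j. c * u j + d * v j)) = c * fdet n (f(k := u)) + d * fdet n (f(k := v))"
proof -
  have *: "(\<Prod>i\<in>{0..<n}. (f(k := g)) i (p i)) = g (p k) * (\<Prod>i\<in>{0..<n} - {k}. f i (p i))" for g p
    using assms by (subst prod.remove[of _ k]) (auto intro!: prod.cong)
  show ?thesis
    unfolding fdet_leibniz *
    by (simp add: sum_distrib_left sum.distrib[symmetric] algebra_simps)
qed

lemma fdet_scale:
  "fdet n (\<lambda>i j. r i * c j * f i j) = (\<Prod>i<n. r i) * (\<Prod>j<n. c j) * fdet n f"
  unfolding fdet_leibniz sum_distrib_left
proof (rule sum.cong[OF refl])
  fix p assume "p \<in> {p. p permutes {0..<n}}"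
  then have p: "p permutes {0..<n}" by simp
  have "(\<Prod>i\<in>{0..<n}. c (p i)) = (\<Prod>j<n. c j)"
    using prod.permute[OF p, of c] by (simp add: atLeast0LessThan comp_def)
  then show "signof p * (\<Prod>i\<in>{0..<n}. r i * c (p i) * f i (p i)) =
      (\<Prod>i<n. r i) * (\<Prod>j<n. c j) * (signof p * (\<Prod>i\<in>{0..<n}. f i (p i)))"
    by (simp add: prod.distrib atLeast0LessThan)
qed

lemma fdet_eq_rows:
  assumes "i < n" "k < n" "i \<noteq> k" "\<And>j. j < n \<Longrightarrow> f i j = f k j"
  shows "fdet n f = 0"
  unfolding fdet_def
  by (rule det_identical_rows[of _ n i k]) (use assms in \<open>auto intro!: eq_vecI\<close>)

lemma fdet_transpose: "fdet n (\<lambda>i j. f j i) = fdet n f"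
proof -
  have "mat n n (\<lambda>(i, j). f j i) = (mat n n (\<lambda>(i, j). f i j))\<^sup>T"
    by (rule eq_matI) auto
  then show ?thesis unfolding fdet_def
    by (simp add: det_transpose[of _ n])
qed

text \<open>All subtractions refer to the old rows, so together they are multiplication by a unit
  lower triangular matrix. Below, \<open>h\<close> is constantly 0 for Vandermonde determinants and
  the predecessor for Hankel determinants.\<close>

lemma fdet_row_ops:
  assumes "\<And>i. 0 < i \<Longrightarrow> i < n \<Longrightarrow> h i < i"
  shows "fdet n (\<lambda>i j. if i = 0 then f i j else f i j - c i * f (h i) j) = fdet n f"
proof -
  let ?L = "mat n n (\<lambda>(i, k). if k = i then 1 else if 0 < i \<and> k = h i then - c i else 0 :: real)"
  let ?F = "mat n n (\<lambda>(i, j). f i j)"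
  have "mat n n (\<lambda>(i, j). if i = 0 then f i j else f i j - c i * f (h i) j) = ?L * ?F"
  proof (rule eq_matI)
    fix i j assume ij: "i < dim_row (?L * ?F)" "j < dim_col (?L * ?F)"
    then have "(?L * ?F) $$ (i, j) =
        (\<Sum>k\<in>{0..<n}. (if k = i then 1 else if 0 < i \<and> k = h i then - c i else 0) * f k j)"
      by (simp add: scalar_prod_def)
    also have "\<dots> = (\<Sum>k\<in>{0..<n}. (if k = i then f k j else 0) + (if 0 < i \<and> k = h i then - c i * f k j else 0))"
      by (intro sum.cong) (use assms[of i] ij in auto)
    also have "\<dots> = (if i = 0 then f i j else f i j - c i * f (h i) j)"
      using assms[of i] ij by (auto simp: sum.distrib)
    finally show "mat n n (\<lambda>(i, j). if i = 0 then f i j else f i j - c i * f (h i) j) $$ (i, j) =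
        (?L * ?F) $$ (i, j)" using ij by simp
  qed auto
  moreover have "det ?L = 1"
  proof (subst det_lower_triangular[of n])
    show "?L $$ (i, j) = 0" if "i < j" "j < n" for i j using that assms[of i] by auto
    have "diag_mat ?L = replicate n 1" by (auto simp: diag_mat_def intro!: nth_equalityI)
    then show "prod_list (diag_mat ?L) = 1" by (simp only: prod_list_replicate power_one)
  qed auto
  ultimately show ?thesis
    unfolding fdet_def by (simp add: det_mult[of _ n])
qed

lemma fdet_first_col:
  assumes "\<And>i. 0 < i \<Longrightarrow> i < Suc n \<Longrightarrow> f i 0 = 0"
  shows "fdet (Suc n) f = f 0 0 * fdet n (\<lambda>i j. f (Suc i) (Suc j))"
proof -
  let ?A = "mat (Suc n) (Suc n) (\<lambda>(i, j). f i j)"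
  have "det ?A = (\<Sum>i<Suc n. ?A $$ (i, 0) * cofactor ?A i 0)"
    by (rule laplace_expansion_column) auto
  also have "\<dots> = (\<Sum>i\<in>{0}. ?A $$ (i, 0) * cofactor ?A i 0)"
    by (rule sum.mono_neutral_right) (use assms in auto)
  also have "\<dots> = f 0 0 * det (mat_delete ?A 0 0)"
    by (simp add: cofactor_def)
  also have "mat_delete ?A 0 0 = mat n n (\<lambda>(i, j). f (Suc i) (Suc j))"
    by (rule eq_matI) (auto simp: mat_delete_def)
  finally show ?thesis by (simp add: fdet_def)
qed

text \<open>After subtracting the first row, row i is divisible by \<open>X i - X 0\<close>.
  Synthetic division lowers the degree by one and keeps the leading coefficient, so the quotients
  satisfy the hypothesis again.\<close>

lemma fdet_monic_polys:
  assumes "\<And>j. j < n \<Longrightarrow> degree (p j) \<le> j"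
  shows "fdet n (\<lambda>i j. poly (p j) (X i)) = (\<Prod>j<n. coeff (p j) j) * (\<Prod>j<n. \<Prod>i<j. X j - X i)"
  using assms
proof (induction n arbitrary: p X)
  case (Suc n)
  define q where "q j = synthetic_div (p (Suc j)) (X 0)" for j
  have eq: "poly (p (Suc j)) x - poly (p (Suc j)) (X 0) = (x - X 0) * poly (q j) x" for j x
  proof -
    have "poly (p (Suc j) + smult (X 0) (q j)) x = poly (pCons (poly (p (Suc j)) (X 0)) (q j)) x"
      unfolding q_def using synthetic_div_correct[of "p (Suc j)" "X 0"] by simp
    then show ?thesis by (simp add: algebra_simps)
  qed
  have deg: "degree (q j) \<le> j" if "j < n" for j
    using Suc.prems[of "Suc j"] that by (simp add: q_def degree_synthetic_div)
  have lead: "coeff (q j) j = coeff (p (Suc j)) (Suc j)" if "j < n" for j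
  proof -
    have "coeff (p (Suc j) + smult (X 0) (q j)) (Suc j) = coeff (pCons (poly (p (Suc j)) (X 0)) (q j)) (Suc j)"
      unfolding q_def using synthetic_div_correct[of "p (Suc j)" "X 0"] by simp
    moreover have "coeff (q j) (Suc j) = 0"
      using deg[OF that] by (simp add: coeff_eq_0)
    ultimately show ?thesis by simp
  qed
  have c0: "poly (p 0) x = coeff (p 0) 0" for x
  proof -
    have "degree (p 0) = 0" using Suc.prems[of 0] by simp
    then obtain a where "p 0 = [:a:]" by (metis degree_0_id degree_eq_zeroE)
    then show ?thesis by simp
  qed
  have "fdet (Suc n) (\<lambda>i j. poly (p j) (X i)) =
      fdet (Suc n) (\<lambda>i j. if i = 0 then poly (p j) (X i) else poly (p j) (X i) - 1 * poly (p j) (X 0))"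
    by (rule fdet_row_ops[symmetric, where h = "\<lambda>_. 0" and c = "\<lambda>_. 1"]) simp
  also have "\<dots> = coeff (p 0) 0 * fdet n (\<lambda>i j. poly (p (Suc j)) (X (Suc i)) - 1 * poly (p (Suc j)) (X 0))"
    by (subst fdet_first_col) (simp_all add: c0)
  also have "fdet n (\<lambda>i j. poly (p (Suc j)) (X (Suc i)) - 1 * poly (p (Suc j)) (X 0)) =
      fdet n (\<lambda>i j. (X (Suc i) - X 0) * 1 * poly (q j) (X (Suc i)))"
    by (intro fdet_cong) (simp add: eq)
  also have "\<dots> = (\<Prod>i<n. X (Suc i) - X 0) * ((\<Prod>j<n. coeff (q j) j) * (\<Prod>j<n. \<Prod>i<j. X (Suc j) - X (Suc i)))"
    by (subst fdet_scale, subst Suc.IH) (use deg in auto)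
  also have "(\<Prod>j<n. coeff (q j) j) = (\<Prod>j<n. coeff (p (Suc j)) (Suc j))"
    by (intro prod.cong) (auto simp: lead)
  finally show ?case
    by (simp add: prod.lessThan_Suc_shift prod.distrib mult_ac del: prod.lessThan_Suc)
qed simp

text \<open>The value 0 for a list of the wrong length is the combinatorial truth: with a wrong
  number of dents there is no matching.\<close>

definition rows_det :: "nat \<Rightarrow> (nat \<Rightarrow> real) list \<Rightarrow> real" where
  "rows_det e rs = (if length rs = e then fdet e (\<lambda>i. rs ! i) else 0)"

lemma rows_det_lin:
  assumes "\<And>j. r j = c * u j + d * v j"
  shows "rows_det e (xs @ r # ys) = c * rows_det e (xs @ u # ys) + d * rows_det e (xs @ v # ys)"
proof (cases "length xs + Suc (length ys) = e")
  case True
  have r: "r = (\<lambda>j. c * u j + d * v j)" using assms by auto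
  have *: "(\<lambda>i. (xs @ w # ys) ! i) = (\<lambda>i. (xs @ r # ys) ! i)(length xs := w)" for w
    by (auto simp: nth_append fun_eq_iff nth_Cons')
  show ?thesis
    using True by (simp add: rows_det_def *[of u] *[of v])
      (subst *[of r], subst r, rule fdet_row_lin, simp)
qed (simp add: rows_det_def)

lemma rows_det_add:
  assumes "\<And>j. r j = u j + v j"
  shows "rows_det e (xs @ r # ys) = rows_det e (xs @ u # ys) + rows_det e (xs @ v # ys)"
  using rows_det_lin[of r 1 u 1 v] assms by simp

lemma rows_det_zero_row:
  assumes "\<And>j. r j = 0"
  shows "rows_det e (xs @ r # ys) = 0"
  using rows_det_lin[of r 0 r 0 r] assms by simp

lemma rows_det_eq_rows: "rows_det e (xs @ r # r # ys) = 0"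
  unfolding rows_det_def
  by (simp, intro impI fdet_eq_rows[of "length xs" _ "Suc (length xs)"])
    (auto simp: nth_append)

text \<open>The effect of a new exit at the west boundary: it becomes column 0, and starting points
  above it cannot reach it.\<close>

lemma rows_det_first_col:
  "rows_det (Suc e) (case_nat 1 u # map (case_nat 0) vs) = rows_det e vs"
  unfolding rows_det_def by (simp, intro impI, subst fdet_first_col) (auto intro!: fdet_cong)

lemma rows_det_zero_col:
  "rows_det (Suc e) (map (case_nat 0) vs) = 0"
  unfolding rows_det_def
proof (simp, intro impI)
  assume l: "length vs = Suc e"
  have "fdet (Suc e) (\<lambda>i. map (case_nat 0) vs ! i) =
      (map (case_nat 0) vs ! 0) 0 * fdet e (\<lambda>i j. (map (case_nat 0) vs ! Suc i) (Suc j))"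
    by (rule fdet_first_col) (use l in auto)
  then show "fdet (Suc e) (\<lambda>i. map (case_nat 0) vs ! i) = 0" using l by (cases vs) auto
qed

section \<open>The Cauchy-Binet formula\<close>

lemma fdet_sum_rows:
  assumes "finite W"
  shows "fdet n (\<lambda>i j. \<Sum>s\<in>W. P i s * G j s) =
    (\<Sum>f\<in>{0..<n} \<rightarrow>\<^sub>E W. (\<Prod>i\<in>{0..<n}. P i (f i)) * fdet n (\<lambda>i j. G j (f i)))"
proof -
  have "fdet n (\<lambda>i j. \<Sum>s\<in>W. P i s * G j s) =
     (\<Sum>p | p permutes {0..<n}. \<Sum>f\<in>{0..<n} \<rightarrow>\<^sub>E W. signof p * (\<Prod>i\<in>{0..<n}. P i (f i) * G (p i) (f i)))"
    unfolding fdet_leibniz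
    by (intro sum.cong refl, subst prod_sum_PiE) (use assms in \<open>auto simp: sum_distrib_left\<close>)
  also have "\<dots> = (\<Sum>f\<in>{0..<n} \<rightarrow>\<^sub>E W. (\<Prod>i\<in>{0..<n}. P i (f i)) * fdet n (\<lambda>i j. G j (f i)))"
    unfolding fdet_leibniz
    by (subst sum.swap) (simp add: sum_distrib_left prod.distrib mult_ac)
  finally show ?thesis .
qed

definition enum :: "nat set \<Rightarrow> nat \<Rightarrow> nat" where
  "enum S i = sorted_list_of_set S ! i"

lemma bij_betw_enum:
  assumes "finite S" "card S = n"
  shows "bij_betw (enum S) {0..<n} S"
  using bij_betw_nth[of "sorted_list_of_set S" "{..<n}" S] assms
  by (simp add: enum_def[abs_def] atLeast0LessThan)

text \<open>A map of n indices onto an n-element set is the increasing enumeration after a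
  permutation. Members of the function space are undefined outside the indices, so F may depend only
  on values at indices below n.\<close>

lemma sum_surjections_eq_sum_permutations:
  assumes "finite S" "card S = n"
    and "\<And>f g. (\<And>i. i < n \<Longrightarrow> f i = g i) \<Longrightarrow> F f = (F g :: real)"
  shows "(\<Sum>f | f \<in> {0..<n} \<rightarrow>\<^sub>E W \<and> f ` {0..<n} = S. F f) = (\<Sum>p | p permutes {0..<n} \<and> S \<subseteq> W. F (\<lambda>i. enum S (p i)))"
proof (cases "S \<subseteq> W")
  case True
  note b = bij_betw_enum[OF assms(1,2)]
  let ?r = "\<lambda>p. restrict (\<lambda>i. enum S (p i)) {0..<n}"
  have "(\<Sum>f\<in>?r ` {p. p permutes {0..<n}}. F f) = (\<Sum>p | p permutes {0..<n}. F (?r p))"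
  proof (rule sum.reindex_cong[OF _ refl refl], rule inj_onI)
    fix p q assume pq: "p \<in> {p. p permutes {0..<n}}" "q \<in> {p. p permutes {0..<n}}" "?r p = ?r q"
    show "p = q"
    proof
      fix i show "p i = q i"
      proof (cases "i < n")
        case True
        then have "enum S (p i) = enum S (q i)" using fun_cong[OF pq(3), of i] by simp
        moreover have "p i \<in> {0..<n}" "q i \<in> {0..<n}"
          using pq True permutes_in_image[of p "{0..<n}" i] permutes_in_image[of q "{0..<n}" i] by auto
        ultimately show ?thesis using b by (auto simp: bij_betw_def dest: inj_onD)
      next
        case False
        then show ?thesis
          using pq permutes_not_in[of p "{0..<n}" i] permutes_not_in[of q "{0..<n}" i] by simp
      qed
    qed
  qed
  moreover have "?r ` {p. p permutes {0..<n}} = {f. f \<in> {0..<n} \<rightarrow>\<^sub>E W \<and> f ` {0..<n} = S}"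
  proof (intro equalityI subsetI)
    fix f assume "f \<in> ?r ` {p. p permutes {0..<n}}"
    then obtain p where p: "p permutes {0..<n}" "f = ?r p" by auto
    have "f ` {0..<n} = enum S ` (p ` {0..<n})" using p(2) by force
    also have "\<dots> = S" using permutes_image[OF p(1)] b by (simp add: bij_betw_def)
    finally show "f \<in> {f. f \<in> {0..<n} \<rightarrow>\<^sub>E W \<and> f ` {0..<n} = S}"
      using p True by auto
  next
    fix f assume f: "f \<in> {f. f \<in> {0..<n} \<rightarrow>\<^sub>E W \<and> f ` {0..<n} = S}"
    have injf: "inj_on f {0..<n}" by (rule eq_card_imp_inj_on) (use f assms in auto)
    define p where "p i = (if i < n then the_inv_into {0..<n} (enum S) (f i) else i)" for i
    have ei: "enum S (p i) = f i" "p i < n" if "i < n" for i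
    proof -
      have "f i \<in> S" using f that by auto
      then show "enum S (p i) = f i" "p i < n"
        using b f_the_inv_into_f_bij_betw[OF b, of "f i"] bij_betw_the_inv_into[OF b] that
        by (auto simp: p_def bij_betw_def)
    qed
    have "inj_on p {0..<n}"
      using injf ei by (intro inj_onI) (metis atLeastLessThan_iff inj_onD)
    moreover have "p ` {0..<n} \<subseteq> {0..<n}" using ei by auto
    ultimately have "bij_betw p {0..<n} {0..<n}"
      by (simp add: bij_betw_def endo_inj_surj)
    then have "p permutes {0..<n}"
      by (rule bij_imp_permutes) (simp add: p_def)
    moreover have "f = ?r p"
    proof
      fix i show "f i = ?r p i" using f ei[of i] by (cases "i < n") (auto simp: PiE_def extensional_def)
    qed
    ultimately show "f \<in> ?r ` {p. p permutes {0..<n}}" by auto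
  qed
  moreover have "F (?r p) = F (\<lambda>i. enum S (p i))" for p
    by (rule assms(3)) simp
  ultimately show ?thesis using True by simp
next
  case False
  have "f ` {0..<n} \<subseteq> W" if "f \<in> {0..<n} \<rightarrow>\<^sub>E W" for f using that by auto
  then have "{f. f \<in> {0..<n} \<rightarrow>\<^sub>E W \<and> f ` {0..<n} = S} = {}" using False by auto
  then show ?thesis using False by (simp only: sum.empty) simp
qed

text \<open>In the expansion over all maps into W, non-injective maps give two equal rows,
  and injective ones are increasing enumerations up to a permutation.\<close>

lemma cauchy_binet:
  assumes "finite W"
  shows "fdet n (\<lambda>i j. \<Sum>s\<in>W. P i s * G j s) =
    (\<Sum>S | S \<subseteq> W \<and> card S = n. fdet n (\<lambda>i j. P j (enum S i)) * fdet n (\<lambda>i j. G j (enum S i)))"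
proof -
  let ?t = "\<lambda>f. (\<Prod>i\<in>{0..<n}. P i (f i)) * fdet n (\<lambda>i j. G j (f i))"
  have "fdet n (\<lambda>i j. \<Sum>s\<in>W. P i s * G j s) = (\<Sum>f\<in>{0..<n} \<rightarrow>\<^sub>E W. ?t f)"
    by (rule fdet_sum_rows[OF assms])
  also have "\<dots> = (\<Sum>S\<in>Pow W. \<Sum>f | f \<in> {0..<n} \<rightarrow>\<^sub>E W \<and> f ` {0..<n} = S. ?t f)"
    by (rule sum.group[symmetric]) (use assms in \<open>auto intro: finite_PiE\<close>)
  also have "\<dots> = (\<Sum>S | S \<subseteq> W \<and> card S = n. \<Sum>f | f \<in> {0..<n} \<rightarrow>\<^sub>E W \<and> f ` {0..<n} = S. ?t f)"
  proof (rule sum.mono_neutral_right)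
    show "\<forall>S\<in>Pow W - {S. S \<subseteq> W \<and> card S = n}. (\<Sum>f | f \<in> {0..<n} \<rightarrow>\<^sub>E W \<and> f ` {0..<n} = S. ?t f) = 0"
    proof (intro ballI sum.neutral)
      fix S f assume S: "S \<in> Pow W - {S. S \<subseteq> W \<and> card S = n}"
        and f: "f \<in> {f. f \<in> {0..<n} \<rightarrow>\<^sub>E W \<and> f ` {0..<n} = S}"
      have "\<not> inj_on f {0..<n}" using S f card_image[of f "{0..<n}"] by auto
      then obtain i k where ik: "i < n" "k < n" "i \<noteq> k" "f i = f k" by (auto simp: inj_on_def)
      then have "fdet n (\<lambda>i j. G j (f i)) = 0" by (intro fdet_eq_rows[of i n k]) auto
      then show "?t f = 0" by simp
    qed
  qed (use assms in auto)
  also have "\<dots> = (\<Sum>S | S \<subseteq> W \<and> card S = n. fdet n (\<lambda>i j. P j (enum S i)) * fdet n (\<lambda>i j. G j (enum S i)))"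
  proof (rule sum.cong[OF refl])
    fix S assume S: "S \<in> {S. S \<subseteq> W \<and> card S = n}"
    have "(\<Sum>f | f \<in> {0..<n} \<rightarrow>\<^sub>E W \<and> f ` {0..<n} = S. ?t f) =
        (\<Sum>p | p permutes {0..<n} \<and> S \<subseteq> W. ?t (\<lambda>i. enum S (p i)))"
      by (rule sum_surjections_eq_sum_permutations)
        (use S assms in \<open>auto intro: finite_subset intro!: arg_cong2[of _ _ _ _ "(*)"] prod.cong fdet_cong\<close>)
    \<comment> \<open>Sorting the rows costs the sign of p, and this sign completes the products of
      P to the Leibniz formula of a second determinant.\<close>
    also have "\<dots> = (\<Sum>p | p permutes {0..<n}. signof p * (\<Prod>i\<in>{0..<n}. P i (enum S (p i))) * fdet n (\<lambda>i j. G j (enum S i)))"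
    proof (rule sum.cong)
      show "{p. p permutes {0..<n} \<and> S \<subseteq> W} = {p. p permutes {0..<n}}" using S by auto
      fix p assume "p \<in> {p. p permutes {0..<n}}"
      then have p: "p permutes {0..<n}" by simp
      have lt: "p i < n" if "i < n" for i
        using permutes_in_image[OF p, of i] that by auto
      have "fdet n (\<lambda>i j. G j (enum S (p i))) = signof p * fdet n (\<lambda>i j. G j (enum S i))"
        unfolding fdet_def
        by (subst det_permute_rows[OF _ p, symmetric]) (auto simp: lt intro!: arg_cong[of _ _ det] cong_mat)
      then show "?t (\<lambda>i. enum S (p i)) = signof p * (\<Prod>i\<in>{0..<n}. P i (enum S (p i))) * fdet n (\<lambda>i j. G j (enum S i))"
        by simp
    qed
    also have "\<dots> = fdet n (\<lambda>i j. P i (enum S j)) * fdet n (\<lambda>i j. G j (enum S i))"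
      by (simp add: fdet_leibniz[of n "\<lambda>i j. P i (enum S j)"] sum_distrib_right)
    also have "fdet n (\<lambda>i j. P i (enum S j)) = fdet n (\<lambda>i j. P j (enum S i))"
      by (rule fdet_transpose)
    finally show "(\<Sum>f | f \<in> {0..<n} \<rightarrow>\<^sub>E W \<and> f ` {0..<n} = S. ?t f) =
      fdet n (\<lambda>i j. P j (enum S i)) * fdet n (\<lambda>i j. G j (enum S i))" .
  qed
  finally show ?thesis .
qed

section \<open>Matchings of trapezoids as determinants\<close>

text \<open>
  Cells are addressed by the number j of strips above the horizontal line that carries their
  horizontal side, and by the position i of that side on the line, counted from the west boundary.
\<close>

datatype cell = UpC nat nat | DnC nat nat

fun cell_adj :: "cell \<Rightarrow> cell \<Rightarrow> bool" where
  "cell_adj (UpC j i) (DnC j' i') \<longleftrightarrow> (j = j' \<and> i = i') \<or>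
     (j = Suc j' \<and> (i = i' \<or> odd j' \<and> i' = Suc i \<or> even j' \<and> i = Suc i'))"
| "cell_adj _ _ \<longleftrightarrow> False"

definition cell_edges :: "cell set set" where
  "cell_edges = {{s, t} |s t. cell_adj s t}"

definition cell_weight :: "real \<Rightarrow> cell set \<Rightarrow> real" where
  "cell_weight \<omega> l = (if \<exists>j. odd j \<and> l = {UpC j 0, DnC j 0} then \<omega> else 1)"

definition trapezoid :: "nat \<Rightarrow> nat \<Rightarrow> nat set \<Rightarrow> cell set" where
  "trapezoid c k V =
    {UpC j i |j i. 1 \<le> j \<and> j \<le> k \<and> i < c + (j + 1) div 2 \<and> \<not> (j = k \<and> i \<in> V)} \<union>
    {DnC j i |j i. j < k \<and> i < c + (j + 1) div 2}"

text \<open>A partly consumed lowest strip, with n up-pointing and n' down-pointing cells left at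
  its west end, on top of which j strips are still intact. V' collects the base positions of these
  strips already used from below.\<close>

definition strip :: "nat \<Rightarrow> nat \<Rightarrow> nat \<Rightarrow> nat \<Rightarrow> nat set \<Rightarrow> nat set \<Rightarrow> cell set" where
  "strip c j n n' V V' = {UpC (Suc j) i |i. i < n \<and> i \<notin> V} \<union> {DnC j i |i. i < n'} \<union> trapezoid c j V'"

text \<open>
  The weights of the lattice paths from position p on the base of j strips to the west boundary.
  Every second strip has one exit there, and column 0 belongs to the lowest one.
\<close>

fun level_row :: "real \<Rightarrow> nat \<Rightarrow> nat \<Rightarrow> nat \<Rightarrow> real" where
  "level_row \<omega> 0 p = (\<lambda>_. 0)"
| "level_row \<omega> (Suc j) p =
    (if even j then case_nat 1 (\<lambda>col. \<Sum>q<p. level_row \<omega> j q col)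
     else (\<lambda>col. \<Sum>q\<le>p. (if q = 0 then \<omega> else 1) * level_row \<omega> j q col))"

declare level_row.simps(2) [simp del]

lemma finite_trapezoid: "finite (trapezoid c k V)"
proof (rule finite_subset)
  let ?N = "c + (k + 1) div 2"
  have "i < ?N" if "i < c + (j + 1) div 2" "j \<le> k" for i j
  proof -
    have "(j + 1) div 2 \<le> (k + 1) div 2" using that by (intro div_le_mono) simp
    then show ?thesis using that by simp
  qed
  then show "trapezoid c k V \<subseteq> (\<Union>j\<in>{..k}. UpC j ` {..<?N} \<union> DnC j ` {..<?N})"
    unfolding trapezoid_def by fastforce
qed auto

lemma finite_strip: "finite (strip c j n n' V V')"
  by (simp add: strip_def finite_trapezoid)

lemma cell_edgesI: "cell_adj s t \<Longrightarrow> {s, t} \<in> cell_edges"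
  by (auto simp: cell_edges_def)

lemma cell_edge_iff_dn:
  "l \<in> cell_edges \<and> DnC j i \<in> l \<longleftrightarrow>
    l = {UpC j i, DnC j i} \<or> l = {UpC (Suc j) i, DnC j i} \<or>
    (odd j \<and> (\<exists>i'. i = Suc i' \<and> l = {UpC (Suc j) i', DnC j i})) \<or>
    (even j \<and> l = {UpC (Suc j) (Suc i), DnC j i})"
proof
  assume "l \<in> cell_edges \<and> DnC j i \<in> l"
  then obtain s t where st: "l = {s, t}" "cell_adj s t" "DnC j i \<in> l" by (auto simp: cell_edges_def)
  then show "l = {UpC j i, DnC j i} \<or> l = {UpC (Suc j) i, DnC j i} \<or>
    (odd j \<and> (\<exists>i'. i = Suc i' \<and> l = {UpC (Suc j) i', DnC j i})) \<or>
    (even j \<and> l = {UpC (Suc j) (Suc i), DnC j i})"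
    by (cases s; cases t) auto
next
  assume "l = {UpC j i, DnC j i} \<or> l = {UpC (Suc j) i, DnC j i} \<or>
    (odd j \<and> (\<exists>i'. i = Suc i' \<and> l = {UpC (Suc j) i', DnC j i})) \<or>
    (even j \<and> l = {UpC (Suc j) (Suc i), DnC j i})"
  then show "l \<in> cell_edges \<and> DnC j i \<in> l"
    by (elim disjE conjE exE) (simp_all add: cell_edgesI)
qed

lemma cell_edge_iff_up:
  "l \<in> cell_edges \<and> UpC j i \<in> l \<longleftrightarrow>
    l = {UpC j i, DnC j i} \<or>
    (\<exists>j'. j = Suc j' \<and> (l = {UpC j i, DnC j' i} \<or>
    (odd j' \<and> l = {UpC j i, DnC j' (Suc i)}) \<or>
    (even j' \<and> (\<exists>i'. i = Suc i' \<and> l = {UpC j i, DnC j' i'}))))"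
proof
  assume "l \<in> cell_edges \<and> UpC j i \<in> l"
  then obtain s t where st: "l = {s, t}" "cell_adj s t" "UpC j i \<in> l" by (auto simp: cell_edges_def)
  then show "l = {UpC j i, DnC j i} \<or>
    (\<exists>j'. j = Suc j' \<and> (l = {UpC j i, DnC j' i} \<or>
    (odd j' \<and> l = {UpC j i, DnC j' (Suc i)}) \<or>
    (even j' \<and> (\<exists>i'. i = Suc i' \<and> l = {UpC j i, DnC j' i'}))))"
    by (cases s; cases t) auto
next
  assume "l = {UpC j i, DnC j i} \<or>
    (\<exists>j'. j = Suc j' \<and> (l = {UpC j i, DnC j' i} \<or>
    (odd j' \<and> l = {UpC j i, DnC j' (Suc i)}) \<or>
    (even j' \<and> (\<exists>i'. i = Suc i' \<and> l = {UpC j i, DnC j' i'}))))"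
  then show "l \<in> cell_edges \<and> UpC j i \<in> l"
    by (elim disjE conjE exE) (simp_all add: cell_edgesI)
qed

lemma cell_weight_vertical:
  "cell_weight \<omega> {UpC j i, DnC j i} = (if odd j \<and> i = 0 then \<omega> else 1)"
  by (auto simp: cell_weight_def doubleton_eq_iff)

lemma cell_weight_other:
  "cell_weight \<omega> {UpC (Suc j) i, DnC j i'} = 1"
  by (auto simp: cell_weight_def doubleton_eq_iff)

lemma sorted_list_of_set_append:
  fixes A B :: "nat set"
  assumes "finite A" "finite B" "\<And>a b. a \<in> A \<Longrightarrow> b \<in> B \<Longrightarrow> a < b"
  shows "sorted_list_of_set (A \<union> B) = sorted_list_of_set A @ sorted_list_of_set B"
proof -
  let ?l = "sorted_list_of_set A @ sorted_list_of_set B"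
  have "sorted ?l" "distinct ?l"
    using assms by (fastforce simp: sorted_append)+
  then have "sorted_list_of_set (set ?l) = ?l"
    by (rule sorted_list_of_set.idem_if_sorted_distinct)
  then show ?thesis using assms by simp
qed

lemma sorted_list_of_set_snoc:
  assumes "V \<subseteq> {..<n :: nat}"
  shows "sorted_list_of_set (insert n V) = sorted_list_of_set V @ [n]"
proof -
  have "finite V" using assms by (rule finite_subset) simp
  then have "sorted_list_of_set (V \<union> {n}) = sorted_list_of_set V @ sorted_list_of_set {n}"
    by (rule sorted_list_of_set_append) (use assms in auto)
  then show ?thesis by (simp only: Un_insert_right Un_empty_right) simp
qed

lemma sorted_list_of_set_cons:
  assumes "V \<subseteq> {Suc n..<k}"
  shows "sorted_list_of_set (insert n V) = n # sorted_list_of_set V"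
proof -
  have "finite V" using assms by (rule finite_subset) simp
  then have "sorted_list_of_set ({n} \<union> V) = sorted_list_of_set {n} @ sorted_list_of_set V"
    by (intro sorted_list_of_set_append) (use assms in auto)
  then show ?thesis by (simp only: Un_insert_left Un_empty_left) simp
qed

section \<open>Recursion over the cells of a strip\<close>

abbreviation trapezoid_matchings :: "real \<Rightarrow> nat \<Rightarrow> nat \<Rightarrow> nat set \<Rightarrow> real" where
  "trapezoid_matchings \<omega> c k V \<equiv> weighted_matchings cell_edges (cell_weight \<omega>) (trapezoid c k V)"

text \<open>
  A strip is consumed cell by cell from its east end. The lists of rows change in a single place,
  where the defining sum of the row splits off its last term.
\<close>

lemma strip_matchings_odd:
  assumes "odd j" and W: "W = c + (j + 1) div 2"
    and IH: "\<And>V'. V' \<subseteq> {..<W} \<Longrightarrow>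
      trapezoid_matchings \<omega> c j V' = rows_det e (map (level_row \<omega> j) (sorted_list_of_set V'))"
  shows "n \<le> W \<Longrightarrow> V \<subseteq> {..<n} \<Longrightarrow> V' \<subseteq> {n..<W} \<Longrightarrow>
    weighted_matchings cell_edges (cell_weight \<omega>) (strip c j n n V V') =
      rows_det e (map (level_row \<omega> (Suc j)) (sorted_list_of_set V) @ map (level_row \<omega> j) (sorted_list_of_set V'))"
proof (induction n arbitrary: V V')
  case 0
  then have "V = {}" "V' \<subseteq> {..<W}" "strip c j 0 0 V V' = trapezoid c j V'" by (auto simp: strip_def)
  then show ?case using IH by simp
next
  case (Suc n)
  let ?w = "cell_weight \<omega>" let ?R = "strip c j (Suc n) (Suc n) V V'"
  let ?M = "weighted_matchings cell_edges ?w"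
  have j: "1 \<le> j" using \<open>odd j\<close> by (cases j) auto
  show ?case
  proof (cases "n \<in> V")
    \<comment> \<open>The easternmost up-pointing cell has a single neighbour left, which forces its
      lozenge and leaves V and V' alone.\<close>
    case False
    have V: "V \<subseteq> {..<n}" using Suc.prems(2) False by (auto simp: less_Suc_eq)
    have "?M ?R = (\<Sum>l\<in>{{UpC (Suc j) n, DnC j n}}. ?w l * ?M (?R - l))"
    proof (rule weighted_matchings_expand_edges[where v = "UpC (Suc j) n"])
      fix l assume "l \<in> cell_edges" "UpC (Suc j) n \<in> l" "l \<subseteq> ?R"
      then show "l \<in> {{UpC (Suc j) n, DnC j n}}"
        using cell_edge_iff_up[of l "Suc j" n] \<open>odd j\<close> by (auto simp: strip_def trapezoid_def)
    next
      fix l assume "l \<in> {{UpC (Suc j) n, DnC j n}}"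
      then show "l \<in> cell_edges \<and> UpC (Suc j) n \<in> l \<and> l \<subseteq> ?R"
        using cell_edge_iff_up[of l "Suc j" n] False by (auto simp: strip_def)
    qed (use False in \<open>auto simp: finite_strip, auto simp: strip_def\<close>)
    moreover have "?R - {UpC (Suc j) n, DnC j n} = strip c j n n V V'"
      unfolding strip_def trapezoid_def by auto
    moreover have "?M (strip c j n n V V') =
      rows_det e (map (level_row \<omega> (Suc j)) (sorted_list_of_set V) @ map (level_row \<omega> j) (sorted_list_of_set V'))"
      by (rule Suc.IH) (use Suc.prems V in auto)
    ultimately show ?thesis by (simp add: cell_weight_other)
  next
    case True
    define V0 where "V0 = V - {n}"
    have V: "V = insert n V0" "V0 \<subseteq> {..<n}" "n \<notin> V0"
      using True Suc.prems(2) by (auto simp: V0_def less_Suc_eq)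
    let ?xs = "map (level_row \<omega> (Suc j)) (sorted_list_of_set V0)"
    let ?ys = "map (level_row \<omega> j) (sorted_list_of_set V')"
    let ?a = "if n = 0 then \<omega> else 1"
    let ?l1 = "{UpC j n, DnC j n}" let ?l2 = "{UpC (Suc j) (n - 1), DnC j n}"
    have nV': "n \<notin> V'" using Suc.prems(3) by auto
    have slV: "sorted_list_of_set V = sorted_list_of_set V0 @ [n]"
      using sorted_list_of_set_snoc[OF V(2)] V(1) by simp
    \<comment> \<open>The last down-pointing cell is matched either across its horizontal side,
      which adds n to V', or with the up-pointing cell to its west, which moves the dent from n to n
      - 1.\<close>
    let ?L = "{?l1} \<union> (if 0 < n \<and> n - 1 \<notin> V0 then {?l2} else {})"
    have "?M ?R = (\<Sum>l\<in>?L. ?w l * ?M (?R - l))"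
    proof (rule weighted_matchings_expand_edges[where v = "DnC j n"])
      fix l assume "l \<in> cell_edges" "DnC j n \<in> l" "l \<subseteq> ?R"
      then show "l \<in> ?L"
        using cell_edge_iff_dn[of l j n] \<open>odd j\<close> V by (auto simp: strip_def trapezoid_def)
    next
      fix l assume l: "l \<in> ?L"
      then have "l = ?l1 \<or> 0 < n \<and> n - 1 \<notin> V0 \<and> l = ?l2" by (auto split: if_splits)
      moreover have "UpC j n \<in> ?R" "DnC j n \<in> ?R"
        using j nV' Suc.prems(1) W by (auto simp: strip_def trapezoid_def)
      moreover have "UpC (Suc j) (n - 1) \<in> ?R" if "0 < n" "n - 1 \<notin> V0"
        using that V by (auto simp: strip_def)
      ultimately show "l \<in> cell_edges \<and> DnC j n \<in> l \<and> l \<subseteq> ?R"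
        using cell_edge_iff_dn[of l j n] \<open>odd j\<close> by (cases n) auto
    qed (auto simp: finite_strip, auto simp: strip_def)
    moreover have "?R - ?l1 = strip c j n n V0 (insert n V')"
      unfolding strip_def trapezoid_def using V by (auto simp: less_Suc_eq)
    moreover have "?R - ?l2 = strip c j n n (insert (n - 1) V0) V'" if "0 < n"
      unfolding strip_def trapezoid_def using V that by (auto simp: less_Suc_eq)
    moreover have "?M (strip c j n n V0 (insert n V')) =
        rows_det e (?xs @ level_row \<omega> j n # ?ys)"
      by (subst Suc.IH) (use Suc.prems V in \<open>auto simp: sorted_list_of_set_cons\<close>)
    moreover have "?M (strip c j n n (insert (n - 1) V0) V') =
        rows_det e (?xs @ level_row \<omega> (Suc j) (n - 1) # ?ys)" if n: "0 < n" "n - 1 \<notin> V0"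
    proof -
      have V0: "V0 \<subseteq> {..<n - 1}"
      proof
        fix v assume "v \<in> V0"
        then have "v < n" "v \<noteq> n - 1" using V n by auto
        then show "v \<in> {..<n - 1}" by auto
      qed
      show ?thesis
        by (subst Suc.IH) (use Suc.prems V n V0 in \<open>auto simp: sorted_list_of_set_snoc\<close>)
    qed
    moreover have "rows_det e (?xs @ level_row \<omega> (Suc j) (n - 1) # ?ys) = 0" if n: "0 < n" "n - 1 \<in> V0"
    proof -
      have "V0 = insert (n - 1) (V0 - {n - 1})" using n by auto
      moreover have "V0 - {n - 1} \<subseteq> {..<n - 1}"
      proof
        fix v assume "v \<in> V0 - {n - 1}"
        then have "v < n" "v \<noteq> n - 1" using V n by auto
        then show "v \<in> {..<n - 1}" by auto
      qed
      ultimately have "sorted_list_of_set V0 = sorted_list_of_set (V0 - {n - 1}) @ [n - 1]"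
        using sorted_list_of_set_snoc[of "V0 - {n - 1}" "n - 1"] by simp
      then show ?thesis by (simp add: rows_det_eq_rows)
    qed
    \<comment> \<open>The two choices mirror the defining sum of the row: its last term and the sum
      up to n - 1. At n = 0 only the last term exists, and it carries the weight of the west
      boundary.\<close>
    moreover have "rows_det e (?xs @ level_row \<omega> (Suc j) n # ?ys) = ?a * rows_det e (?xs @ level_row \<omega> j n # ?ys)
        + (if n = 0 then 0 else 1) * rows_det e (?xs @ level_row \<omega> (Suc j) (n - 1) # ?ys)"
    proof (rule rows_det_lin)
      fix col
      show "level_row \<omega> (Suc j) n col = ?a * level_row \<omega> j n col
        + (if n = 0 then 0 else 1) * level_row \<omega> (Suc j) (n - 1) col"
        using \<open>odd j\<close> by (cases n) (auto simp: level_row.simps)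
    qed
    moreover have "?l1 \<noteq> ?l2" by (auto simp: doubleton_eq_iff)
    ultimately show ?thesis
      using \<open>odd j\<close> by (auto simp: cell_weight_vertical cell_weight_other slV)
  qed
qed

text \<open>Such a strip has one up-pointing cell more than down-pointing ones, hence
  \<open>Suc n\<close> against n. The surplus cell at the west end must be a dent: this is the exit
  that enlarges the determinant by a column. For j = 0 there is nothing above the strip, hence no
  V'.\<close>

lemma strip_matchings_even:
  assumes "even j" and W: "W = c + (j + 1) div 2"
    and IH: "\<And>V'. V' \<subseteq> {..<W} \<Longrightarrow> (j = 0 \<Longrightarrow> V' = {}) \<Longrightarrow>
      trapezoid_matchings \<omega> c j V' = rows_det e (map (level_row \<omega> j) (sorted_list_of_set V'))"
  shows "n \<le> W \<Longrightarrow> V \<subseteq> {..n} \<Longrightarrow> V' \<subseteq> {n..<W} \<Longrightarrow> (j = 0 \<Longrightarrow> V' = {}) \<Longrightarrow>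
    weighted_matchings cell_edges (cell_weight \<omega>) (strip c j (Suc n) n V V') =
      rows_det (Suc e) (map (level_row \<omega> (Suc j)) (sorted_list_of_set V) @
        map (case_nat 0) (map (level_row \<omega> j) (sorted_list_of_set V')))"
proof (induction n arbitrary: V V')
  case 0
  let ?w = "cell_weight \<omega>" let ?R = "strip c j (Suc 0) 0 V V'"
  let ?M = "weighted_matchings cell_edges ?w"
  have V': "V' \<subseteq> {..<W}" using 0 by auto
  show ?case
  proof (cases "0 \<in> V")
    case True
    then have "V = {0}" "?R = trapezoid c j V'" using 0 by (auto simp: strip_def)
    moreover have "level_row \<omega> (Suc j) 0 = case_nat 1 (\<lambda>_. 0)" using \<open>even j\<close> by (simp add: level_row.simps)
    ultimately show ?thesis
      using IH[OF V' 0(4)] by (simp add: rows_det_first_col del: map_map)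
  next
    case False
    then have V: "V = {}" using 0 by auto
    \<comment> \<open>The surplus cell has no neighbour left, so nothing matches it; on the other
      side the new column is zero.\<close>
    have "?M ?R = (\<Sum>l\<in>{}. ?w l * ?M (?R - l))"
    proof (rule weighted_matchings_expand_edges[where v = "UpC (Suc j) 0"])
      fix l assume "l \<in> cell_edges" "UpC (Suc j) 0 \<in> l" "l \<subseteq> ?R"
      then show "l \<in> {}"
        using cell_edge_iff_up[of l "Suc j" 0] \<open>even j\<close> by (auto simp: strip_def trapezoid_def)
    qed (use V in \<open>auto simp: finite_strip, auto simp: strip_def\<close>)
    then show ?thesis using V by (simp add: rows_det_zero_col del: map_map)
  qed
next
  case (Suc n)
  let ?w = "cell_weight \<omega>" let ?R = "strip c j (Suc (Suc n)) (Suc n) V V'"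
  let ?M = "weighted_matchings cell_edges ?w"
  let ?z = "case_nat 0 :: (nat \<Rightarrow> real) \<Rightarrow> nat \<Rightarrow> real"
  show ?case
  proof (cases "Suc n \<in> V")
    case False
    have V: "V \<subseteq> {..n}" using Suc.prems(2) False by (auto simp: le_Suc_eq)
    have "?M ?R = (\<Sum>l\<in>{{UpC (Suc j) (Suc n), DnC j n}}. ?w l * ?M (?R - l))"
    proof (rule weighted_matchings_expand_edges[where v = "UpC (Suc j) (Suc n)"])
      fix l assume "l \<in> cell_edges" "UpC (Suc j) (Suc n) \<in> l" "l \<subseteq> ?R"
      then show "l \<in> {{UpC (Suc j) (Suc n), DnC j n}}"
        using cell_edge_iff_up[of l "Suc j" "Suc n"] \<open>even j\<close> by (auto simp: strip_def trapezoid_def)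
    next
      fix l assume "l \<in> {{UpC (Suc j) (Suc n), DnC j n}}"
      then show "l \<in> cell_edges \<and> UpC (Suc j) (Suc n) \<in> l \<and> l \<subseteq> ?R"
        using cell_edge_iff_up[of l "Suc j" "Suc n"] False \<open>even j\<close> by (auto simp: strip_def)
    qed (use False in \<open>auto simp: finite_strip, auto simp: strip_def\<close>)
    moreover have "?R - {UpC (Suc j) (Suc n), DnC j n} = strip c j (Suc n) n V V'"
      unfolding strip_def trapezoid_def by (auto simp: less_Suc_eq)
    moreover have "?M (strip c j (Suc n) n V V') =
      rows_det (Suc e) (map (level_row \<omega> (Suc j)) (sorted_list_of_set V) @ map ?z (map (level_row \<omega> j) (sorted_list_of_set V')))"
      by (rule Suc.IH) (use Suc.prems V in auto)
    ultimately show ?thesis by (simp add: cell_weight_other)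
  next
    case True
    define V0 where "V0 = V - {Suc n}"
    have V: "V = insert (Suc n) V0" "V0 \<subseteq> {..n}" "V0 \<subseteq> {..<Suc n}" "Suc n \<notin> V0"
      using True Suc.prems(2) by (auto simp: V0_def le_Suc_eq less_Suc_eq)
    let ?xs = "map (level_row \<omega> (Suc j)) (sorted_list_of_set V0)"
    let ?ys = "map ?z (map (level_row \<omega> j) (sorted_list_of_set V'))"
    let ?l1 = "{UpC j n, DnC j n}" let ?l2 = "{UpC (Suc j) n, DnC j n}"
    have nV': "n \<notin> V'" using Suc.prems(3) by auto
    have slV: "sorted_list_of_set V = sorted_list_of_set V0 @ [Suc n]"
      using sorted_list_of_set_snoc[OF V(3)] V(1) by simp
    let ?L = "(if 0 < j then {?l1} else {}) \<union> (if n \<notin> V0 then {?l2} else {})"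
    have "?M ?R = (\<Sum>l\<in>?L. ?w l * ?M (?R - l))"
    proof (rule weighted_matchings_expand_edges[where v = "DnC j n"])
      fix l assume "l \<in> cell_edges" "DnC j n \<in> l" "l \<subseteq> ?R"
      then show "l \<in> ?L"
        using cell_edge_iff_dn[of l j n] \<open>even j\<close> V by (auto simp: strip_def trapezoid_def)
    next
      fix l assume l: "l \<in> ?L"
      then have "0 < j \<and> l = ?l1 \<or> n \<notin> V0 \<and> l = ?l2" by (auto split: if_splits)
      moreover have "UpC j n \<in> ?R" if "0 < j"
        using that nV' Suc.prems(1) W by (auto simp: strip_def trapezoid_def)
      moreover have "DnC j n \<in> ?R" by (auto simp: strip_def)
      moreover have "UpC (Suc j) n \<in> ?R" if "n \<notin> V0"
        using that V by (auto simp: strip_def)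
      ultimately show "l \<in> cell_edges \<and> DnC j n \<in> l \<and> l \<subseteq> ?R"
        using cell_edge_iff_dn[of l j n] by auto
    qed (auto simp: finite_strip, auto simp: strip_def)
    moreover have "?R - ?l1 = strip c j (Suc n) n V0 (insert n V')"
      unfolding strip_def trapezoid_def using V by (auto simp: less_Suc_eq)
    moreover have "?R - ?l2 = strip c j (Suc n) n (insert n V0) V'"
      unfolding strip_def trapezoid_def using V by (auto simp: less_Suc_eq)
    moreover have "?M (strip c j (Suc n) n V0 (insert n V')) =
        rows_det (Suc e) (?xs @ ?z (level_row \<omega> j n) # ?ys)" if "0 < j"
      by (subst Suc.IH) (use Suc.prems V that in \<open>auto simp: sorted_list_of_set_cons\<close>)
    \<comment> \<open>No lozenge can cross the north side; correspondingly \<open>level_row\<close>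
      at level 0 is zero.\<close>
    moreover have "rows_det (Suc e) (?xs @ ?z (level_row \<omega> j n) # ?ys) = 0" if "j = 0"
      by (rule rows_det_zero_row) (simp add: that split: nat.split)
    moreover have "?M (strip c j (Suc n) n (insert n V0) V') =
        rows_det (Suc e) (?xs @ level_row \<omega> (Suc j) n # ?ys)" if n: "n \<notin> V0"
    proof -
      have V0: "V0 \<subseteq> {..<n}"
      proof
        fix v assume "v \<in> V0"
        then have "v \<le> n" "v \<noteq> n" using V n by auto
        then show "v \<in> {..<n}" by auto
      qed
      show ?thesis
        by (subst Suc.IH) (use Suc.prems V n V0 in \<open>auto simp: sorted_list_of_set_snoc\<close>)
    qed
    moreover have "rows_det (Suc e) (?xs @ level_row \<omega> (Suc j) n # ?ys) = 0" if n: "n \<in> V0"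
    proof -
      have "V0 = insert n (V0 - {n})" using n by auto
      moreover have "V0 - {n} \<subseteq> {..<n}"
      proof
        fix v assume "v \<in> V0 - {n}"
        then have "v \<le> n" "v \<noteq> n" using V n by auto
        then show "v \<in> {..<n}" by auto
      qed
      ultimately have "sorted_list_of_set V0 = sorted_list_of_set (V0 - {n}) @ [n]"
        using sorted_list_of_set_snoc[of "V0 - {n}" n] by simp
      then show ?thesis by (simp add: rows_det_eq_rows)
    qed
    moreover have "rows_det (Suc e) (?xs @ level_row \<omega> (Suc j) (Suc n) # ?ys) =
        rows_det (Suc e) (?xs @ ?z (level_row \<omega> j n) # ?ys)
        + rows_det (Suc e) (?xs @ level_row \<omega> (Suc j) n # ?ys)"
      by (rule rows_det_add) (use \<open>even j\<close> in \<open>simp add: level_row.simps split: nat.split\<close>)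
    moreover have "?l1 \<noteq> ?l2" by (auto simp: doubleton_eq_iff)
    ultimately show ?thesis
      using \<open>even j\<close> by (auto simp: cell_weight_vertical cell_weight_other slV)
  qed
qed

text \<open>A determinant of Lindstroem-Gessel-Viennot type, with one column per exit on the west
  boundary. No argument about intersecting paths is made: multilinearity and the vanishing for equal
  rows follow the matching cell by cell.\<close>

lemma trapezoid_matchings_eq_det:
  assumes "V \<subseteq> {..<c + (k + 1) div 2}" "k = 0 \<Longrightarrow> V = {}"
  shows "trapezoid_matchings \<omega> c k V = rows_det ((k + 1) div 2) (map (level_row \<omega> k) (sorted_list_of_set V))"
  using assms
proof (induction k arbitrary: V)
  case 0
  then show ?case by (simp add: trapezoid_def rows_det_def)
next
  case (Suc j)
  let ?W = "c + (j + 1) div 2"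
  show ?case
  proof (cases "even j")
    case False
    then have d: "(Suc j + 1) div 2 = (j + 1) div 2" by (auto elim!: oddE)
    have "trapezoid c (Suc j) V = strip c j ?W ?W V {}"
      unfolding trapezoid_def strip_def using d by (auto simp: le_Suc_eq less_Suc_eq)
    moreover have "weighted_matchings cell_edges (cell_weight \<omega>) (strip c j ?W ?W V {}) =
      rows_det ((j + 1) div 2) (map (level_row \<omega> (Suc j)) (sorted_list_of_set V) @ map (level_row \<omega> j) (sorted_list_of_set {}))"
      by (rule strip_matchings_odd[OF False refl Suc.IH]) (use Suc.prems d False in auto)
    ultimately show ?thesis using d by simp
  next
    case True
    then have d: "(Suc j + 1) div 2 = Suc ((j + 1) div 2)" by (auto elim!: evenE)
    have "trapezoid c (Suc j) V = strip c j (Suc ?W) ?W V {}"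
      unfolding trapezoid_def strip_def using d by (auto simp: le_Suc_eq less_Suc_eq)
    moreover have "weighted_matchings cell_edges (cell_weight \<omega>) (strip c j (Suc ?W) ?W V {}) =
      rows_det (Suc ((j + 1) div 2)) (map (level_row \<omega> (Suc j)) (sorted_list_of_set V) @
        map (case_nat 0) (map (level_row \<omega> j) (sorted_list_of_set {})))"
      by (rule strip_matchings_even[OF True refl Suc.IH]) (use Suc.prems d in auto)
    ultimately show ?thesis using d by simp
  qed
qed

section \<open>Vandermonde determinants in squared positions\<close>

lemma degree_prod_linear:
  fixes a :: "nat \<Rightarrow> real"
  shows "degree (\<Prod>u<j. [:- a u, 1:]) \<le> j \<and> coeff (\<Prod>u<j. [:- a u, 1:]) j = 1"
proof (induction j)
  case (Suc j)
  let ?p = "\<Prod>u<j. [:- a u, 1:]"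
  have "(\<Prod>u<Suc j. [:- a u, 1:]) = smult (- a j) ?p + pCons 0 ?p"
    by (simp add: mult.commute)
  moreover have "degree (smult (- a j) ?p + pCons 0 ?p) \<le> Suc j"
    using Suc by (intro degree_add_le) (auto intro: le_trans[OF degree_smult_le] le_trans[OF degree_pCons_le])
  moreover have "coeff (smult (- a j) ?p + pCons 0 ?p) (Suc j) = 1"
    using Suc by (simp add: coeff_eq_0)
  ultimately show ?case by simp
qed simp

text \<open>Newton polynomials are monic whatever their nodes a are. This freedom in the choice of a
  is used in the Selberg sum.\<close>

lemma fdet_newton:
  "fdet n (\<lambda>i j. \<Prod>u<j. X i - a u) = (\<Prod>j<n. \<Prod>i<j. X j - X i)"
proof -
  have "fdet n (\<lambda>i j. \<Prod>u<j. X i - a u) = fdet n (\<lambda>i j. poly (\<Prod>u<j. [:- a u, 1:]) (X i))"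
    by (simp add: poly_prod)
  also have "\<dots> = (\<Prod>j<n. \<Prod>i<j. X j - X i)"
    by (subst fdet_monic_polys) (simp_all add: degree_prod_linear)
  finally show ?thesis .
qed

text \<open>Attached to a set and not to an enumeration, so that it can be split along unions. All
  factors are positive.\<close>

definition square_vandermonde :: "nat set \<Rightarrow> real" where
  "square_vandermonde V = (\<Prod>t\<in>V. \<Prod>s\<in>{s \<in> V. s < t}. (real t)\<^sup>2 - (real s)\<^sup>2)"

lemma enum_less_iff:
  assumes "finite V" "i < card V" "j < card V"
  shows "enum V i < enum V j \<longleftrightarrow> i < j"
proof -
  have *: "enum V i < enum V j" if "i < j" "j < card V" for i j
    using strict_sorted_list_of_set[of V] that assms(1)
    by (simp add: enum_def sorted_wrt_iff_nth_less)
  show ?thesis using *[of i j] *[of j i] assms by (metis less_asym linorder_neqE_nat less_irrefl)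
qed

lemma prod_enum:
  assumes "finite V" "card V = n"
  shows "(\<Prod>j<n. f (enum V j)) = (\<Prod>t\<in>V. f t)"
  using prod.reindex_bij_betw[OF bij_betw_enum[OF assms], of f] by (simp add: atLeast0LessThan)

lemma prod_enum_pairs:
  assumes "finite V" "card V = n"
  shows "(\<Prod>j<n. \<Prod>i<j. f (enum V i) (enum V j)) = (\<Prod>t\<in>V. \<Prod>s\<in>{s \<in> V. s < t}. f s t)"
proof -
  have "(\<Prod>i<j. f (enum V i) (enum V j)) = (\<Prod>s\<in>{s \<in> V. s < enum V j}. f s (enum V j))" if j: "j < n" for j
  proof (rule prod.reindex_bij_betw)
    have b: "bij_betw (enum V) {0..<n} V" by (rule bij_betw_enum[OF assms])
    have "enum V ` {..<j} = {s \<in> V. s < enum V j}"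
    proof (intro equalityI subsetI)
      fix s assume "s \<in> enum V ` {..<j}"
      then show "s \<in> {s \<in> V. s < enum V j}"
        using b j assms enum_less_iff[of V _ j] by (auto simp: bij_betw_def)
    next
      fix s assume s: "s \<in> {s \<in> V. s < enum V j}"
      then have "s \<in> enum V ` {0..<n}" using b by (simp add: bij_betw_def)
      then obtain i where "i < n" "s = enum V i" by auto
      then show "s \<in> enum V ` {..<j}" using s j assms enum_less_iff[of V i j] by auto
    qed
    moreover have "inj_on (enum V) {..<j}"
      using b j by (auto simp: bij_betw_def intro: inj_on_subset)
    ultimately show "bij_betw (enum V) {..<j} {s \<in> V. s < enum V j}" by (simp add: bij_betw_def)
  qed
  then have "(\<Prod>j<n. \<Prod>i<j. f (enum V i) (enum V j)) = (\<Prod>j<n. \<Prod>s\<in>{s \<in> V. s < enum V j}. f s (enum V j))"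
    by (intro prod.cong[OF refl]) simp
  then show ?thesis using prod_enum[OF assms, of "\<lambda>t. \<Prod>s\<in>{s \<in> V. s < t}. f s t"] by simp
qed

lemma fdet_enum_newton:
  assumes "finite V" "card V = n"
  shows "fdet n (\<lambda>i j. \<Prod>u<j. (real (enum V i))\<^sup>2 - a u) = square_vandermonde V"
  unfolding fdet_newton square_vandermonde_def
  by (rule prod_enum_pairs[OF assms, of "\<lambda>s t. (real t)\<^sup>2 - (real s)\<^sup>2"])

lemma fdet_enum_Suc_newton:
  assumes "finite V" "card V = n"
  shows "fdet n (\<lambda>i j. \<Prod>u<j. (real (Suc (enum V i)))\<^sup>2 - a u) = square_vandermonde (Suc ` V)"
proof -
  have *: "{s \<in> Suc ` V. s < Suc t} = Suc ` {s \<in> V. s < t}" for t by auto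
  show ?thesis unfolding fdet_newton square_vandermonde_def
    by (simp add: prod.reindex * prod_enum_pairs[OF assms, of "\<lambda>s t. (real (Suc t))\<^sup>2 - (real (Suc s))\<^sup>2", simplified])
qed

lemma square_vandermonde_pos: "finite V \<Longrightarrow> square_vandermonde V > 0"
  unfolding square_vandermonde_def by (intro prod_pos) (auto intro!: power_strict_mono)

text \<open>Every mixed pair occurs once, the larger square first. Which of the two elements is
  larger varies, hence the absolute values.\<close>

lemma square_vandermonde_union:
  assumes "finite U" "finite S" "U \<inter> S = {}"
  shows "square_vandermonde (U \<union> S) = square_vandermonde U * square_vandermonde S *
    (\<Prod>s\<in>S. \<Prod>u\<in>U. \<bar>(real s)\<^sup>2 - (real u)\<^sup>2\<bar>)"
proof -
  let ?d = "\<lambda>s t. (real t)\<^sup>2 - (real s)\<^sup>2"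
  have split: "(\<Prod>s\<in>{s \<in> U \<union> S. s < t}. ?d s t) = (\<Prod>s\<in>{s \<in> U. s < t}. ?d s t) * (\<Prod>s\<in>{s \<in> S. s < t}. ?d s t)" for t
  proof -
    have "{s \<in> U \<union> S. s < t} = {s \<in> U. s < t} \<union> {s \<in> S. s < t}" by auto
    then show ?thesis using assms by (simp add: prod.union_disjoint disjoint_iff)
  qed
  have abs: "(\<Prod>u\<in>U. \<bar>(real s)\<^sup>2 - (real u)\<^sup>2\<bar>) =
      (\<Prod>u\<in>{u \<in> U. u < s}. ?d u s) * (\<Prod>u\<in>{u \<in> U. s < u}. ?d s u)" if "s \<in> S" for s
  proof -
    have "u < s \<or> s < u" if "u \<in> U" for u
      using that \<open>s \<in> S\<close> assms(3) by (metis disjoint_iff linorder_neqE_nat)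
    then have "U = {u \<in> U. u < s} \<union> {u \<in> U. s < u}" by auto
    then have "(\<Prod>u\<in>U. \<bar>(real s)\<^sup>2 - (real u)\<^sup>2\<bar>) =
      (\<Prod>u\<in>{u \<in> U. u < s} \<union> {u \<in> U. s < u}. \<bar>(real s)\<^sup>2 - (real u)\<^sup>2\<bar>)" by simp
    also have "\<dots> = (\<Prod>u\<in>{u \<in> U. u < s}. \<bar>(real s)\<^sup>2 - (real u)\<^sup>2\<bar>) * (\<Prod>u\<in>{u \<in> U. s < u}. \<bar>(real s)\<^sup>2 - (real u)\<^sup>2\<bar>)"
      using assms by (intro prod.union_disjoint) auto
    also have "\<dots> = (\<Prod>u\<in>{u \<in> U. u < s}. ?d u s) * (\<Prod>u\<in>{u \<in> U. s < u}. ?d s u)"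
      by (intro arg_cong2[of _ _ _ _ "(*)"] prod.cong) (auto simp: abs_real_def power_mono not_less
          dest: less_imp_le intro: power_mono)
    finally show ?thesis .
  qed
  have "square_vandermonde (U \<union> S) = (\<Prod>t\<in>U. \<Prod>s\<in>{s \<in> U \<union> S. s < t}. ?d s t) * (\<Prod>t\<in>S. \<Prod>s\<in>{s \<in> U \<union> S. s < t}. ?d s t)"
    unfolding square_vandermonde_def using assms by (intro prod.union_disjoint)
  also have "\<dots> = square_vandermonde U * square_vandermonde S *
      ((\<Prod>t\<in>U. \<Prod>s\<in>{s \<in> S. s < t}. ?d s t) * (\<Prod>t\<in>S. \<Prod>s\<in>{s \<in> U. s < t}. ?d s t))"
    unfolding split prod.distrib square_vandermonde_def by (simp only: mult_ac)
  also have "(\<Prod>t\<in>U. \<Prod>s\<in>{s \<in> S. s < t}. ?d s t) = (\<Prod>s\<in>S. \<Prod>t\<in>{t \<in> U. s < t}. ?d s t)"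
    using assms(1,2) by (rule prod.swap_restrict)
  also have "(\<Prod>s\<in>S. \<Prod>t\<in>{t \<in> U. s < t}. ?d s t) * (\<Prod>t\<in>S. \<Prod>s\<in>{s \<in> U. s < t}. ?d s t) =
      (\<Prod>s\<in>S. \<Prod>u\<in>U. \<bar>(real s)\<^sup>2 - (real u)\<^sup>2\<bar>)"
    by (simp add: prod.distrib[symmetric] abs mult.commute)
  finally show ?thesis .
qed

section \<open>Closed forms of the rows as odd and even polynomials\<close>

lemma choose_sum_odd: "(\<Sum>q<p. (q + 1 + c) choose (2 * c + 1)) = (p + 1 + c) choose (2 * c + 2)"
proof (induction p)
  case 0
  then show ?case by (simp add: binomial_eq_0)
next
  case (Suc p)
  have "(Suc p + 1 + c) choose (2 * c + 2) = ((p + 1 + c) choose (2 * c + 1)) + ((p + 1 + c) choose (2 * c + 2))"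
    by simp
  then show ?case using Suc by simp
qed

lemma choose_sum_even: "(\<Sum>q\<le>p. (q + c) choose (2 * c)) = (p + 1 + c) choose (2 * c + 1)"
proof (induction p)
  case 0
  then show ?case by (cases c) (auto simp: binomial_eq_0)
next
  case (Suc p)
  have "(Suc p + 1 + c) choose (2 * c + 1) = ((Suc p + c) choose (2 * c)) + ((Suc p + c) choose (2 * c + 1))"
    by simp
  then show ?case using Suc by simp
qed

text \<open>The entry depends on m, the number of exits below the one in question, but not on the
  height; e merely bounds m. Both parities go through one induction because each level sums the one
  before.\<close>

lemma level_row_1:
  "(\<forall>p m. m < e \<longrightarrow> level_row 1 (2 * e) p m = real ((p + 1 + m) choose (2 * m + 1))) \<and>
   (\<forall>p m. m \<le> e \<longrightarrow> level_row 1 (2 * e + 1) p m = real ((p + m) choose (2 * m)))"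
proof (induction e)
  case 0
  then show ?case by (simp add: level_row.simps)
next
  case (Suc e)
  have 1: "level_row 1 (2 * Suc e) p m = real ((p + 1 + m) choose (2 * m + 1))" if "m < Suc e" for p m
  proof -
    have "level_row 1 (2 * Suc e) p m = (\<Sum>q\<le>p. level_row 1 (2 * e + 1) q m)"
      by (simp add: level_row.simps)
    also have "\<dots> = real (\<Sum>q\<le>p. (q + m) choose (2 * m))"
      using Suc that by simp
    finally show ?thesis by (simp only: choose_sum_even)
  qed
  have 2: "level_row 1 (2 * Suc e + 1) p m = real ((p + m) choose (2 * m))" if m: "m \<le> Suc e" for p m
  proof (cases m)
    case 0
    then show ?thesis by (simp add: level_row.simps)
  next
    case (Suc c)
    have "level_row 1 (2 * Suc e + 1) p m = (\<Sum>q<p. level_row 1 (2 * Suc e) q c)"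
      by (simp add: level_row.simps(2)[of _ "2 * Suc e"] Suc del: mult_Suc_right)
    also have "\<dots> = real (\<Sum>q<p. (q + 1 + c) choose (2 * c + 1))"
      using 1 Suc m by simp
    finally show ?thesis by (simp only: choose_sum_odd Suc) simp
  qed
  show ?case using 1 2 by blast
qed

text \<open>The rows at odd levels for the weight 1/2. Halving the term at q = 0 averages two
  neighbouring binomial coefficients, and the average is even in p.\<close>

definition half_row :: "nat \<Rightarrow> nat \<Rightarrow> real" where
  "half_row p m = (case m of 0 \<Rightarrow> 1 |
     Suc c \<Rightarrow> (real ((p + c + 1) choose (2 * c + 2)) + real ((p + c) choose (2 * c + 2))) / 2)"

lemma half_row_sum:
  "(\<Sum>q\<le>p. (if q = 0 then 1/2 else 1) * half_row q m) =
    (real ((p + m + 1) choose (2 * m + 1)) + real ((p + m) choose (2 * m + 1))) / 2"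
proof (induction p)
  case 0
  then show ?case by (cases m) (auto simp: half_row_def binomial_eq_0)
next
  case (Suc p)
  have "half_row (Suc p) m = (real ((Suc p + m) choose (2 * m)) + real ((p + m) choose (2 * m))) / 2"
    by (cases m) (auto simp: half_row_def)
  moreover have "(Suc p + m + 1) choose (2 * m + 1) = ((Suc p + m) choose (2 * m)) + ((p + m + 1) choose (2 * m + 1))"
    by simp
  moreover have "(Suc p + m) choose (2 * m + 1) = ((p + m) choose (2 * m)) + ((p + m) choose (2 * m + 1))"
    by simp
  ultimately show ?case using Suc by (simp del: binomial_Suc_Suc add: field_simps)
qed

lemma half_row_Suc:
  "(\<Sum>q<p. (real ((q + c + 1) choose (2 * c + 1)) + real ((q + c) choose (2 * c + 1))) / 2) = half_row p (Suc c)"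
proof (induction p)
  case 0
  then show ?case by (simp add: half_row_def binomial_eq_0)
next
  case (Suc p)
  have "(Suc p + c + 1) choose (2 * c + 2) = ((p + c + 1) choose (2 * c + 1)) + ((p + c + 1) choose (2 * c + 2))"
    by simp
  moreover have "(Suc p + c) choose (2 * c + 2) = ((p + c) choose (2 * c + 1)) + ((p + c) choose (2 * c + 2))"
    by simp
  ultimately show ?case using Suc by (simp del: binomial_Suc_Suc add: half_row_def field_simps)
qed

lemma level_row_half:
  "(\<forall>p m. m < e \<longrightarrow> level_row (1/2) (2 * e) p m =
     (real ((p + m + 1) choose (2 * m + 1)) + real ((p + m) choose (2 * m + 1))) / 2) \<and>
   (\<forall>p m. m \<le> e \<longrightarrow> level_row (1/2) (2 * e + 1) p m = half_row p m)"
proof (induction e)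
  case 0
  then show ?case by (simp add: level_row.simps half_row_def)
next
  case (Suc e)
  have 1: "level_row (1/2) (2 * Suc e) p m =
     (real ((p + m + 1) choose (2 * m + 1)) + real ((p + m) choose (2 * m + 1))) / 2"
    if "m < Suc e" for p m
  proof -
    have "level_row (1/2) (2 * Suc e) p m = (\<Sum>q\<le>p. (if q = 0 then 1/2 else 1) * level_row (1/2) (2 * e + 1) q m)"
      by (simp add: level_row.simps)
    also have "\<dots> = (\<Sum>q\<le>p. (if q = 0 then 1/2 else 1) * half_row q m)"
      using Suc that by (intro sum.cong) auto
    finally show ?thesis by (simp only: half_row_sum)
  qed
  have 2: "level_row (1/2) (2 * Suc e + 1) p m = half_row p m" if m: "m \<le> Suc e" for p m
  proof (cases m)
    case 0
    then show ?thesis by (simp add: level_row.simps half_row_def)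
  next
    case (Suc c)
    have "level_row (1/2) (2 * Suc e + 1) p m = (\<Sum>q<p. level_row (1/2) (2 * Suc e) q c)"
      by (simp add: level_row.simps(2)[of _ "2 * Suc e"] Suc del: mult_Suc_right)
    also have "\<dots> = half_row p (Suc c)"
      using 1 Suc m by (subst half_row_Suc[symmetric]) (intro sum.cong, auto)
    finally show ?thesis by (simp only: Suc)
  qed
  show ?case using 1 2 by blast
qed

text \<open>The factors at equal distance on either side of the middle factor l pair up to
  differences of squares.\<close>

lemma prod_centered: "(\<Prod>i<2 * c + 1. (l + real c) - real i) = l * (\<Prod>u<c. l\<^sup>2 - (real u + 1)\<^sup>2)"
proof (induction c)
  case (Suc c)
  have "(\<Prod>i<2 * Suc c + 1. (l + real (Suc c)) - real i) =
      (l + real c + 1) * (\<Prod>i<Suc (2 * c + 1). (l + real c) - real i)"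
    by (simp add: prod.lessThan_Suc_shift algebra_simps del: prod.lessThan_Suc)
  also have "\<dots> = (l + real c + 1) * ((l * (\<Prod>u<c. l\<^sup>2 - (real u + 1)\<^sup>2)) * (l - real c - 1))"
    by (subst prod.lessThan_Suc, subst Suc) (simp add: algebra_simps)
  finally show ?case by (simp add: algebra_simps power2_eq_square)
qed simp

lemma choose_eq_prod: "real (n choose k) = (\<Prod>i<k. real n - real i) / fact k"
  by (simp add: binomial_gbinomial gbinomial_prod_rev atLeast0LessThan)

text \<open>For l = p + 1 this is the row at an even level with weight 1: l times a Newton
  polynomial in the square of l.\<close>

lemma choose_centered:
  "real ((l + c) choose (2 * c + 1)) = real l * (\<Prod>u<c. (real l)\<^sup>2 - (real u + 1)\<^sup>2) / fact (2 * c + 1)"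
  using prod_centered[of "real l" c] by (simp only: choose_eq_prod of_nat_add)

text \<open>The two averaged binomials share 2 c + 1 factors centred at p. Their remaining factors p
  + c + 1 and p - c - 1 add up to 2 p, and a second p comes from the centred product, so no linear
  factor is left over.\<close>

lemma half_row_centered:
  "half_row p m = (\<Prod>u<m. (real p)\<^sup>2 - (real u)\<^sup>2) / fact (2 * m)"
proof (cases m)
  case 0
  then show ?thesis by (simp add: half_row_def)
next
  case (Suc c)
  let ?P = "\<Prod>i<2 * c + 1. (real p + real c) - real i"
  have "(\<Prod>i<Suc (2 * c + 1). real (p + c + 1) - real i) = (real p + real c + 1) * ?P"
    by (subst prod.lessThan_Suc_shift) (simp add: algebra_simps del: prod.lessThan_Suc)
  moreover have "(\<Prod>i<Suc (2 * c + 1). real (p + c) - real i) = ?P * (real p - real c - 1)"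
    by (subst prod.lessThan_Suc) (simp add: algebra_simps del: prod.lessThan_Suc)
  moreover have "half_row p m = ((\<Prod>i<Suc (2 * c + 1). real (p + c + 1) - real i) / fact (2 * c + 2)
      + (\<Prod>i<Suc (2 * c + 1). real (p + c) - real i) / fact (2 * c + 2)) / 2"
    by (simp only: Suc half_row_def nat.case choose_eq_prod) simp
  ultimately have "half_row p m = ((real p + real c + 1) * ?P / fact (2 * c + 2)
      + ?P * (real p - real c - 1) / fact (2 * c + 2)) / 2"
    by (simp only:)
  also have "\<dots> = real p * ?P / fact (2 * c + 2)"
    by (simp only: add_divide_distrib[symmetric]) (simp add: algebra_simps del: prod.lessThan_Suc fact_Suc)
  also have "\<dots> = (\<Prod>u<m. (real p)\<^sup>2 - (real u)\<^sup>2) / fact (2 * m)"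
    unfolding prod_centered Suc
    by (subst prod.lessThan_Suc_shift) (simp add: power2_eq_square algebra_simps)
  finally show ?thesis .
qed

text \<open>These factorials are the column denominators of the row polynomials; this is how
  \<open>H2\<close> enters.\<close>

lemma H2_odd: "H2 (2 * e + 1) = (\<Prod>j<e. fact (2 * j + 1))"
proof -
  have "H2 (2 * e + 1) = (\<Prod>i\<in>{1..e}. fact (2 * (e - i) + 1))"
    unfolding H2_def by (intro prod.cong arg_cong[of _ _ fact]) auto
  also have "\<dots> = (\<Prod>j<e. fact (2 * (e - Suc j) + 1))"
    by (rule prod.reindex_bij_witness[of _ Suc "\<lambda>i. i - 1"]) auto
  also have "\<dots> = (\<Prod>j<e. fact (2 * j + 1))"
    by (rule prod.nat_diff_reindex)
  finally show ?thesis .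
qed

lemma H2_even: "H2 (2 * e) = (\<Prod>j<e. fact (2 * j))"
proof -
  have "H2 (2 * e) = (\<Prod>i\<in>{1..e}. fact (2 * (e - i)))"
    unfolding H2_def by (intro prod.cong arg_cong[of _ _ fact]) auto
  also have "\<dots> = (\<Prod>j<e. fact (2 * (e - Suc j)))"
    by (rule prod.reindex_bij_witness[of _ Suc "\<lambda>i. i - 1"]) auto
  also have "\<dots> = (\<Prod>j<e. fact (2 * j))"
    by (rule prod.nat_diff_reindex)
  finally show ?thesis .
qed

lemma rows_det_enum:
  assumes "finite V"
  shows "rows_det e (map r (sorted_list_of_set V)) = (if card V = e then fdet e (\<lambda>i. r (enum V i)) else 0)"
  using assms unfolding rows_det_def by (auto simp: enum_def intro!: fdet_cong)

text \<open>The positions enter as i + 1, the variable in which the rows are odd. Without strips the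
  region is empty whatever V is, while the right-hand side would see the size of V; hence the
  condition for e = 0.\<close>

theorem trapezoid_matchings_full:
  assumes "V \<subseteq> {..<c + e}" "e = 0 \<Longrightarrow> V = {}"
  shows "trapezoid_matchings 1 c (2 * e) V =
    (if card V = e then (\<Prod>l\<in>Suc ` V. real l) * square_vandermonde (Suc ` V) / H2 (2 * e + 1) else 0)"
proof -
  have fin: "finite V" using assms(1) by (rule finite_subset) simp
  have "fdet e (\<lambda>i. level_row 1 (2 * e) (enum V i)) = (\<Prod>l\<in>Suc ` V. real l) * square_vandermonde (Suc ` V) / H2 (2 * e + 1)"
    if "card V = e"
  proof -
    have "fdet e (\<lambda>i. level_row 1 (2 * e) (enum V i)) =
      fdet e (\<lambda>i j. real (Suc (enum V i)) * (1 / fact (2 * j + 1)) * (\<Prod>u<j. (real (Suc (enum V i)))\<^sup>2 - (real u + 1)\<^sup>2))"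
      using level_row_1[of e] choose_centered[of "Suc (enum V _)"]
      by (intro fdet_cong) (simp only: Suc_eq_plus1, simp)
    also have "\<dots> = (\<Prod>i<e. real (Suc (enum V i))) * (\<Prod>j<e. 1 / fact (2 * j + 1)) * square_vandermonde (Suc ` V)"
      by (subst fdet_scale, subst fdet_enum_Suc_newton[OF fin that]) simp
    also have "(\<Prod>i<e. real (Suc (enum V i))) = (\<Prod>l\<in>Suc ` V. real l)"
      using prod_enum[OF fin that, of "\<lambda>t. real (Suc t)"] by (simp add: prod.reindex)
    finally show ?thesis by (simp only: H2_odd prod_dividef prod.neutral_const) simp
  qed
  then show ?thesis
    using trapezoid_matchings_eq_det[of V c "2 * e" 1] assms by (simp add: rows_det_enum[OF fin])
qed

text \<open>The positions enter unshifted and without linear factors, since the rows are even about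
  position 0.\<close>

theorem trapezoid_matchings_half:
  assumes "V \<subseteq> {..<c + e}" "0 < e"
  shows "trapezoid_matchings (1/2) c (2 * e - 1) V =
    (if card V = e then square_vandermonde V / H2 (2 * e) else 0)"
proof -
  have fin: "finite V" using assms(1) by (rule finite_subset) simp
  obtain e' where e: "e = Suc e'" using assms(2) by (cases e) auto
  have "fdet e (\<lambda>i. level_row (1/2) (2 * e - 1) (enum V i)) = square_vandermonde V / H2 (2 * e)"
    if "card V = e"
  proof -
    have "fdet e (\<lambda>i. level_row (1/2) (2 * e - 1) (enum V i)) =
      fdet e (\<lambda>i j. 1 * (1 / fact (2 * j)) * (\<Prod>u<j. (real (enum V i))\<^sup>2 - (real u)\<^sup>2))"
      using level_row_half[of e'] by (intro fdet_cong) (simp add: e half_row_centered)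
    also have "\<dots> = (\<Prod>i<e. 1) * (\<Prod>j<e. 1 / fact (2 * j)) * square_vandermonde V"
      by (subst fdet_scale, subst fdet_enum_newton[OF fin that]) simp
    finally show ?thesis by (simp only: H2_even prod_dividef prod.neutral_const) simp
  qed
  moreover have "(2 * e - 1 + 1) div 2 = e" using assms(2) by simp
  ultimately show ?thesis
    using trapezoid_matchings_eq_det[of V c "2 * e - 1" "1/2"] assms by (simp add: rows_det_enum[OF fin])
qed

section \<open>A discrete Selberg sum\<close>

text \<open>Subtract from each row the multiple of its predecessor that clears column 0. Up to a row
  factor and a column factor, the remaining minor is again of the same kind, with X + 1 and Y + 2
  for X and Y.\<close>

lemma hankel_factorial_det:
  "fdet y (\<lambda>i j. fact (X + i + j) / fact (Y + i + j)) =
    (\<Prod>k<y. fact (X + k) * fact (y - 1 - k) * (real Y - real X + real k) ^ (y - 1 - k) / fact (Y + y - 1 + k))"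
proof (induction y arbitrary: X Y)
  case (Suc y)
  let ?h = "\<lambda>i j. fact (X + i + j) / fact (Y + i + j) :: real"
  let ?c = "\<lambda>i. (real X + real i) / (real Y + real i)"
  let ?d = "real Y - real X"
  have entry: "?h (Suc i) (Suc j) - ?c (Suc i) * ?h i (Suc j) =
      (?d / (real Y + real i + 1)) * (real j + 1) * (fact (Suc X + i + j) / fact (Suc (Suc Y) + i + j))" for i j
  proof -
    let ?f = "fact (Suc X + i + j) / fact (Suc Y + i + j) :: real"
    let ?x = "real X + real i" let ?y = "real Y + real i"
    have fX: "fact (X + Suc i + Suc j) = (?x + real j + 2) * (fact (Suc X + i + j) :: real)"
      using fact_Suc[of "Suc X + i + j", where 'a = real] by (simp del: fact_Suc add: algebra_simps)
    have fY: "fact (Y + Suc i + Suc j) = (?y + real j + 2) * (fact (Suc Y + i + j) :: real)"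
      "fact (Suc (Suc Y) + i + j) = (?y + real j + 2) * (fact (Suc Y + i + j) :: real)"
      using fact_Suc[of "Suc Y + i + j", where 'a = real] by (simp_all del: fact_Suc add: algebra_simps)
    have "(?x + real j + 2) / (?y + real j + 2) - (?x + 1) / (?y + 1)
        = (?d / (?y + 1)) * (real j + 1) / (?y + real j + 2)"
      by (simp add: divide_simps) (simp add: algebra_simps)
    then have "?f * ((?x + real j + 2) / (?y + real j + 2) - (?x + 1) / (?y + 1))
        = ?f * ((?d / (?y + 1)) * (real j + 1) / (?y + real j + 2))" by (simp only:)
    moreover have "?h (Suc i) (Suc j) = ?f * ((?x + real j + 2) / (?y + real j + 2))"
      by (simp only: fX fY) (simp add: mult.commute del: fact_Suc)
    moreover have "?h i (Suc j) = ?f" by simp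
    moreover have "?c (Suc i) = (?x + 1) / (?y + 1)" by (simp add: algebra_simps)
    moreover have "fact (Suc X + i + j) / fact (Suc (Suc Y) + i + j) = ?f / (?y + real j + 2)"
      by (simp only: fY) (simp add: mult.commute del: fact_Suc)
    ultimately show ?thesis
      by (simp del: fact_Suc add: right_diff_distrib mult_ac)
  qed
  have "fdet (Suc y) ?h = fdet (Suc y) (\<lambda>i j. if i = 0 then ?h i j else ?h i j - ?c i * ?h (i - 1) j)"
    by (rule fdet_row_ops[symmetric]) simp
  also have "\<dots> = ?h 0 0 * fdet y (\<lambda>i j. ?h (Suc i) (Suc j) - ?c (Suc i) * ?h i (Suc j))"
  proof (subst fdet_first_col)
    fix i assume "0 < i" "i < Suc y"
    then obtain m where i: "i = Suc m" by (cases i) auto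
    have "fact (X + i + 0) = (real X + real i) * (fact (X + (i - 1) + 0) :: real)"
      "fact (Y + i + 0) = (real Y + real i) * (fact (Y + (i - 1) + 0) :: real)"
      by (simp_all add: i algebra_simps)
    then show "(if i = 0 then ?h i 0 else ?h i 0 - ?c i * ?h (i - 1) 0) = 0"
      using \<open>0 < i\<close> by (simp only:) simp
  qed simp
  also have "fdet y (\<lambda>i j. ?h (Suc i) (Suc j) - ?c (Suc i) * ?h i (Suc j)) =
     (\<Prod>i<y. ?d / (real Y + real i + 1)) * (\<Prod>j<y. real j + 1) *
     fdet y (\<lambda>i j. fact (Suc X + i + j) / fact (Suc (Suc Y) + i + j))"
    by (simp only: entry fdet_scale)
  also have "\<dots> = (\<Prod>i<y. ?d / (real Y + real i + 1)) * fact y *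
     (\<Prod>k<y. fact (Suc X + k) * fact (y - 1 - k) * (?d + real (Suc k)) ^ (y - 1 - k) / fact (Suc (Suc Y) + y - 1 + k))"
  proof -
    have "(\<Prod>j<y. real j + 1) = fact y" by (induction y) (auto simp: algebra_simps)
    then show ?thesis by (simp only: Suc.IH) (simp add: algebra_simps)
  qed
  also have "(\<Prod>i<y. ?d / (real Y + real i + 1)) = ?d ^ y * fact Y / fact (Y + y)"
  proof -
    have "fact Y * (\<Prod>i<y. real Y + real i + 1) = fact (Y + y)"
    proof (induction y)
      case (Suc y)
      have "fact Y * (\<Prod>i<Suc y. real Y + real i + 1) = fact (Y + y) * (real Y + real y + 1)"
        by (simp add: Suc[symmetric])
      then show ?case by (simp add: algebra_simps)
    qed simp
    moreover have "(\<Prod>i<y. real Y + real i + 1) > 0" by (intro prod_pos) auto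
    ultimately show ?thesis by (simp add: prod_dividef field_simps)
  qed
  finally show ?case
    by (subst prod.lessThan_Suc_shift) (simp add: algebra_simps del: fact_Suc)
qed simp

text \<open>All that a crossing position s contributes apart from the pairs of crossing positions:
  one s from the odd rows, s^2 from the lower dent at position 0, and the differences to the two
  intervals filled by the ferns, {1..a} and {N+1..N+B}.\<close>

definition selberg_weight :: "nat \<Rightarrow> nat \<Rightarrow> nat \<Rightarrow> nat \<Rightarrow> real" where
  "selberg_weight a N B s = real s ^ 3 * (\<Prod>u\<in>{1..a}. (real s)\<^sup>2 - (real u)\<^sup>2) *
     (\<Prod>u\<in>{N + 1..N + B}. (real u)\<^sup>2 - (real s)\<^sup>2)"

lemma prod_shifted_pochhammer:
  "real s * (\<Prod>u\<in>{1..a}. (real s)\<^sup>2 - (real u)\<^sup>2) = pochhammer (real s - real a) (2 * a + 1)"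
proof (induction a)
  case (Suc a)
  let ?p = "pochhammer (real s - real a) (2 * a + 1)"
  have "pochhammer (real s - real (Suc a)) (Suc (Suc (2 * a + 1))) =
      (real s - real a - 1) * pochhammer (real s - real a) (Suc (2 * a + 1))"
    by (subst pochhammer_rec) (simp add: algebra_simps del: pochhammer_Suc)
  also have "pochhammer (real s - real a) (Suc (2 * a + 1)) = ?p * (real s + real a + 1)"
    by (subst pochhammer_Suc) simp
  finally have "pochhammer (real s - real (Suc a)) (2 * Suc a + 1) =
      (real s - real a - 1) * (?p * (real s + real a + 1))" by simp
  also have "\<dots> = real s * (\<Prod>u\<in>{1..Suc a}. (real s)\<^sup>2 - (real u)\<^sup>2)"
    unfolding Suc[symmetric] by (simp add: algebra_simps power2_eq_square)
  finally show ?case by simp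
qed simp

text \<open>Induction on B for all a: the new factor is (N+B+1)^2 - s^2 = ((N+B+1)^2 - (a+1)^2) -
  (s^2 - (a+1)^2), and its second part extends the western interval, which gives the sum for B and a
  + 1. For B = 0 the weight does not depend on N, and induction on N verifies the formula.\<close>

lemma selberg_weight_sum:
  assumes "a \<le> N"
  shows "(\<Sum>s\<in>{a + 1..N}. selberg_weight a N B s) =
    fact (a + 1) * fact B / (2 * fact (a + B + 2)) * pochhammer (real N - real a) (2 * a + B + 2) * pochhammer (real N) (B + 2)"
  using assms
proof (induction B arbitrary: a)
  case 0
  then show ?case
  proof (induction N rule: dec_induct)
    case (step N)
    have "(\<Sum>s\<in>{a + 1..Suc N}. selberg_weight a (Suc N) 0 s) =
        (\<Sum>s\<in>{a + 1..N}. selberg_weight a N 0 s) + selberg_weight a N 0 (Suc N)"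
      using step by (simp add: selberg_weight_def)
    also have "selberg_weight a N 0 (Suc N) = (real N + 1)\<^sup>2 * pochhammer (real N + 1 - real a) (2 * a + 1)"
    proof -
      have "selberg_weight a N 0 (Suc N) = (real N + 1)\<^sup>2 * (real (Suc N) * (\<Prod>u\<in>{1..a}. (real (Suc N))\<^sup>2 - (real u)\<^sup>2))"
        by (simp add: selberg_weight_def power2_eq_square power3_eq_cube mult.assoc add.commute)
      then show ?thesis unfolding prod_shifted_pochhammer by (simp add: add.commute)
    qed
    finally have eq: "(\<Sum>s\<in>{a + 1..Suc N}. selberg_weight a (Suc N) 0 s) =
        (\<Sum>s\<in>{a + 1..N}. selberg_weight a N 0 s) + (real N + 1)\<^sup>2 * pochhammer (real N + 1 - real a) (2 * a + 1)" .
    let ?p = "pochhammer (real N + 1 - real a) (2 * a + 1)"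
    have c: "fact (a + 1) * fact 0 / (2 * fact (a + 0 + 2)) = (1 / (2 * (real a + 2)) :: real)"
    proof -
      have "fact (a + 0 + 2) = (real a + 2) * (fact (a + 1) :: real)"
        using fact_Suc[of "a + 1", where 'a = real] by (simp del: fact_Suc add: algebra_simps)
      then show ?thesis by (simp del: fact_Suc)
    qed
    have p1: "pochhammer (real N - real a) (2 * a + 0 + 2) = (real N - real a) * ?p"
      using pochhammer_rec[of "real N - real a" "2 * a + 1"] by (simp add: algebra_simps)
    have p2: "pochhammer (real (Suc N) - real a) (2 * a + 0 + 2) = ?p * (real N + real a + 2)"
      using pochhammer_Suc[of "real N + 1 - real a" "2 * a + 1"] by (simp add: algebra_simps)
    have p3: "pochhammer (real N) (0 + 2) = real N * (real N + 1)"
      "pochhammer (real (Suc N)) (0 + 2) = (real N + 1) * (real N + 2)"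
      by (simp_all add: pochhammer_Suc numeral_2_eq_2 algebra_simps)
    have IH: "(\<Sum>s\<in>{a + 1..N}. selberg_weight a N 0 s) = 1 / (2 * (real a + 2)) * ((real N - real a) * ?p) * (real N * (real N + 1))"
      using step.IH unfolding c p1 p3 .
    show ?case unfolding eq IH c p2 p3
      by (simp add: divide_simps) (simp add: algebra_simps power2_eq_square)
  qed (simp add: pochhammer_rec)
next
  case (Suc B)
  have nf: "real a + real B + 3 \<noteq> 0" by linarith
  let ?P = "pochhammer (real N - real a) (2 * a + B + 2)" let ?Q = "pochhammer (real N) (B + 2)"
  let ?C = "fact (a + 1) * fact B / (2 * fact (a + B + 2)) :: real"
  have rec: "selberg_weight a N (Suc B) s = ((real N + real B + 1)\<^sup>2 - (real a + 1)\<^sup>2) * selberg_weight a N B s - selberg_weight (a + 1) N B s" for s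
    by (simp add: selberg_weight_def algebra_simps)
  \<comment> \<open>The weight for a + 1 vanishes at s = a + 1.\<close>
  have "(\<Sum>s\<in>{a + 1..N}. selberg_weight (a + 1) N B s) = (\<Sum>s\<in>{a + 1 + 1..N}. selberg_weight (a + 1) N B s)"
    by (rule sum.mono_neutral_right) (auto simp: selberg_weight_def not_le less_Suc_eq_le)
  also have "\<dots> = ?C * (real a + 2) / (real a + real B + 3) * ((real N - real a - 1) * ?P * (real N + real a + real B + 2)) * ?Q"
  proof (cases "a < N")
    case True
    have "pochhammer (real N - real (a + 1)) (2 * (a + 1) + B + 2) = (real N - real a - 1) * ?P * (real N + real a + real B + 2)"
      using pochhammer_rec[of "real N - real (a + 1)" "2 * a + B + 3"] pochhammer_Suc[of "real N - real a" "2 * a + B + 2"]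
      by (simp add: algebra_simps numeral_3_eq_3)
    moreover have "fact (a + 1 + 1) * fact B / (2 * fact (a + 1 + B + 2)) = ?C * (real a + 2) / (real a + real B + 3)"
      by (simp add: divide_simps) (simp add: algebra_simps)
    ultimately show ?thesis using Suc.IH[of "a + 1"] True by simp
  next
    case False
    then have "N = a" using Suc.prems by simp
    then show ?thesis by (simp add: pochhammer_rec)
  qed
  finally have s: "(\<Sum>s\<in>{a + 1..N}. selberg_weight (a + 1) N B s) =
      ?C * (real a + 2) / (real a + real B + 3) * ((real N - real a - 1) * ?P * (real N + real a + real B + 2)) * ?Q" .
  have "(\<Sum>s\<in>{a + 1..N}. selberg_weight a N (Suc B) s) = ((real N + real B + 1)\<^sup>2 - (real a + 1)\<^sup>2) * (?C * ?P * ?Q)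
     - ?C * (real a + 2) / (real a + real B + 3) * ((real N - real a - 1) * ?P * (real N + real a + real B + 2)) * ?Q"
    unfolding rec sum_subtractf sum_distrib_left[symmetric] s Suc.IH[OF Suc.prems] ..
  also have "\<dots> = (?C * ?P * ?Q) * ((real N + real a + real B + 2) * (real B + 1) * (real N + real B + 2) / (real a + real B + 3))"
  proof -
    have "(real N + real B + 1)\<^sup>2 - (real a + 1)\<^sup>2 - (real a + 2) / (real a + real B + 3) * ((real N - real a - 1) * (real N + real a + real B + 2))
      = (real N + real a + real B + 2) * (real B + 1) * (real N + real B + 2) / (real a + real B + 3)"
      using nf by (simp add: divide_simps) (simp add: algebra_simps power2_eq_square)
    moreover have "d * (c * p * q) - c * g / h * (n * p * n') * q = (c * p * q) * (d - g / h * (n * n'))"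
      for d c p q g h n n' :: real by (simp add: algebra_simps)
    ultimately show ?thesis by (simp only:)
  qed
  also have "\<dots> = fact (a + 1) * fact (Suc B) / (2 * fact (a + Suc B + 2)) * pochhammer (real N - real a) (2 * a + Suc B + 2) * pochhammer (real N) (Suc B + 2)"
  proof -
    have "fact (a + 1) * fact (Suc B) / (2 * fact (a + Suc B + 2)) = ?C * (real B + 1) / (real a + real B + 3)"
      by (simp add: divide_simps) (simp add: algebra_simps)
    moreover have "pochhammer (real N - real a) (2 * a + Suc B + 2) = ?P * (real N + real a + real B + 2)"
      using pochhammer_Suc[of "real N - real a" "2 * a + B + 2"] by (simp add: algebra_simps)
    moreover have "pochhammer (real N) (Suc B + 2) = ?Q * (real N + real B + 2)"
      using pochhammer_Suc[of "real N" "B + 2"] by (simp add: algebra_simps)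
    ultimately show ?thesis by simp
  qed
  finally show ?case .
qed

lemma prod_atLeastAtMost_split:
  "(\<Prod>u\<in>{m + 1..m + (n + i)}. f u) = (\<Prod>u\<in>{m + 1..m + n}. f u) * (\<Prod>u<i. f (m + n + 1 + u :: nat) :: real)"
  by (induction i) (auto simp: algebra_simps)

lemma selberg_weight_add:
  "selberg_weight (a + i) N (B + j) s = selberg_weight a N B s *
    (\<Prod>u<i. (real s)\<^sup>2 - (real (a + 1 + u))\<^sup>2) * (\<Prod>u<j. (real (N + B + 1 + u))\<^sup>2 - (real s)\<^sup>2)"
  using prod_atLeastAtMost_split[where m = 0 and n = a and i = i and f = "\<lambda>u. (real s)\<^sup>2 - (real u)\<^sup>2"]
    prod_atLeastAtMost_split[where m = N and n = B and i = j and f = "\<lambda>u. (real u)\<^sup>2 - (real s)\<^sup>2"]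
  by (simp add: selberg_weight_def add.assoc del: of_nat_add)

section \<open>The value of the Selberg sum in terms of \<open>T\<close> and
  \<open>H\<close>\<close>

lemma pochhammer_Suc_fact: "pochhammer (real c + 1) m = fact (c + m) / fact c"
proof (induction m)
  case (Suc m)
  have "fact (c + Suc m) = (real c + real m + 1) * (fact (c + m) :: real)"
    using fact_Suc[of "c + m", where 'a = real] by (simp add: algebra_simps)
  then show ?case using Suc by (simp only: pochhammer_Suc) (simp add: algebra_simps)
qed simp

text \<open>Under this bound no subtraction in \<open>T\<close> truncates, and each Pochhammer
  symbol is a quotient of two factorials. The numerators are listed in reverse order to obtain
  arguments increasing with k.\<close>

lemma T_eq_fact:
  assumes "2 * y \<le> n"
  shows "T (c + 1) n y = (\<Prod>k<y. fact (c + n - y + 1 + k)) / (\<Prod>k<y. fact (c + k))"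
proof -
  have "T (c + 1) n y = (\<Prod>i<y. fact (c + n - i) / fact (c + i))"
    unfolding T_def
  proof (rule prod.cong[OF refl])
    fix i assume i: "i \<in> {..<y}"
    then have "c + i + (n - 2 * i) = c + n - i" using assms by simp
    then show "pochhammer (real (c + 1) + real i) (n - 2 * i) = fact (c + n - i) / fact (c + i)"
      using pochhammer_Suc_fact[of "c + i" "n - 2 * i"] by (simp add: algebra_simps)
  qed
  also have "\<dots> = (\<Prod>i<y. fact (c + n - i)) / (\<Prod>i<y. fact (c + i))"
    by (rule prod_dividef)
  also have "(\<Prod>i<y. fact (c + n - i)) = (\<Prod>i<y. fact (c + n - (y - Suc i)) :: real)"
    by (rule prod.nat_diff_reindex[symmetric])
  also have "\<dots> = (\<Prod>k<y. fact (c + n - y + 1 + k))"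
    using assms by (intro prod.cong arg_cong[of _ _ fact]) auto
  finally show ?thesis .
qed

lemma H_pos: "H n > 0"
  unfolding H_def by (intro prod_pos) auto

lemma H_ratio: "H (n + y) / H n = (\<Prod>k<y. fact (n + k))"
proof -
  have "H (n + y) = H n * (\<Prod>k<y. fact (n + k))"
    by (induction y) (auto simp: H_def)
  then show ?thesis using H_pos[of n] by simp
qed

text \<open>Here and below B stands for b + z: the bend of the east side acts as z further
  dents.\<close>

definition T_ratio :: "nat \<Rightarrow> nat \<Rightarrow> nat \<Rightarrow> nat \<Rightarrow> real" where
  "T_ratio a x y B = (T (x + 1) (2*a + B + 2*y) y * T (x + a + 1) (B + 2*y) y)
          / (T 1 (2*a + B + 2*y) y * T (a + 1) (B + 2*y) y)"

definition selberg_value :: "nat \<Rightarrow> nat \<Rightarrow> nat \<Rightarrow> nat \<Rightarrow> real" where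
  "selberg_value a x y B = (1/2) ^ y * (fact (a + y) / fact a) *
     ((H (2*a + B + 2*y + 1) * H (B + y)) / (H (2*a + B + y + 1) * H B)) * T_ratio a x y B"

text \<open>Each factor n! is split as (n - k)! times n (n - 1) ... (n - k + 1), and equal linear
  factors are collected into powers. This cancels the powers produced by the Hankel
  determinant.\<close>

lemma fact_power_split:
  assumes "y \<le> Suc n"
  shows "fact n ^ y = (\<Prod>k<y. fact (n - k)) * (\<Prod>k<y. (real n - real k) ^ (y - 1 - k))"
  using assms
proof (induction y)
  case (Suc y)
  have "(\<Prod>k<Suc y. (real n - real k) ^ (Suc y - 1 - k)) = (\<Prod>k<y. (real n - real k) ^ (y - k))"
    by simp
  also have "\<dots> = (\<Prod>k<y. (real n - real k) ^ (y - 1 - k) * (real n - real k))"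
  proof (rule prod.cong[OF refl])
    fix k assume "k \<in> {..<y}"
    then have "y - k = Suc (y - 1 - k)" by auto
    then show "(real n - real k) ^ (y - k) = (real n - real k) ^ (y - 1 - k) * (real n - real k)" by simp
  qed
  finally have 1: "(\<Prod>k<Suc y. (real n - real k) ^ (Suc y - 1 - k)) =
      (\<Prod>k<y. (real n - real k) ^ (y - 1 - k)) * (\<Prod>k<y. real n - real k)"
    by (simp add: prod.distrib)
  have "y \<le> n" using Suc.prems by simp
  then have 2: "fact (n - y) * (\<Prod>k<y. real n - real k) = fact n"
  proof (induction y)
    case (Suc y)
    then have "fact (n - y) = (real n - real y) * (fact (n - Suc y) :: real)"
      using fact_Suc[of "n - Suc y", where 'a = real] by (simp add: Suc_diff_Suc of_nat_diff)
    then have "fact (n - Suc y) * (\<Prod>k<Suc y. real n - real k) = fact (n - y) * (\<Prod>k<y. real n - real k)"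
      by simp
    then show ?case using Suc by simp
  qed simp
  have "fact n ^ Suc y = (\<Prod>k<y. fact (n - k)) * (\<Prod>k<y. (real n - real k) ^ (y - 1 - k)) * (fact (n - y) * (\<Prod>k<y. real n - real k))"
    using Suc by (simp add: 2)
  then show ?case unfolding 1 by simp
qed simp

lemma selberg_value_eq:
  fixes a x y B :: nat
  defines "N \<equiv> a + x + y"
  assumes "0 < N"
  shows "selberg_value a x y B =
    (\<Prod>k<y. fact (a + k + 1) / fact (N - a - k - 1)) *
    (\<Prod>k<y. fact (B + k) * fact (N + B + k + 1) / (2 * fact (N - 1))) *
    (\<Prod>k<y. fact (N + a + B + 1 + k) * fact (y - 1 - k) * (real N - 1 - real k) ^ (y - 1 - k) / fact (a + B + 2 + y - 1 + k))"
proof (cases "y = 0")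
  case True
  then show ?thesis using H_pos[of "2 * a + B + 1"] H_pos[of B] by (simp add: selberg_value_def T_ratio_def T_def)
next
  case y: False
  define A1 A2 A3 A4 A5 D1 D2 D3 D4 E :: real where
    "A1 = (\<Prod>k<y. fact (N + a + B + 1 + k))" and "A2 = (\<Prod>k<y. fact (N + B + 1 + k))"
    and "A3 = (\<Prod>k<y. fact (2 * a + B + y + 1 + k))" and "A4 = (\<Prod>k<y. fact (a + B + y + 1 + k))"
    and "A5 = (\<Prod>k<y. fact (B + k))"
    and "D1 = (\<Prod>k<y. fact (x + k))" and "D2 = (\<Prod>k<y. fact (x + a + k))"
    and "D3 = (\<Prod>k<y. fact k)" and "D4 = (\<Prod>k<y. fact (a + k))"
    and "E = (\<Prod>k<y. (real N - 1 - real k) ^ (y - 1 - k))"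
  have "x + (2*a + B + 2*y) - y + 1 + k = N + a + B + 1 + k" for k by (simp add: N_def)
  then have t1: "T (x + 1) (2*a + B + 2*y) y = A1 / D1"
    using T_eq_fact[of y "2*a + B + 2*y" x] by (simp only: A1_def D1_def)
  have "x + a + (B + 2*y) - y + 1 + k = N + B + 1 + k" for k by (simp add: N_def)
  then have t2: "T (x + a + 1) (B + 2*y) y = A2 / D2"
    using T_eq_fact[of y "B + 2*y" "x + a"] by (simp only: A2_def D2_def)
  have t3: "T 1 (2*a + B + 2*y) y = A3 / D3"
    using T_eq_fact[of y "2*a + B + 2*y" 0] by (simp add: A3_def D3_def algebra_simps)
  have "a + (B + 2*y) - y + 1 + k = a + B + y + 1 + k" for k by simp
  then have t4: "T (a + 1) (B + 2*y) y = A4 / D4"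
    using T_eq_fact[of y "B + 2*y" a] by (simp only: A4_def D4_def)
  have h1: "H (2*a + B + 2*y + 1) / H (2*a + B + y + 1) = A3"
    using H_ratio[of "2*a + B + y + 1" y] by (simp add: A3_def algebra_simps)
  have h2: "H (B + y) / H B = A5"
    using H_ratio[of B y] by (simp add: A5_def)
  have f1: "(\<Prod>k<y. fact (a + k + 1)) = fact (a + y) / fact a * D4"
    unfolding D4_def by (induction y) (simp_all del: fact_Suc)
  have f2: "(\<Prod>k<y. fact (N - a - k - 1)) = D1"
  proof -
    have "(\<Prod>k<y. fact (N - a - k - 1)) = (\<Prod>k<y. fact (x + (y - Suc k)) :: real)"
      by (intro prod.cong arg_cong[of _ _ fact]) (auto simp: N_def)
    then show ?thesis unfolding D1_def by (simp only: prod.nat_diff_reindex[of "\<lambda>k. fact (x + k)"])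
  qed
  have f3: "(\<Prod>k<y. fact (y - 1 - k)) = D3"
    using prod.nat_diff_reindex[of fact y] by (simp add: D3_def)
  \<comment> \<open>The denominators (N - 1)! of the columns supply one of the products in
    \<open>T\<close> and absorb the powers E.\<close>
  have f4: "fact (N - 1) ^ y = D2 * E"
  proof -
    have "(\<Prod>k<y. fact (N - 1 - k)) = (\<Prod>k<y. fact (x + a + (y - Suc k)) :: real)"
      by (intro prod.cong arg_cong[of _ _ fact]) (auto simp: N_def)
    also have "\<dots> = D2" unfolding D2_def by (simp only: prod.nat_diff_reindex[of "\<lambda>k. fact (x + a + k)"])
    moreover have "(\<Prod>k<y. (real (N - 1) - real k) ^ (y - 1 - k)) = E"
      unfolding E_def using \<open>0 < N\<close> by (simp add: of_nat_diff)
    ultimately show ?thesis using fact_power_split[of y "N - 1"] by (simp add: N_def)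
  qed
  have pos: "A1 > 0" "A2 > 0" "A3 > 0" "A4 > 0" "A5 > 0" "D1 > 0" "D2 > 0" "D3 > 0" "D4 > 0"
    unfolding A1_def A2_def A3_def A4_def A5_def D1_def D2_def D3_def D4_def
    by (auto intro!: prod_pos)
  \<comment> \<open>No inspection of signs is needed: D2 * E is a power of a factorial.\<close>
  have Epos: "E > 0"
  proof -
    have "D2 * E > 0" using f4[symmetric] by simp
    then show ?thesis using pos by (simp add: zero_less_mult_iff)
  qed
  have l: "selberg_value a x y B = (1/2) ^ y * (fact (a + y) / fact a) * (A3 * A5) * ((A1 / D1 * (A2 / D2)) / (A3 / D3 * (A4 / D4)))"
    unfolding selberg_value_def T_ratio_def t1 t2 t3 t4 h1[symmetric] h2[symmetric] by simp
  have a4: "(\<Prod>k<y. fact (a + B + 2 + y - 1 + k)) = A4"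
    unfolding A4_def by (intro prod.cong arg_cong[of _ _ fact]) auto
  have r: "(\<Prod>k<y. fact (a + k + 1) / fact (N - a - k - 1)) *
    (\<Prod>k<y. fact (B + k) * fact (N + B + k + 1) / (2 * fact (N - 1))) *
    (\<Prod>k<y. fact (N + a + B + 1 + k) * fact (y - 1 - k) * (real N - 1 - real k) ^ (y - 1 - k) / fact (a + B + 2 + y - 1 + k))
    = (fact (a + y) / fact a * D4) / D1 * (A5 * A2 / (2 ^ y * (D2 * E))) * (A1 * D3 * E / A4)"
    unfolding prod_dividef prod.distrib f1 f2 f3 a4 f4[symmetric]
    by (simp add: A1_def A2_def A5_def E_def power_mult_distrib add.commute add.left_commute)
  show ?thesis unfolding l r using pos Epos
    by (simp add: field_simps power_one_over)
qed

text \<open>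
  The squared Vandermonde product is split into two determinants whose Newton factors extend the weight
  at either end of the interval, so that Cauchy-Binet leaves one-variable sums of the same shape.
\<close>

theorem selberg_sum:
  fixes a x y B :: nat
  defines "N \<equiv> a + x + y"
  shows "(\<Sum>S | S \<subseteq> {a + 1..N} \<and> card S = y. (\<Prod>s\<in>S. selberg_weight a N B s) * (square_vandermonde S)\<^sup>2) =
    selberg_value a x y B"
proof (cases "y = 0")
  case True
  have "{S. S \<subseteq> {a + 1..N} \<and> card S = 0} = {{}}"
    using finite_subset[of _ "{a + 1..N}"] by auto
  then show ?thesis using True H_pos[of "2 * a + B + 1"] H_pos[of B]
    by (simp add: selberg_value_def T_ratio_def T_def square_vandermonde_def)
next
  case y: False
  then have N: "0 < N" by (simp add: N_def)
  let ?W = "{a + 1..N}"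
  define P where "P i s = selberg_weight a N B s * (\<Prod>u<i. (real s)\<^sup>2 - (real (a + 1 + u))\<^sup>2)" for i s
  define G where "G j s = (\<Prod>u<j. (real (N + B + 1 + u))\<^sup>2 - (real s)\<^sup>2)" for j s
  \<comment> \<open>The sign of turning round all Newton factors of G. It occurs a second time
    because Y - X + k is -(N - 1 - k) in the Hankel determinant, and thus cancels.\<close>
  define sg :: real where "sg = (\<Prod>j<y. (-1) ^ j)"
  have sg2: "sg * sg = 1" unfolding sg_def by (simp add: prod.distrib[symmetric] power_add[symmetric] flip: mult_2)
  have "(\<Sum>S | S \<subseteq> ?W \<and> card S = y. (\<Prod>s\<in>S. selberg_weight a N B s) * (square_vandermonde S)\<^sup>2) =
     sg * (\<Sum>S | S \<subseteq> ?W \<and> card S = y. fdet y (\<lambda>i j. P j (enum S i)) * fdet y (\<lambda>i j. G j (enum S i)))"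
    unfolding sum_distrib_left
  proof (rule sum.cong[OF refl])
    fix S assume "S \<in> {S. S \<subseteq> ?W \<and> card S = y}"
    then have S: "finite S" "card S = y" by (auto intro: finite_subset)
    have 1: "fdet y (\<lambda>i j. P j (enum S i)) = (\<Prod>s\<in>S. selberg_weight a N B s) * square_vandermonde S"
    proof -
      have "fdet y (\<lambda>i j. P j (enum S i)) =
        fdet y (\<lambda>i j. selberg_weight a N B (enum S i) * 1 * (\<Prod>u<j. (real (enum S i))\<^sup>2 - (real (a + 1 + u))\<^sup>2))"
        by (simp add: P_def)
      also have "\<dots> = (\<Prod>s\<in>S. selberg_weight a N B s) * square_vandermonde S"
        by (subst fdet_scale, subst fdet_enum_newton[OF S], subst prod_enum[OF S]) simp
      finally show ?thesis .
    qed
    have 2: "fdet y (\<lambda>i j. G j (enum S i)) = sg * square_vandermonde S"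
    proof -
      have "G j s = (-1) ^ j * (\<Prod>u<j. (real s)\<^sup>2 - (real (N + B + 1 + u))\<^sup>2)" for j s
        unfolding G_def by (induction j) (auto simp: algebra_simps)
      then have "fdet y (\<lambda>i j. G j (enum S i)) =
        fdet y (\<lambda>i j. 1 * (-1) ^ j * (\<Prod>u<j. (real (enum S i))\<^sup>2 - (real (N + B + 1 + u))\<^sup>2))"
        by simp
      also have "\<dots> = sg * square_vandermonde S"
        by (subst fdet_scale, subst fdet_enum_newton[OF S]) (simp add: sg_def)
      finally show ?thesis .
    qed
    show "(\<Prod>s\<in>S. selberg_weight a N B s) * (square_vandermonde S)\<^sup>2 =
      sg * (fdet y (\<lambda>i j. P j (enum S i)) * fdet y (\<lambda>i j. G j (enum S i)))"
      unfolding 1 2 using sg2 by (simp add: power2_eq_square mult_ac)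
  qed
  also have "(\<Sum>S | S \<subseteq> ?W \<and> card S = y. fdet y (\<lambda>i j. P j (enum S i)) * fdet y (\<lambda>i j. G j (enum S i))) =
      fdet y (\<lambda>i j. \<Sum>s\<in>?W. P i s * G j s)"
    by (rule cauchy_binet[symmetric]) simp
  also have "\<dots> = fdet y (\<lambda>i j. (fact (a + i + 1) / fact (N - a - i - 1)) *
      (fact (B + j) * fact (N + B + j + 1) / (2 * fact (N - 1))) *
      (fact (N + a + B + 1 + i + j) / fact (a + B + 2 + i + j)))"
  proof (rule fdet_cong)
    fix i j assume i: "i < y"
    have "(\<Sum>s\<in>?W. P i s * G j s) = (\<Sum>s\<in>?W. selberg_weight (a + i) N (B + j) s)"
      by (intro sum.cong refl) (simp add: P_def G_def selberg_weight_add)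
    \<comment> \<open>The additional Newton factors vanish at s = a + 1, ..., a + i.\<close>
    also have "\<dots> = (\<Sum>s\<in>{a + i + 1..N}. selberg_weight (a + i) N (B + j) s)"
      by (rule sum.mono_neutral_right) (auto simp: selberg_weight_def)
    also have "\<dots> = fact (a + i + 1) * fact (B + j) / (2 * fact (a + i + (B + j) + 2)) *
        pochhammer (real N - real (a + i)) (2 * (a + i) + (B + j) + 2) * pochhammer (real N) (B + j + 2)"
      by (rule selberg_weight_sum) (use i in \<open>simp add: N_def\<close>)
    also have "pochhammer (real N - real (a + i)) (2 * (a + i) + (B + j) + 2) =
        fact (N + a + B + 1 + i + j) / fact (N - a - i - 1)"
    proof -
      have "real N - real (a + i) = real (N - a - i - 1) + 1"
        using i by (simp add: N_def of_nat_diff)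
      moreover have "N - a - i - 1 + (2 * (a + i) + (B + j) + 2) = N + a + B + 1 + i + j"
        using i by (simp add: N_def)
      ultimately show ?thesis by (simp only: pochhammer_Suc_fact)
    qed
    also have "pochhammer (real N) (B + j + 2) = fact (N + B + j + 1) / fact (N - 1)"
    proof -
      have "real N = real (N - 1) + 1" using N by (simp add: of_nat_diff)
      moreover have "N - 1 + (B + j + 2) = N + B + j + 1" using N by simp
      ultimately show ?thesis by (metis pochhammer_Suc_fact)
    qed
    finally show "(\<Sum>s\<in>?W. P i s * G j s) = (fact (a + i + 1) / fact (N - a - i - 1)) *
      (fact (B + j) * fact (N + B + j + 1) / (2 * fact (N - 1))) *
      (fact (N + a + B + 1 + i + j) / fact (a + B + 2 + i + j))"
      by (simp only: add.assoc add.commute add.left_commute times_divide_eq_left times_divide_eq_right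
          divide_divide_eq_left divide_divide_eq_right mult_ac)
  qed
  also have "\<dots> = (\<Prod>k<y. fact (a + k + 1) / fact (N - a - k - 1)) *
    (\<Prod>k<y. fact (B + k) * fact (N + B + k + 1) / (2 * fact (N - 1))) *
    (\<Prod>k<y. fact (N + a + B + 1 + k) * fact (y - 1 - k) * (real (a + B + 2) - real (N + a + B + 1) + real k) ^ (y - 1 - k) / fact (a + B + 2 + y - 1 + k))"
    by (simp only: fdet_scale hankel_factorial_det)
  also have "(\<Prod>k<y. fact (N + a + B + 1 + k) * fact (y - 1 - k) * (real (a + B + 2) - real (N + a + B + 1) + real k) ^ (y - 1 - k) / fact (a + B + 2 + y - 1 + k))
    = sg * (\<Prod>k<y. fact (N + a + B + 1 + k) * fact (y - 1 - k) * (real N - 1 - real k) ^ (y - 1 - k) / fact (a + B + 2 + y - 1 + k))"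
  proof -
    have "sg = (\<Prod>k<y. (-1) ^ (y - 1 - k))"
      unfolding sg_def using prod.nat_diff_reindex[of "\<lambda>k. (-1 :: real) ^ k" y] by simp
    moreover have "(real (a + B + 2) - real (N + a + B + 1) + real k) ^ (y - 1 - k) = (-1) ^ (y - 1 - k) * (real N - 1 - real k) ^ (y - 1 - k)" for k
    proof -
      have "real (a + B + 2) - real (N + a + B + 1) + real k = (-1) * (real N - 1 - real k)" by simp
      then show ?thesis by (simp only: power_mult_distrib)
    qed
    ultimately show ?thesis
      by (simp only: prod.distrib[symmetric]) (simp add: mult_ac)
  qed
  finally have eq: "(\<Sum>S | S \<subseteq> ?W \<and> card S = y. (\<Prod>s\<in>S. selberg_weight a N B s) * (square_vandermonde S)\<^sup>2) =
    sg * ((\<Prod>k<y. fact (a + k + 1) / fact (N - a - k - 1)) *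
    (\<Prod>k<y. fact (B + k) * fact (N + B + k + 1) / (2 * fact (N - 1))) *
    (sg * (\<Prod>k<y. fact (N + a + B + 1 + k) * fact (y - 1 - k) * (real N - 1 - real k) ^ (y - 1 - k) / fact (a + B + 2 + y - 1 + k))))" .
  have "sg * (p * q * (sg * r)) = p * q * r" for p q r
    using sg2 by (simp add: mult.left_commute mult.assoc[symmetric])
  then show ?thesis
    unfolding eq selberg_value_eq[OF N[unfolded N_def], folded N_def] .
qed

section \<open>Unit triangles and lozenges\<close>

lemma up_subset_iff: "up u k \<subseteq> S \<longleftrightarrow> (u, k) \<in> S \<and> (u + 1, k) \<in> S \<and> (u + 1/2, k + 1) \<in> S"
  by (simp add: up_def)

lemma down_subset_iff: "down u k \<subseteq> S \<longleftrightarrow> (u, k) \<in> S \<and> (u + 1, k) \<in> S \<and> (u + 1/2, k - 1) \<in> S"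
  by (simp add: down_def)

lemma up_eq_iff [simp]: "up u k = up u' k' \<longleftrightarrow> u = u' \<and> k = k'"
proof
  assume "up u k = up u' k'"
  then have "up u k \<subseteq> up u' k'" by simp
  then have "(u, k) \<in> up u' k'" "(u + 1/2, k + 1) \<in> up u' k'"
    by (simp_all only: up_subset_iff)
  then show "u = u' \<and> k = k'" by (simp add: up_def) linarith
qed simp

lemma down_eq_iff [simp]: "down u k = down u' k' \<longleftrightarrow> u = u' \<and> k = k'"
proof
  assume "down u k = down u' k'"
  then have "down u k \<subseteq> down u' k'" by simp
  then have "(u, k) \<in> down u' k'" "(u + 1/2, k - 1) \<in> down u' k'"
    by (simp_all only: down_subset_iff)
  then show "u = u' \<and> k = k'" by (simp add: down_def) linarith
qed simp

lemma up_neq_down [simp]: "up u k \<noteq> down u' k'" "down u' k' \<noteq> up u k"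
proof -
  have "up u k \<noteq> down u' k'"
  proof
    assume "up u k = down u' k'"
    then have "up u k \<subseteq> down u' k'" by simp
    then have "(u, k) \<in> down u' k'" "(u + 1, k) \<in> down u' k'" "(u + 1/2, k + 1) \<in> down u' k'"
      by (simp_all only: up_subset_iff)
    then show False by (simp add: down_def) linarith
  qed
  then show "up u k \<noteq> down u' k'" "down u' k' \<noteq> up u k" by metis+
qed

lemma up_in_unit_triangles [simp]: "up u k \<in> unit_triangles \<longleftrightarrow> (u, k) \<in> Defs.lattice"
  by (auto simp: unit_triangles_def)

lemma down_in_unit_triangles [simp]: "down u k \<in> unit_triangles \<longleftrightarrow> (u, k) \<in> Defs.lattice"
  by (auto simp: unit_triangles_def)

lemma unit_triangle_cases:
  assumes "s \<in> unit_triangles"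
  obtains u k where "s = up u k" "(u, k) \<in> Defs.lattice" | u k where "s = down u k" "(u, k) \<in> Defs.lattice"
  using assms by (auto simp: unit_triangles_def)

lemma card_2_obtain:
  assumes "card A = 2"
  obtains p q where "p \<in> A" "q \<in> A" "p \<noteq> q"
  using assms by (auto simp: card_2_iff)

lemma card_up_down: "card (up u k) = 3" "card (down u k) = 3"
  by (auto simp: up_def down_def)

lemma not_adjacent_up_up: "card (up u k \<inter> up u' k') = 2 \<Longrightarrow> False"
proof (cases "u = u' \<and> k = k'")
  case False
  then show "card (up u k \<inter> up u' k') = 2 \<Longrightarrow> False"
    by (elim card_2_obtain) (auto simp: up_def)
qed (auto simp: card_up_down)

lemma not_adjacent_down_down: "card (down u k \<inter> down u' k') = 2 \<Longrightarrow> False"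
proof (cases "u = u' \<and> k = k'")
  case False
  then show "card (down u k \<inter> down u' k') = 2 \<Longrightarrow> False"
    by (elim card_2_obtain) (auto simp: down_def)
qed (auto simp: card_up_down)

lemma mem_up: "(x, m) \<in> up u k \<longleftrightarrow> m = k \<and> x = u \<or> m = k \<and> x = u + 1 \<or> m = k + 1 \<and> x = u + 1/2"
  by (auto simp: up_def)

lemma mem_down: "(x, m) \<in> down u k \<longleftrightarrow> m = k \<and> x = u \<or> m = k \<and> x = u + 1 \<or> m = k - 1 \<and> x = u + 1/2"
  by (auto simp: down_def)

lemma card_up_Int_down:
  assumes "p \<in> up u k" "p \<in> down u' k'" "q \<in> up u k" "q \<in> down u' k'" "p \<noteq> q"
  shows "card (up u k \<inter> down u' k') = 2"
proof -
  have f: "finite (up u k)" "finite (down u' k')" by (auto simp: up_def down_def)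
  have "\<not> up u k \<subseteq> down u' k'"
    using card_subset_eq[OF f(2), of "up u k"] by (auto simp: card_up_down)
  then have "card (up u k \<inter> down u' k') < card (up u k)"
    by (intro psubset_card_mono[OF f(1)]) auto
  moreover have "card {p, q} \<le> card (up u k \<inter> down u' k')"
    by (rule card_mono) (use f assms in auto)
  ultimately show ?thesis using assms(5) by (simp add: card_up_down)
qed

lemma adjacent_up_down:
  "card (up u k \<inter> down u' k') = 2 \<longleftrightarrow> (u' = u \<and> k' = k) \<or> (k' = k + 1 \<and> (u' = u + 1/2 \<or> u' = u - 1/2))"
proof
  assume "card (up u k \<inter> down u' k') = 2"
  then obtain p q where pq: "p \<in> up u k" "p \<in> down u' k'" "q \<in> up u k" "q \<in> down u' k'" "p \<noteq> q"
    by (elim card_2_obtain) blast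
  obtain x m y m' where p: "p = (x, m)" and q: "q = (y, m')" by (cases p, cases q)
  note mem = pq[unfolded p q mem_up mem_down prod.inject]
  have ne: "x \<noteq> y \<or> m \<noteq> m'" using mem(5) by simp
  consider "k' = k" | "k' = k + 1" | "k' \<noteq> k" "k' \<noteq> k + 1" by blast
  then show "(u' = u \<and> k' = k) \<or> (k' = k + 1 \<and> (u' = u + 1/2 \<or> u' = u - 1/2))"
  proof cases
    case 1
    have "m = k" using mem(1,2) 1 by (elim disjE conjE) linarith+
    moreover have "m' = k" using mem(3,4) 1 by (elim disjE conjE) linarith+
    ultimately have "x \<noteq> y" "x = u \<or> x = u + 1" "x = u' \<or> x = u' + 1" "y = u \<or> y = u + 1" "y = u' \<or> y = u' + 1"
      using mem ne 1 by simp_all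
    then have "u' = u" by (elim disjE) linarith+
    then show ?thesis using 1 by simp
  next
    case 2
    have "m = k \<or> m' = k"
    proof (rule ccontr)
      assume "\<not> (m = k \<or> m' = k)"
      then have "m = k + 1" "x = u + 1/2" "m' = k + 1" "y = u + 1/2" using mem(1,3) by simp_all
      then show False using ne by simp
    qed
    then have "u' = u - 1/2 \<or> u' = u + 1/2"
    proof
      assume "m = k"
      then have "x = u \<or> x = u + 1" "x = u' + 1/2" using mem(1,2) 2 by simp_all
      then show ?thesis by (elim disjE) linarith+
    next
      assume "m' = k"
      then have "y = u \<or> y = u + 1" "y = u' + 1/2" using mem(3,4) 2 by simp_all
      then show ?thesis by (elim disjE) linarith+
    qed
    then show ?thesis using 2 by blast
  next
    case 3
    have "m = k + 1" using mem(1,2) 3 by (elim disjE conjE) linarith+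
    moreover have "m' = k + 1" using mem(3,4) 3 by (elim disjE conjE) linarith+
    ultimately have "x = u + 1/2" "y = u + 1/2" using mem(1,3) by simp_all
    then show ?thesis using ne \<open>m = k + 1\<close> \<open>m' = k + 1\<close> by simp
  qed
next
  assume "(u' = u \<and> k' = k) \<or> (k' = k + 1 \<and> (u' = u + 1/2 \<or> u' = u - 1/2))"
  then consider "u' = u" "k' = k" | "k' = k + 1" "u' = u + 1/2" | "k' = k + 1" "u' = u - 1/2" by blast
  then show "card (up u k \<inter> down u' k') = 2"
  proof cases
    case 1
    then show ?thesis
      by (intro card_up_Int_down[of "(u, k)" _ _ _ _ "(u + 1, k)"]) (simp_all add: mem_up mem_down)
  next
    case 2
    then show ?thesis
      by (intro card_up_Int_down[of "(u + 1, k)" _ _ _ _ "(u + 1/2, k + 1)"]) (simp_all add: mem_up mem_down)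
  next
    case 3
    then show ?thesis
      by (intro card_up_Int_down[of "(u, k)" _ _ _ _ "(u + 1/2, k + 1)"]) (simp_all add: mem_up mem_down)
  qed
qed

lemma doubleton_in_lozenges:
  "{s, t} \<in> lozenges \<longleftrightarrow> s \<in> unit_triangles \<and> t \<in> unit_triangles \<and> card (s \<inter> t) = 2"
proof
  assume "{s, t} \<in> lozenges"
  then obtain s' t' where "{s, t} = {s', t'}" "s' \<in> unit_triangles" "t' \<in> unit_triangles" "card (s' \<inter> t') = 2"
    unfolding lozenges_def mem_Collect_eq by (elim exE conjE)
  moreover from this(1) have "s = s' \<and> t = t' \<or> s = t' \<and> t = s'" by (simp add: doubleton_eq_iff)
  ultimately show "s \<in> unit_triangles \<and> t \<in> unit_triangles \<and> card (s \<inter> t) = 2"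
    by (elim disjE) (simp_all add: Int_commute)
next
  assume "s \<in> unit_triangles \<and> t \<in> unit_triangles \<and> card (s \<inter> t) = 2"
  then show "{s, t} \<in> lozenges"
    unfolding lozenges_def mem_Collect_eq by (intro exI[of _ s] exI[of _ t]) simp
qed

lemma up_down_in_lozenges:
  "{up u k, down u' k'} \<in> lozenges \<longleftrightarrow> (u, k) \<in> Defs.lattice \<and> (u', k') \<in> Defs.lattice \<and>
     ((u' = u \<and> k' = k) \<or> (k' = k + 1 \<and> (u' = u + 1/2 \<or> u' = u - 1/2)))"
  by (simp only: doubleton_in_lozenges adjacent_up_down up_in_unit_triangles down_in_unit_triangles)

lemma up_up_notin_lozenges: "{up u k, up u' k'} \<notin> lozenges"
  by (meson doubleton_in_lozenges not_adjacent_up_up)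

lemma down_down_notin_lozenges: "{down u k, down u' k'} \<notin> lozenges"
  by (meson doubleton_in_lozenges not_adjacent_down_down)

text \<open>The normal form used throughout: the up-pointing half comes first. The case of equal
  heights is the vertical lozenge, the others are the two slanted ones.\<close>

lemma lozenge_cases:
  assumes "l \<in> lozenges"
  obtains u k u' k' where "l = {up u k, down u' k'}" "(u, k) \<in> Defs.lattice" "(u', k') \<in> Defs.lattice"
    "(u' = u \<and> k' = k) \<or> (k' = k + 1 \<and> (u' = u + 1/2 \<or> u' = u - 1/2))"
proof -
  obtain s t where st: "l = {s, t}" "s \<in> unit_triangles" "t \<in> unit_triangles"
    using assms unfolding lozenges_def mem_Collect_eq by (elim exE conjE)
  note l = assms[unfolded st(1)]
  have "\<exists>u k u' k'. l = {up u k, down u' k'}"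
    using st(2)
  proof (cases rule: unit_triangle_cases)
    case s: (1 u k)
    from st(3) show ?thesis
    proof (cases rule: unit_triangle_cases)
      case (1 u' k')
      then show ?thesis using l s(1) up_up_notin_lozenges by simp
    next
      case (2 u' k')
      then show ?thesis using st(1) s(1) by blast
    qed
  next
    case s: (2 u k)
    from st(3) show ?thesis
    proof (cases rule: unit_triangle_cases)
      case (1 u' k')
      then have "l = {up u' k', down u k}" using st(1) s(1) by (simp add: insert_commute)
      then show ?thesis by blast
    next
      case (2 u' k')
      then show ?thesis using l s(1) down_down_notin_lozenges by simp
    qed
  qed
  then obtain u k u' k' where e: "l = {up u k, down u' k'}" by blast
  show thesis
    by (rule that[OF e]) (use assms e up_down_in_lozenges in simp_all)
qed

lemma card_lozenge: "l \<in> lozenges \<Longrightarrow> card l = 2"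
  by (erule lozenge_cases) simp

lemma card_cell_edge: "l \<in> cell_edges \<Longrightarrow> card l = 2"
proof -
  assume "l \<in> cell_edges"
  then obtain s t where "l = {s, t}" "cell_adj s t" by (auto simp: cell_edges_def)
  then show ?thesis by (cases s; cases t) auto
qed

section \<open>Quartered hexagons in cell coordinates\<close>

text \<open>
  The polygon of a quartered hexagon of height J: its west zigzag bulges out for even J (as for Q)
  and in for odd J (as for K'), and ends in the same way at the north side.
\<close>

definition west :: "nat \<Rightarrow> int \<Rightarrow> real" where
  "west J k = (if even k then 0 else if even J then - 1/2 else 1/2)"

definition quarter_polygon :: "nat \<Rightarrow> nat \<Rightarrow> point set" where
  "quarter_polygon J n = {(u, k). 0 \<le> k \<and> k \<le> int J \<and> west J k \<le> u \<and> u \<le> real n - of_int k / 2}"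

text \<open>Cells count lines from the north side, heights are measured from the base; hence the
  height J - j.\<close>

fun cell_triangle :: "nat \<Rightarrow> cell \<Rightarrow> triangle" where
  "cell_triangle J (UpC j i) = up (west J (int J - int j) + real i) (int J - int j)"
| "cell_triangle J (DnC j i) = down (west J (int J - int j) + real i) (int J - int j)"

text \<open>The step depends on j alone and not on the parity of J. This is why one adjacency
  relation on cells serves both kinds of zigzag.\<close>

lemma west_step: "west J (int J - int j) = west J (int J - int j - 1) + (if even j then 1/2 else - 1/2)"
  by (auto simp: west_def)

lemma west_lattice: "west J k - of_int k / 2 \<in> \<int>"
proof (cases "even k")
  case True
  then show ?thesis by (auto simp: west_def elim!: evenE)
next
  case False
  then obtain m where "k = 2 * m + 1" by (rule oddE)
  then have "west J k - of_int k / 2 = of_int (if even J then - m - 1 else - m)"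
    by (simp add: west_def field_simps)
  then show ?thesis by (metis Ints_of_int)
qed

lemma west_lattice_add: "(west J k + real i, k) \<in> Defs.lattice"
proof -
  have "west J k + real i - of_int k / 2 = (west J k - of_int k / 2) + real i" by simp
  also have "\<dots> \<in> \<int>" by (intro Ints_add west_lattice Ints_of_nat)
  finally show ?thesis by (simp add: Defs.lattice_def)
qed

lemma lattice_position:
  assumes "(u, k) \<in> Defs.lattice" "west J k \<le> u"
  obtains i where "u = west J k + real i"
proof -
  have "u - west J k = (u - of_int k / 2) - (west J k - of_int k / 2)" by simp
  also have "\<dots> \<in> \<int>" using assms(1) by (intro Ints_diff[OF _ west_lattice]) (simp add: Defs.lattice_def)
  finally obtain z where z: "u - west J k = of_int z" by (auto elim: Ints_cases)
  then have "0 \<le> z" using assms(2) by simp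
  then show thesis using z that[of "nat z"] by simp
qed

lemma width_eq:
  assumes "n = c + (J + 1) div 2" "j \<le> J"
  shows "real (c + (j + 1) div 2) = real n - of_int (int J - int j) / 2 - west J (int J - int j)"
proof (cases "even j")
  case True
  then obtain h where h: "j = 2 * h" by (rule evenE)
  show ?thesis
  proof (cases "even J")
    case True
    then obtain g where "J = 2 * g" by (rule evenE)
    then show ?thesis using assms h by (simp add: west_def field_simps)
  next
    case False
    then obtain g where "J = 2 * g + 1" by (rule oddE)
    then show ?thesis using assms h by (simp add: west_def field_simps)
  qed
next
  case False
  then obtain h where h: "j = 2 * h + 1" by (rule oddE)
  show ?thesis
  proof (cases "even J")
    case True
    then obtain g where "J = 2 * g" by (rule evenE)
    then show ?thesis using assms h by (simp add: west_def field_simps)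
  next
    case False
    then obtain g where "J = 2 * g + 1" by (rule oddE)
    then show ?thesis using assms h by (simp add: west_def field_simps)
  qed
qed

lemma west_diff: "\<bar>west J (k + 1) - west J k\<bar> = 1/2" "\<bar>west J (k - 1) - west J k\<bar> = 1/2"
  by (auto simp: west_def)

lemma up_in_cells: "up u k \<in> cells S \<longleftrightarrow> (u, k) \<in> Defs.lattice \<and> (u, k) \<in> S \<and> (u + 1, k) \<in> S \<and> (u + 1/2, k + 1) \<in> S"
  by (simp add: cells_def up_subset_iff)

lemma down_in_cells: "down u k \<in> cells S \<longleftrightarrow> (u, k) \<in> Defs.lattice \<and> (u, k) \<in> S \<and> (u + 1, k) \<in> S \<and> (u + 1/2, k - 1) \<in> S"
  by (simp add: cells_def down_subset_iff)

text \<open>The apex needs no test against the lateral sides, as neither of them moves by more than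
  one half between consecutive lines.\<close>

lemma up_in_quarter_polygon:
  "up u k \<in> cells (quarter_polygon J n) \<longleftrightarrow>
    (u, k) \<in> Defs.lattice \<and> 0 \<le> k \<and> k + 1 \<le> int J \<and> west J k \<le> u \<and> u + 1 \<le> real n - of_int k / 2"
proof -
  have "west J (k + 1) \<le> west J k + 1/2" using west_diff(1)[of J k] by linarith
  moreover have "real_of_int (k + 1) / 2 = of_int k / 2 + 1/2" by (simp add: field_simps)
  ultimately show ?thesis
    unfolding up_in_cells quarter_polygon_def mem_Collect_eq case_prod_conv
    by (intro iffI; elim conjE; intro conjI; (assumption | linarith))
qed

lemma down_in_quarter_polygon:
  "down u k \<in> cells (quarter_polygon J n) \<longleftrightarrow>
    (u, k) \<in> Defs.lattice \<and> 1 \<le> k \<and> k \<le> int J \<and> west J k \<le> u \<and> u + 1 \<le> real n - of_int k / 2"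
proof -
  have "west J (k - 1) \<le> west J k + 1/2" using west_diff(2)[of J k] by linarith
  moreover have "real_of_int (k - 1) / 2 = of_int k / 2 - 1/2" by (simp add: field_simps)
  ultimately show ?thesis
    unfolding down_in_cells quarter_polygon_def mem_Collect_eq case_prod_conv
    by (intro iffI; elim conjE; intro conjI; (assumption | linarith))
qed

lemma UpC_in_trapezoid: "UpC j i \<in> trapezoid c k V \<longleftrightarrow> 1 \<le> j \<and> j \<le> k \<and> i < c + (j + 1) div 2 \<and> \<not> (j = k \<and> i \<in> V)"
  by (auto simp: trapezoid_def)

lemma DnC_in_trapezoid: "DnC j i \<in> trapezoid c k V \<longleftrightarrow> j < k \<and> i < c + (j + 1) div 2"
  by (auto simp: trapezoid_def)

lemma cells_quarter_polygon:
  assumes n: "n = c + (J + 1) div 2"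
  shows "cells (quarter_polygon J n) = cell_triangle J ` trapezoid c J {}"
proof (intro equalityI subsetI)
  fix s assume s: "s \<in> cells (quarter_polygon J n)"
  then have "s \<in> unit_triangles" by (simp add: cells_def)
  then show "s \<in> cell_triangle J ` trapezoid c J {}"
  proof (cases rule: unit_triangle_cases)
    case (1 u k)
    then have k: "0 \<le> k" "k + 1 \<le> int J" "west J k \<le> u" "u + 1 \<le> real n - of_int k / 2"
      using s up_in_quarter_polygon by auto
    obtain i where i: "u = west J k + real i" using lattice_position[OF 1(2) k(3)] .
    define j where "j = nat (int J - k)"
    have j: "k = int J - int j" "1 \<le> j" "j \<le> J" using k by (auto simp: j_def)
    have "real i < real (c + (j + 1) div 2)"
      unfolding width_eq[OF n j(3)] using k i j by simp
    then have "UpC j i \<in> trapezoid c J {}" using j by (simp add: UpC_in_trapezoid)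
    moreover have "s = cell_triangle J (UpC j i)" using 1 i j by simp
    ultimately show ?thesis by blast
  next
    case (2 u k)
    then have k: "1 \<le> k" "k \<le> int J" "west J k \<le> u" "u + 1 \<le> real n - of_int k / 2"
      using s down_in_quarter_polygon by auto
    obtain i where i: "u = west J k + real i" using lattice_position[OF 2(2) k(3)] .
    define j where "j = nat (int J - k)"
    have j: "k = int J - int j" "j < J" using k by (auto simp: j_def)
    have "real i < real (c + (j + 1) div 2)"
      unfolding width_eq[OF n less_imp_le[OF j(2)]] using k i j by simp
    then have "DnC j i \<in> trapezoid c J {}" using j by (simp add: DnC_in_trapezoid)
    moreover have "s = cell_triangle J (DnC j i)" using 2 i j by simp
    ultimately show ?thesis by blast
  qed
next
  fix s assume "s \<in> cell_triangle J ` trapezoid c J {}"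
  then obtain r where r: "s = cell_triangle J r" "r \<in> trapezoid c J {}" by auto
  show "s \<in> cells (quarter_polygon J n)"
  proof (cases r)
    case (UpC j i)
    then have j: "1 \<le> j" "j \<le> J" "i + 1 \<le> c + (j + 1) div 2" using r by (auto simp: UpC_in_trapezoid)
    then have "real (i + 1) \<le> real n - of_int (int J - int j) / 2 - west J (int J - int j)"
      unfolding width_eq[OF n j(2), symmetric] by (simp only: of_nat_le_iff)
    then show ?thesis using UpC r j by (simp add: up_in_quarter_polygon west_lattice_add)
  next
    case (DnC j i)
    then have j: "j < J" "i + 1 \<le> c + (j + 1) div 2" using r by (auto simp: DnC_in_trapezoid)
    then have "real (i + 1) \<le> real n - of_int (int J - int j) / 2 - west J (int J - int j)"
      unfolding width_eq[OF n less_imp_le[OF j(1)], symmetric] by (simp only: of_nat_le_iff)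
    then show ?thesis using DnC r j by (simp add: down_in_quarter_polygon west_lattice_add)
  qed
qed

text \<open>An arbitrary n need not have the form required for the description by cells, but
  enlarging n to such a value only enlarges the polygon.\<close>

lemma finite_quarter_polygon: "finite (cells (quarter_polygon J n))"
proof (rule finite_subset)
  show "cells (quarter_polygon J n) \<subseteq> cells (quarter_polygon J (n + (J + 1) div 2))"
    unfolding cells_def quarter_polygon_def by fastforce
  show "finite (cells (quarter_polygon J (n + (J + 1) div 2)))"
    unfolding cells_quarter_polygon[OF refl] by (intro finite_imageI finite_trapezoid)
qed

lemma inj_cell_triangle: "inj_on (cell_triangle J) R"
proof (rule inj_onI)
  fix s t assume "cell_triangle J s = cell_triangle J t"
  then show "s = t" by (cases s; cases t) auto
qed

lemma cell_adj_iff_lozenge: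
  "{cell_triangle J (UpC j i), cell_triangle J (DnC j' i')} \<in> lozenges \<longleftrightarrow> cell_adj (UpC j i) (DnC j' i')"
proof -
  let ?u = "west J (int J - int j) + real i" let ?u' = "west J (int J - int j') + real i'"
  have "{cell_triangle J (UpC j i), cell_triangle J (DnC j' i')} \<in> lozenges \<longleftrightarrow>
     (?u' = ?u \<and> int J - int j' = int J - int j) \<or>
     (int J - int j' = int J - int j + 1 \<and> (?u' = ?u + 1/2 \<or> ?u' = ?u - 1/2))"
    by (simp only: cell_triangle.simps up_down_in_lozenges west_lattice_add) simp
  also have "\<dots> \<longleftrightarrow> cell_adj (UpC j i) (DnC j' i')"
  proof (cases "j = Suc j'")
    case True
    have "west J (int J - int j') = west J (int J - int j) + (if even j' then 1/2 else - 1/2)"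
      using west_step[of J j'] True by (simp add: algebra_simps)
    then show ?thesis using True by auto
  next
    case False
    then show ?thesis by auto
  qed
  finally show ?thesis .
qed

lemma cell_edge_iff_lozenge:
  "{cell_triangle J s, cell_triangle J t} \<in> lozenges \<longleftrightarrow> {s, t} \<in> cell_edges"
proof -
  have e: "{s, t} \<in> cell_edges \<longleftrightarrow> cell_adj s t \<or> cell_adj t s" for s t
    unfolding cell_edges_def by (auto simp: doubleton_eq_iff)
  show ?thesis
  proof (cases s)
    case s: (UpC j i)
    show ?thesis
    proof (cases t)
      case (UpC j' i')
      then show ?thesis using s by (simp add: e up_up_notin_lozenges)
    next
      case (DnC j' i')
      then show ?thesis using s cell_adj_iff_lozenge[of J j i j' i'] by (simp only: e) simp
    qed
  next
    case s: (DnC j i)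
    show ?thesis
    proof (cases t)
      case (UpC j' i')
      have "{cell_triangle J s, cell_triangle J t} = {cell_triangle J t, cell_triangle J s}"
        by (rule insert_commute)
      then show ?thesis using UpC s cell_adj_iff_lozenge[of J j' i' j i]
        by (simp only: e) simp
    next
      case (DnC j' i')
      then show ?thesis using s by (simp add: e down_down_notin_lozenges)
    qed
  qed
qed

section \<open>Forced lozenges in dents\<close>

text \<open>
  A dent X of a polygon R: apart from the base triangles on the line k = 0, it is a union of
  vertical lozenges, and the other neighbours of their down-pointing halves lie in X as well.
\<close>

definition dent_shape :: "triangle set \<Rightarrow> triangle set \<Rightarrow> bool" where
  "dent_shape R X \<longleftrightarrow>
    (\<forall>u k. up u k \<in> X \<inter> R \<longrightarrow> 0 \<le> k) \<and>
    (\<forall>u k. down u k \<in> X \<inter> R \<longrightarrow> 1 \<le> k \<and> up u k \<in> X \<inter> R) \<and>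
    (\<forall>u k. up u k \<in> X \<inter> R \<longrightarrow> 1 \<le> k \<longrightarrow> down u k \<in> X \<inter> R) \<and>
    (\<forall>u k u'. down u k \<in> X \<inter> R \<longrightarrow> (u' = u + 1/2 \<or> u' = u - 1/2) \<longrightarrow> up u' (k - 1) \<in> R \<longrightarrow> up u' (k - 1) \<in> X)"

definition base_triangles :: "triangle set \<Rightarrow> triangle set" where
  "base_triangles X = {up u 0 |u. up u 0 \<in> X}"

definition dent_lozenges :: "triangle set \<Rightarrow> lozenge set" where
  "dent_lozenges X = {{up u k, down u k} |u k. 1 \<le> k \<and> up u k \<in> X}"

lemma dent_lozengesE:
  assumes "l \<in> dent_lozenges X"
  obtains u k where "l = {up u k, down u k}" "1 \<le> k" "up u k \<in> X"
  using assms unfolding dent_lozenges_def mem_Collect_eq by (elim exE conjE)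

lemma dent_lozengesI: "1 \<le> k \<Longrightarrow> up u k \<in> X \<Longrightarrow> {up u k, down u k} \<in> dent_lozenges X"
  unfolding dent_lozenges_def mem_Collect_eq by (intro exI conjI) (rule refl)

lemma up_in_base_triangles: "up u k \<in> base_triangles X \<longleftrightarrow> k = 0 \<and> up u k \<in> X"
  unfolding base_triangles_def mem_Collect_eq up_eq_iff by fastforce

lemma down_notin_base_triangles: "down u k \<notin> base_triangles X"
  unfolding base_triangles_def by simp

text \<open>Without its base triangles a dent fills up with vertical lozenges from bottom to top: a
  down-pointing triangle of the dent could otherwise only be paired with one of the two up-pointing
  triangles below it, and these are base triangles or belong to a lower forced lozenge.\<close>

lemma forced_dent:
  assumes "finite R" "R \<subseteq> unit_triangles" "dent_shape R X"
  shows "weighted_matchings lozenges w (R - base_triangles X) =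
    (\<Prod>l\<in>dent_lozenges (X \<inter> R). w l) * weighted_matchings lozenges w (R - X)"
proof -
  let ?F = "dent_lozenges (X \<inter> R)" let ?R = "R - base_triangles X"
  note shape = assms(3)[unfolded dent_shape_def]
  have s1: "0 \<le> k" if "up u k \<in> X \<inter> R" for u k
    using shape[THEN conjunct1, rule_format, OF that] .
  have s2: "1 \<le> k" "up u k \<in> X \<inter> R" if "down u k \<in> X \<inter> R" for u k
    using shape[THEN conjunct2, THEN conjunct1, rule_format, OF that] by (rule conjunct1, rule conjunct2)
  have s3: "down u k \<in> X \<inter> R" if "up u k \<in> X \<inter> R" "1 \<le> k" for u k
    using shape[THEN conjunct2, THEN conjunct2, THEN conjunct1, rule_format, OF that] .
  have s4: "up u' (k - 1) \<in> X" if "down u k \<in> X \<inter> R" "u' = u + 1/2 \<or> u' = u - 1/2" "up u' (k - 1) \<in> R" for u k u'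
    using shape[THEN conjunct2, THEN conjunct2, THEN conjunct2, rule_format, OF that] .
  have U: "up u k \<in> \<Union>?F \<longleftrightarrow> 1 \<le> k \<and> up u k \<in> X \<inter> R" "down u k \<in> \<Union>?F \<longleftrightarrow> down u k \<in> X \<inter> R" for u k
  proof -
    show "up u k \<in> \<Union>?F \<longleftrightarrow> 1 \<le> k \<and> up u k \<in> X \<inter> R"
    proof
      assume "up u k \<in> \<Union>?F"
      then obtain l where "l \<in> ?F" "up u k \<in> l" by (rule UnionE)
      then show "1 \<le> k \<and> up u k \<in> X \<inter> R" by (elim dent_lozengesE) simp
    next
      assume "1 \<le> k \<and> up u k \<in> X \<inter> R"
      then have "{up u k, down u k} \<in> ?F" by (intro dent_lozengesI) simp_all
      then show "up u k \<in> \<Union>?F" by (rule UnionI) simp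
    qed
    show "down u k \<in> \<Union>?F \<longleftrightarrow> down u k \<in> X \<inter> R"
    proof
      assume "down u k \<in> \<Union>?F"
      then obtain l where "l \<in> ?F" "down u k \<in> l" by (rule UnionE)
      then have "1 \<le> k \<and> up u k \<in> X \<inter> R" by (elim dent_lozengesE) simp
      then show "down u k \<in> X \<inter> R" using s3 by simp
    next
      assume "down u k \<in> X \<inter> R"
      then have "{up u k, down u k} \<in> ?F" by (intro dent_lozengesI s2)
      then show "down u k \<in> \<Union>?F" by (rule UnionI) simp
    qed
  qed
  have FU: "s \<in> unit_triangles \<and> s \<in> R \<and> s \<in> X \<and> s \<notin> base_triangles X" if s: "s \<in> \<Union>?F" for s
  proof -
    obtain l where l: "l \<in> ?F" "s \<in> l" using s by (rule UnionE)
    from l(1) obtain u k where "l = {up u k, down u k}" by (rule dent_lozengesE)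
    then have "s = up u k \<or> s = down u k" using l(2) by simp
    then have "s \<in> R \<and> s \<in> X \<and> s \<notin> base_triangles X"
    proof
      assume "s = up u k"
      then show ?thesis using s U(1)[of u k] by (simp add: up_in_base_triangles)
    next
      assume "s = down u k"
      then show ?thesis using s U(2)[of u k] by (simp add: down_notin_base_triangles)
    qed
    then show ?thesis using assms(2) by (simp add: subset_iff)
  qed
  have XR: "s \<in> \<Union>?F \<or> s \<in> base_triangles X" if s: "s \<in> X \<inter> R" for s
  proof -
    have "s \<in> unit_triangles" using s assms(2) by (simp add: subset_iff)
    then show ?thesis
    proof (cases rule: unit_triangle_cases)
      case (1 u k)
      then have "0 \<le> k" using s1[of u k] s by simp
      then have "k = 0 \<or> 1 \<le> k" by linarith
      then show ?thesis
      proof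
        assume "k = 0"
        then show ?thesis using 1(1) s by (simp add: up_in_base_triangles)
      next
        assume "1 \<le> k"
        then show ?thesis using 1(1) s U(1)[of u k] by simp
      qed
    next
      case (2 u k)
      then show ?thesis using s U(2)[of u k] by simp
    qed
  qed
  \<comment> \<open>The rank is the height of the highest vertex, k + 1 for the vertical lozenge at
    height k.\<close>
  have rk: "nat (Max (snd ` \<Union>{up u k, down u k})) = nat (k + 1)" for u k
    by (simp add: up_def down_def)
  have "weighted_matchings lozenges w ?R = (\<Prod>l\<in>?F. w l) * weighted_matchings lozenges w (?R - \<Union>?F)"
  proof (rule weighted_matchings_forced[where rk = "\<lambda>l. nat (Max (snd ` \<Union>l))"])
    show "finite ?R" using assms(1) by simp
    show "{} \<notin> lozenges" using card_lozenge[of "{}"] by fastforce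
    show "?F \<subseteq> lozenges"
    proof
      fix l assume "l \<in> ?F"
      then obtain u k where l: "l = {up u k, down u k}" "up u k \<in> X \<inter> R" by (rule dent_lozengesE)
      then have "(u, k) \<in> Defs.lattice" using subsetD[OF assms(2), of "up u k"] by simp
      then show "l \<in> lozenges" using l by (simp add: up_down_in_lozenges)
    qed
    show "\<Union>?F \<subseteq> ?R"
    proof
      fix s assume "s \<in> \<Union>?F"
      from FU[OF this] show "s \<in> ?R" by simp
    qed
    show "disjoint ?F"
    proof (rule disjointI)
      fix l l' assume l: "l \<in> ?F" "l' \<in> ?F" "l \<noteq> l'"
      from l(1) obtain u k where 1: "l = {up u k, down u k}" by (rule dent_lozengesE)
      from l(2) obtain v m where 2: "l' = {up v m, down v m}" by (rule dent_lozengesE)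
      have "\<not> (u = v \<and> k = m)"
      proof
        assume "u = v \<and> k = m"
        then have "l = l'" using 1 2 by simp
        then show False using l(3) by contradiction
      qed
      then show "l \<inter> l' = {}" unfolding 1 2 by simp
    qed
  next
    fix l assume "l \<in> ?F"
    then obtain u k where l: "l = {up u k, down u k}" "1 \<le> k" "up u k \<in> X \<inter> R" by (rule dent_lozengesE)
    then have d: "down u k \<in> X \<inter> R" by (intro s3)
    show "\<exists>t\<in>l. \<forall>l'\<in>lozenges. t \<in> l' \<longrightarrow> l' \<subseteq> ?R \<longrightarrow> l' \<noteq> l \<longrightarrow>
       (\<exists>l''\<in>?F. nat (Max (snd ` \<Union>l'')) < nat (Max (snd ` \<Union>l)) \<and> l'' \<inter> l' \<noteq> {})"
    proof (rule bexI[of _ "down u k"], intro ballI impI)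
      show "down u k \<in> l" using l by simp
      fix l' assume l': "l' \<in> lozenges" "down u k \<in> l'" "l' \<subseteq> ?R" "l' \<noteq> l"
      from l'(1) obtain v m u' k' where e: "l' = {up v m, down u' k'}"
        and adj: "(u' = v \<and> k' = m) \<or> (k' = m + 1 \<and> (u' = v + 1/2 \<or> u' = v - 1/2))"
        by (rule lozenge_cases)
      have uk: "u' = u" "k' = k" using l'(2) e by simp_all
      have "\<not> (u' = v \<and> k' = m)"
      proof
        assume "u' = v \<and> k' = m"
        then have "l' = l" using e l(1) uk by simp
        then show False using l'(4) by contradiction
      qed
      then have m: "m = k - 1" "v = u + 1/2 \<or> v = u - 1/2" using adj uk by linarith+
      have upR: "up v (k - 1) \<in> R" "up v (k - 1) \<notin> base_triangles X" using l'(3) e m by simp_all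
      have X: "up v (k - 1) \<in> X" using s4[OF d m(2) upR(1)] .
      then have "k - 1 \<noteq> 0" using upR(2) by (simp add: up_in_base_triangles)
      then have k1: "1 \<le> k - 1" using l(2) by linarith
      let ?l = "{up v (k - 1), down v (k - 1)}"
      have "?l \<in> ?F" by (rule dent_lozengesI) (use k1 X upR in simp_all)
      moreover have "nat (Max (snd ` \<Union>?l)) < nat (Max (snd ` \<Union>l))"
        unfolding l(1) rk using k1 by simp
      moreover have "?l \<inter> l' \<noteq> {}"
      proof -
        have "up v (k - 1) \<in> ?l \<inter> l'" using e m by simp
        then show ?thesis by (metis empty_iff)
      qed
      ultimately show "\<exists>l''\<in>?F. nat (Max (snd ` \<Union>l'')) < nat (Max (snd ` \<Union>l)) \<and> l'' \<inter> l' \<noteq> {}"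
        by (intro bexI[of _ ?l] conjI)
    qed
  qed
  moreover have "?R - \<Union>?F = R - X"
  proof (rule Set.set_eqI)
    fix s
    have "s \<in> base_triangles X \<Longrightarrow> s \<in> X"
      unfolding base_triangles_def mem_Collect_eq by (elim exE conjE) simp
    then show "s \<in> ?R - \<Union>?F \<longleftrightarrow> s \<in> R - X" using XR[of s] FU[of s] by blast
  qed
  ultimately show ?thesis by simp
qed

text \<open>Deleting V from the base of a trapezoid amounts to deleting only the base triangles of
  X; the rest of X then costs the weights of its forced lozenges.\<close>

lemma polygon_matchings:
  assumes n: "n = c + (J + 1) div 2" and "dent_shape (cells (quarter_polygon J n)) X"
    and V: "\<And>i. i < n \<Longrightarrow> up (real i) 0 \<in> X \<longleftrightarrow> i \<in> V"
    and w: "\<And>j i. 1 \<le> j \<Longrightarrow> j < J \<Longrightarrow>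
      w {cell_triangle J (UpC j i), cell_triangle J (DnC j i)} = (if odd j \<and> i = 0 then \<omega> else 1)"
    and w1: "\<And>u k u' k'. u \<noteq> u' \<Longrightarrow> w {up u k, down u' k'} = 1"
  shows "trapezoid_matchings \<omega> c J V =
    (\<Prod>l\<in>dent_lozenges (X \<inter> cells (quarter_polygon J n)). w l) *
    weighted_matchings lozenges w (cells (quarter_polygon J n) - X)"
proof -
  let ?R = "cells (quarter_polygon J n)" let ?f = "cell_triangle J"
  have R: "?R = ?f ` trapezoid c J {}" by (rule cells_quarter_polygon[OF n])
  have "?R - base_triangles X = ?f ` trapezoid c J V"
  proof -
    have "?f s \<in> base_triangles X \<longleftrightarrow> s \<notin> trapezoid c J V" if s: "s \<in> trapezoid c J {}" for s
    proof (cases s)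
      case (UpC j i)
      then have j: "1 \<le> j" "j \<le> J" "i < c + (j + 1) div 2" using s by (auto simp: UpC_in_trapezoid)
      show ?thesis
      proof (cases "j = J")
        case True
        then have "?f s = up (real i) 0" using UpC by (simp add: west_def)
        then have "?f s \<in> base_triangles X \<longleftrightarrow> i \<in> V" using V[of i] j n True by (simp add: up_in_base_triangles)
        then show ?thesis using UpC True j by (simp add: UpC_in_trapezoid)
      next
        case False
        then show ?thesis using UpC j by (simp add: UpC_in_trapezoid up_in_base_triangles)
      qed
    next
      case (DnC j i)
      then show ?thesis using s by (simp add: DnC_in_trapezoid down_notin_base_triangles)
    qed
    moreover have "trapezoid c J V \<subseteq> trapezoid c J {}" by (auto simp: trapezoid_def)
    ultimately show ?thesis unfolding R by blast
  qed
  moreover have "weighted_matchings lozenges w (?f ` trapezoid c J V) = trapezoid_matchings \<omega> c J V"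
  proof (rule weighted_matchings_image)
    fix s t assume st: "s \<in> trapezoid c J V" "t \<in> trapezoid c J V" "{s, t} \<in> cell_edges"
    have *: "w {?f s, ?f t} = cell_weight \<omega> {s, t}"
      if st: "s \<in> trapezoid c J V" "t \<in> trapezoid c J V" "cell_adj s t" for s t
    proof -
      obtain j i j' i' where c: "s = UpC j i" "t = DnC j' i'" using st(3) by (cases s; cases t) auto
      show ?thesis
      proof (cases "j = j' \<and> i = i'")
        case True
        then show ?thesis using w[of j i] c st
          by (simp add: cell_weight_vertical UpC_in_trapezoid DnC_in_trapezoid del: cell_triangle.simps)
      next
        case False
        then have j: "j = Suc j'" using st(3) c by auto
        have "?f s = up (west J (int J - int j) + real i) (int J - int j)"
          "?f t = down (west J (int J - int j') + real i') (int J - int j')" using c by simp_all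
        \<comment> \<open>The halves of a slanted lozenge start half a unit apart modulo integers,
          so it never counts as vertical and has weight 1.\<close>
        moreover have "west J (int J - int j) + real i \<noteq> west J (int J - int j') + real i'"
        proof
          assume "west J (int J - int j) + real i = west J (int J - int j') + real i'"
          then have "(if even j' then 1/2 else - 1/2) = real i - real i'"
            using west_step[of J j'] j by (simp add: algebra_simps)
          then have "2 * (real i - real i') = 1 \<or> 2 * (real i - real i') = - 1" by (auto split: if_splits)
          then have "2 * (int i - int i') = 1 \<or> 2 * (int i - int i') = - 1"
            by (metis (mono_tags, opaque_lifting) of_int_1 of_int_diff of_int_eq_iff of_int_minus of_int_mult of_int_numeral of_int_of_nat_eq)
          then show False by presburger
        qed
        ultimately have "w {?f s, ?f t} = 1" using w1 by simp
        then show ?thesis using c j by (simp add: cell_weight_other del: cell_triangle.simps)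
      qed
    qed
    have "cell_adj s t \<or> cell_adj t s" using st(3) unfolding cell_edges_def by (auto simp: doubleton_eq_iff)
    then show "w {?f s, ?f t} = cell_weight \<omega> {s, t}"
      using *[of s t] *[of t s] st by (auto simp: insert_commute)
  qed (auto simp: finite_trapezoid inj_cell_triangle card_cell_edge card_lozenge cell_edge_iff_lozenge)
  moreover have "finite ?R" "?R \<subseteq> unit_triangles"
    by (simp_all add: R finite_trapezoid) (simp add: R[symmetric] cells_def subset_iff)
  ultimately show ?thesis using forced_dent[of ?R X w] assms(2) by simp
qed

section \<open>Triangles and half triangles as dents\<close>

lemma up_in_up_tri:
  "up u k \<in> cells (up_tri p s) \<longleftrightarrow> (u, k) \<in> Defs.lattice \<and> 0 \<le> k \<and>
    real p + of_int k / 2 \<le> u \<and> u + 1 \<le> real p + real s - of_int k / 2"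
proof -
  have "real_of_int (k + 1) / 2 = of_int k / 2 + 1/2" by (simp add: field_simps)
  then show ?thesis
    unfolding up_in_cells up_tri_def mem_Collect_eq case_prod_conv
    by (intro iffI; elim conjE; intro conjI; (assumption | linarith))
qed

lemma down_in_up_tri:
  "down u k \<in> cells (up_tri p s) \<longleftrightarrow> (u, k) \<in> Defs.lattice \<and> 1 \<le> k \<and>
    real p + of_int k / 2 \<le> u \<and> u + 1 \<le> real p + real s - of_int k / 2"
proof -
  have "real_of_int (k - 1) / 2 = of_int k / 2 - 1/2" by (simp add: field_simps)
  then show ?thesis
    unfolding down_in_cells up_tri_def mem_Collect_eq case_prod_conv
    by (intro iffI; elim conjE; intro conjI; (assumption | linarith))
qed

text \<open>Left unbounded to the west: it is only ever intersected with a polygon, whose zigzag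
  bounds it.\<close>

definition half_tri :: "nat \<Rightarrow> point set" where
  "half_tri h = {(u, k). 0 \<le> k \<and> u \<le> real h - of_int k / 2}"

lemma up_in_half_tri:
  "up u k \<in> cells (half_tri h) \<longleftrightarrow> (u, k) \<in> Defs.lattice \<and> 0 \<le> k \<and> u + 1 \<le> real h - of_int k / 2"
proof -
  have "real_of_int (k + 1) / 2 = of_int k / 2 + 1/2" by (simp add: field_simps)
  then show ?thesis
    unfolding up_in_cells half_tri_def mem_Collect_eq case_prod_conv
    by (intro iffI; elim conjE; intro conjI; (assumption | linarith))
qed

lemma down_in_half_tri:
  "down u k \<in> cells (half_tri h) \<longleftrightarrow> (u, k) \<in> Defs.lattice \<and> 1 \<le> k \<and> u + 1 \<le> real h - of_int k / 2"
proof -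
  have "real_of_int (k - 1) / 2 = of_int k / 2 - 1/2" by (simp add: field_simps)
  then show ?thesis
    unfolding down_in_cells half_tri_def mem_Collect_eq case_prod_conv
    by (intro iffI; elim conjE; intro conjI; (assumption | linarith))
qed

text \<open>All dents of one side of the line: the triangles of the ferns, the half triangle at the
  west boundary (absent for h = 0), and single triangles taken by lozenges across the line.\<close>

definition dent_union :: "(nat \<times> nat) set \<Rightarrow> nat \<Rightarrow> nat set \<Rightarrow> triangle set" where
  "dent_union P h S = (\<Union>(p, s)\<in>P. cells (up_tri p s)) \<union> cells (half_tri h) \<union> (\<lambda>i. up (real i) 0) ` S"

lemma up_in_dent_union:
  "up u k \<in> dent_union P h S \<longleftrightarrow>
    (\<exists>(p, s)\<in>P. up u k \<in> cells (up_tri p s)) \<or> up u k \<in> cells (half_tri h) \<or> (k = 0 \<and> (\<exists>i\<in>S. u = real i))"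
  unfolding dent_union_def by (simp add: image_iff) blast

lemma down_in_dent_union:
  "down u k \<in> dent_union P h S \<longleftrightarrow>
    (\<exists>(p, s)\<in>P. down u k \<in> cells (up_tri p s)) \<or> down u k \<in> cells (half_tri h)"
  unfolding dent_union_def by (simp add: image_iff) blast

lemma west_bounds: "- 1/2 \<le> west J k" "even k \<Longrightarrow> west J k = 0" "odd k \<Longrightarrow> odd J \<Longrightarrow> west J k = 1/2"
  by (simp_all add: west_def)

lemma dent_shape_dent_union:
  assumes "\<And>p s. (p, s) \<in> P \<Longrightarrow> s \<le> J" "2 * h \<le> J + 1"
  shows "dent_shape (cells (quarter_polygon J n)) (dent_union P h S)"
proof -
  let ?R = "cells (quarter_polygon J n)" let ?X = "dent_union P h S"
  have 1: "0 \<le> k" if "up u k \<in> ?X \<inter> ?R" for u k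
    using that up_in_quarter_polygon by simp
  have 2: "1 \<le> k \<and> up u k \<in> ?X \<inter> ?R" if d: "down u k \<in> ?X \<inter> ?R" for u k
  proof -
    have R: "(u, k) \<in> Defs.lattice" "1 \<le> k" "k \<le> int J" "west J k \<le> u" "u + 1 \<le> real n - of_int k / 2"
      using d down_in_quarter_polygon by simp_all
    have "(\<exists>(p, s)\<in>P. down u k \<in> cells (up_tri p s)) \<or> down u k \<in> cells (half_tri h)"
      using d down_in_dent_union by simp
    then have "up u k \<in> ?X \<and> k + 1 \<le> int J"
    proof
      assume "\<exists>(p, s)\<in>P. down u k \<in> cells (up_tri p s)"
      then obtain p s where ps: "(p, s) \<in> P" "down u k \<in> cells (up_tri p s)" by blast
      then have b: "real p + of_int k / 2 \<le> u" "u + 1 \<le> real p + real s - of_int k / 2"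
        using down_in_up_tri by simp_all
      then have "up u k \<in> cells (up_tri p s)" using R by (simp add: up_in_up_tri)
      then have "up u k \<in> ?X" using ps(1) unfolding up_in_dent_union by blast
      moreover have "real_of_int (k + 1) \<le> real s" using b by (simp add: field_simps)
      then have "k + 1 \<le> int s" by linarith
      ultimately show ?thesis using assms(1)[OF ps(1)] by simp
    next
      assume dh: "down u k \<in> cells (half_tri h)"
      then have b: "u + 1 \<le> real h - of_int k / 2" using down_in_half_tri by simp
      then have "up u k \<in> cells (half_tri h)" using R by (simp add: up_in_half_tri)
      then have "up u k \<in> ?X" unfolding up_in_dent_union by blast
      \<comment> \<open>How far up the half triangle reaches depends on the zigzag, which on odd
        lines starts at -1/2 or 1/2 according to the parity of J; hence the case
        distinctions.\<close>
      moreover have "k + 1 \<le> int J"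
      proof (cases "even k")
        case True
        then have "1 \<le> real h - of_int k / 2" using R b west_bounds(2)[of k J] by linarith
        then have "real_of_int k \<le> 2 * real h - 2" by (simp add: field_simps)
        then have "k \<le> 2 * int h - 2" by linarith
        then show ?thesis using assms(2) by linarith
      next
        case False
        have "1/2 \<le> real h - of_int k / 2" using R b west_bounds(1)[of J k] by linarith
        then have "real_of_int k \<le> 2 * real h - 1" by (simp add: field_simps)
        then have k: "k \<le> 2 * int h - 1" by linarith
        show ?thesis
        proof (cases "even J")
          case True
          then have "2 * h \<le> J" using assms(2) by presburger
          then show ?thesis using k by linarith
        next
          case J: False
          then have "3/2 \<le> real h - of_int k / 2" using R b west_bounds(3)[OF False J] by linarith
          then have "real_of_int k \<le> 2 * real h - 3" by (simp add: field_simps)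
          then show ?thesis using assms(2) by linarith
        qed
      qed
      ultimately show ?thesis by simp
    qed
    then show ?thesis using R by (simp add: up_in_quarter_polygon)
  qed
  have 3: "down u k \<in> ?X \<inter> ?R" if u: "up u k \<in> ?X \<inter> ?R" "1 \<le> k" for u k
  proof -
    have R: "(u, k) \<in> Defs.lattice" "0 \<le> k" "k + 1 \<le> int J" "west J k \<le> u" "u + 1 \<le> real n - of_int k / 2"
      using u(1) up_in_quarter_polygon by simp_all
    have "(\<exists>(p, s)\<in>P. up u k \<in> cells (up_tri p s)) \<or> up u k \<in> cells (half_tri h)"
      using u up_in_dent_union by simp
    then have "down u k \<in> ?X"
    proof
      assume "\<exists>(p, s)\<in>P. up u k \<in> cells (up_tri p s)"
      then obtain p s where ps: "(p, s) \<in> P" "up u k \<in> cells (up_tri p s)" by blast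
      then have "down u k \<in> cells (up_tri p s)" using u(2) by (simp add: up_in_up_tri down_in_up_tri)
      then show ?thesis using ps(1) unfolding down_in_dent_union by blast
    next
      assume "up u k \<in> cells (half_tri h)"
      then have "down u k \<in> cells (half_tri h)" using u(2) by (simp add: up_in_half_tri down_in_half_tri)
      then show ?thesis unfolding down_in_dent_union by blast
    qed
    then show ?thesis using R u(2) by (simp add: down_in_quarter_polygon)
  qed
  have 4: "up u' (k - 1) \<in> ?X"
    if d: "down u k \<in> ?X \<inter> ?R" and u': "u' = u + 1/2 \<or> u' = u - 1/2" and R': "up u' (k - 1) \<in> ?R" for u k u'
  proof -
    have l: "(u', k - 1) \<in> Defs.lattice" "0 \<le> k - 1" using R' up_in_quarter_polygon by simp_all
    have b: "u - 1/2 \<le> u'" "u' \<le> u + 1/2" using u' by (elim disjE; linarith)+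
    have h: "real_of_int (k - 1) / 2 = of_int k / 2 - 1/2" by (simp add: field_simps)
    have "(\<exists>(p, s)\<in>P. down u k \<in> cells (up_tri p s)) \<or> down u k \<in> cells (half_tri h)"
      using d down_in_dent_union by simp
    then show ?thesis
    proof
      assume "\<exists>(p, s)\<in>P. down u k \<in> cells (up_tri p s)"
      then obtain p s where ps: "(p, s) \<in> P" "down u k \<in> cells (up_tri p s)" by blast
      then have t: "real p + of_int k / 2 \<le> u" "u + 1 \<le> real p + real s - of_int k / 2"
        using down_in_up_tri by simp_all
      have "up u' (k - 1) \<in> cells (up_tri p s)"
        unfolding up_in_up_tri h using l t b by (intro conjI; (assumption | linarith))
      then show ?thesis using ps(1) unfolding up_in_dent_union by blast
    next
      assume "down u k \<in> cells (half_tri h)"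
      then have t: "u + 1 \<le> real h - of_int k / 2" using down_in_half_tri by simp
      have "up u' (k - 1) \<in> cells (half_tri h)"
        unfolding up_in_half_tri h using l t b by (intro conjI; (assumption | linarith))
      then show ?thesis unfolding up_in_dent_union by blast
    qed
  qed
  show ?thesis unfolding dent_shape_def
  proof (intro conjI allI impI)
    show "0 \<le> k" if "up u k \<in> ?X \<inter> ?R" for u k using that by (rule 1)
    show "1 \<le> k" "up u k \<in> ?X \<inter> ?R" if "down u k \<in> ?X \<inter> ?R" for u k
      using 2[OF that] by (rule conjunct1, rule conjunct2)
    show "down u k \<in> ?X \<inter> ?R" if "up u k \<in> ?X \<inter> ?R" "1 \<le> k" for u k using that by (rule 3)
    show "up u' (k - 1) \<in> ?X" if "down u k \<in> ?X \<inter> ?R" "u' = u + 1/2 \<or> u' = u - 1/2" "up u' (k - 1) \<in> ?R" for u k u'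
      using that by (rule 4)
  qed
qed

text \<open>Only the half triangle touches the weighted places: its forced lozenges at u = 0 and k =
  2, 4, ..., 2 (h - 1). For h = 0 the truncated exponent gives the factor 1.\<close>

lemma dent_lozenges_weight:
  assumes P: "\<And>p s. (p, s) \<in> P \<Longrightarrow> s \<le> J" and h: "2 * h \<le> J + 1" "h \<le> n" and J: "odd J \<or> \<omega> = 1"
    and w: "\<And>u k. 1 \<le> k \<Longrightarrow> k < int J \<Longrightarrow> w {up u k, down u k} = (if u = 0 \<and> even k then \<omega> else 1)"
  shows "(\<Prod>l\<in>dent_lozenges (dent_union P h S \<inter> cells (quarter_polygon J n)). w l) = \<omega> ^ (h - 1)"
proof -
  let ?R = "cells (quarter_polygon J n)" let ?X = "dent_union P h S"
  let ?F = "dent_lozenges (?X \<inter> ?R)"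
  let ?g = "\<lambda>m. {up 0 (2 * int m), down 0 (2 * int m)}"
  have inj: "inj_on ?g {1..h - 1}" by (rule inj_onI) (simp add: doubleton_eq_iff)
  have fR: "finite (\<Union>?F)"
  proof (rule finite_subset)
    show "\<Union>?F \<subseteq> (\<lambda>(u, k). up u k) ` {(u, k). up u k \<in> ?R} \<union> (\<lambda>(u, k). down u k) ` {(u, k). up u k \<in> ?R}"
    proof
      fix s assume "s \<in> \<Union>?F"
      then obtain l where l: "l \<in> ?F" "s \<in> l" by (rule UnionE)
      from l(1) obtain u k where uk: "l = {up u k, down u k}" "up u k \<in> ?X \<inter> ?R" by (rule dent_lozengesE)
      have "s = up u k \<or> s = down u k" using l(2) uk(1) by simp
      then show "s \<in> (\<lambda>(u, k). up u k) ` {(u, k). up u k \<in> ?R} \<union> (\<lambda>(u, k). down u k) ` {(u, k). up u k \<in> ?R}"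
        using uk(2) by (elim disjE) (auto simp: image_iff)
    qed
    have "inj_on (\<lambda>(u, k). up u k) {(u, k). up u k \<in> ?R}" by (rule inj_onI) (simp add: case_prod_unfold prod_eq_iff)
    moreover have "(\<lambda>(u, k). up u k) ` {(u, k). up u k \<in> ?R} \<subseteq> ?R" by (rule image_subsetI) (simp add: case_prod_unfold)
    moreover have "finite ?R" by (rule finite_quarter_polygon)
    ultimately have "finite {(u, k). up u k \<in> ?R}" by (metis (no_types, lifting) inj_on_finite)
    then show "finite ((\<lambda>(u, k). up u k) ` {(u, k). up u k \<in> ?R} \<union> (\<lambda>(u, k). down u k) ` {(u, k). up u k \<in> ?R})"
      by simp
  qed
  have fF: "finite ?F" using fR by (rule finite_UnionD)
  have sub: "?g ` {1..h - 1} \<subseteq> ?F"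
  proof
    fix l assume "l \<in> ?g ` {1..h - 1}"
    then obtain m where m: "l = ?g m" "1 \<le> m" "m + 1 \<le> h" by auto
    have lat: "(0, 2 * int m) \<in> Defs.lattice" by (simp add: Defs.lattice_def)
    have "up 0 (2 * int m) \<in> cells (half_tri h)" using m lat by (simp add: up_in_half_tri)
    moreover have "up 0 (2 * int m) \<in> ?R"
      using m lat h by (simp add: up_in_quarter_polygon west_bounds)
    ultimately show "l \<in> ?F" unfolding m(1) using m(2) by (intro dent_lozengesI) (simp_all add: up_in_dent_union)
  qed
  \<comment> \<open>A triangle dent starts at some p \<ge> 0 and recedes eastwards with the height,
    so it contains no point with u = 0 and k \<ge> 1.\<close>
  have one: "w l = 1" if l: "l \<in> ?F - ?g ` {1..h - 1}" for l
  proof -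
    from l have "l \<in> ?F" by simp
    then obtain u k where uk: "l = {up u k, down u k}" "1 \<le> k" "up u k \<in> ?X \<inter> ?R" by (rule dent_lozengesE)
    have k: "k < int J" using uk(3) by (simp add: up_in_quarter_polygon)
    have "\<omega> = 1" if z: "u = 0" "even k"
    proof -
      have "(\<exists>(p, s)\<in>P. up u k \<in> cells (up_tri p s)) \<or> up u k \<in> cells (half_tri h)"
        using uk up_in_dent_union by simp
      then have "up u k \<in> cells (half_tri h)"
      proof
        assume "\<exists>(p, s)\<in>P. up u k \<in> cells (up_tri p s)"
        then obtain p s where "up u k \<in> cells (up_tri p s)" by blast
        then have "real p + of_int k / 2 \<le> u" by (simp add: up_in_up_tri)
        then show ?thesis using z uk(2) by simp
      qed
      then have "1 \<le> real h - of_int k / 2" using z by (simp add: up_in_half_tri)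
      then have "real_of_int k \<le> 2 * real h - 2" by (simp add: field_simps)
      then have kh: "k \<le> 2 * int h - 2" by linarith
      obtain q where q: "k = 2 * q" using z(2) by (rule evenE)
      have "l = ?g (nat q)" "nat q \<in> {1..h - 1}" using uk z q kh by auto
      then have "l \<in> ?g ` {1..h - 1}" by (rule image_eqI)
      then show ?thesis using l by simp
    qed
    then show ?thesis using w[OF uk(2) k, of u] uk(1) by simp
  qed
  have "(\<Prod>l\<in>?F. w l) = (\<Prod>l\<in>?g ` {1..h - 1}. w l)"
    by (rule prod.mono_neutral_right[OF fF sub]) (use one in blast)
  also have "\<dots> = (\<Prod>m\<in>{1..h - 1}. w (?g m))" by (subst prod.reindex[OF inj]) simp
  also have "\<dots> = (\<Prod>m\<in>{1..h - 1}. \<omega>)"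
  proof (rule prod.cong[OF refl])
    fix m assume "m \<in> {1..h - 1}"
    then show "w (?g m) = \<omega>" using h by (subst w) auto
  qed
  finally show ?thesis by simp
qed

text \<open>The passage from determinants to geometry, applied four times: to \<open>Q\<close>, to
  \<open>K'\<close> and to either side of the cut. Only the trace V of the dents on the base
  matters.\<close>

theorem dent_union_matchings:
  assumes n: "n = c + (J + 1) div 2" and P: "\<And>p s. (p, s) \<in> P \<Longrightarrow> s \<le> J" and h: "2 * h \<le> J + 1"
    and J: "odd J \<or> \<omega> = 1"
    and w: "\<And>u k. 1 \<le> k \<Longrightarrow> k < int J \<Longrightarrow> w {up u k, down u k} = (if u = 0 \<and> even k then \<omega> else 1)"
    and w1: "\<And>u k u' k'. u \<noteq> u' \<Longrightarrow> w {up u k, down u' k'} = 1"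
    and V: "\<And>i. i < n \<Longrightarrow> i \<in> V \<longleftrightarrow> (\<exists>(p, s)\<in>P. p \<le> i \<and> i < p + s) \<or> i < h \<or> i \<in> S"
  shows "trapezoid_matchings \<omega> c J V =
    \<omega> ^ (h - 1) * weighted_matchings lozenges w (cells (quarter_polygon J n) - dent_union P h S)"
proof -
  have "h \<le> n" using h n by linarith
  have *: "up (real i) 0 \<in> cells (up_tri p s) \<longleftrightarrow> p \<le> i \<and> i < p + s" for i p s
    by (auto simp: up_in_up_tri Defs.lattice_def)
  have **: "up (real i) 0 \<in> cells (half_tri h) \<longleftrightarrow> i < h" for i
    by (auto simp: up_in_half_tri Defs.lattice_def)
  have "trapezoid_matchings \<omega> c J V =
    (\<Prod>l\<in>dent_lozenges (dent_union P h S \<inter> cells (quarter_polygon J n)). w l) *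
    weighted_matchings lozenges w (cells (quarter_polygon J n) - dent_union P h S)"
  proof (rule polygon_matchings[OF n dent_shape_dent_union[OF P h]])
    fix i assume "i < n"
    show "up (real i) 0 \<in> dent_union P h S \<longleftrightarrow> i \<in> V"
      unfolding up_in_dent_union V[OF \<open>i < n\<close>] * ** by auto
  next
    fix j i :: nat assume j: "1 \<le> j" "j < J"
    let ?k = "int J - int j"
    have k: "1 \<le> ?k" "?k < int J" using j by simp_all
    have e: "even ?k \<longleftrightarrow> (even J \<longleftrightarrow> even j)" by simp
    show "w {cell_triangle J (UpC j i), cell_triangle J (DnC j i)} = (if odd j \<and> i = 0 then \<omega> else 1)"
      using J
    proof
      assume J: "odd J"
      show ?thesis unfolding cell_triangle.simps w[OF k] e west_def using J by simp
    next
      assume "\<omega> = 1"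
      then show ?thesis unfolding cell_triangle.simps w[OF k] by simp
    qed
  qed (use w1 in auto)
  then show ?thesis using dent_lozenges_weight[OF P h \<open>h \<le> n\<close> J w] by simp
qed

section \<open>Ferns\<close>

text \<open>Positions in every second block of consecutive lengths xs; c tells whether the first
  block counts. The recursion avoids prefix sums, and both parities come from a single
  definition.\<close>

fun blocks :: "bool \<Rightarrow> nat list \<Rightarrow> nat set" where
  "blocks c [] = {}"
| "blocks c (x # xs) = (if c then {..<x} else {}) \<union> (+) x ` blocks (\<not> c) xs"

lemma mem_plus_image: "(i :: nat) \<in> (+) x ` A \<longleftrightarrow> x \<le> i \<and> i - x \<in> A"
  by (auto simp: image_iff) (metis le_add_diff_inverse)

lemma finite_blocks [simp]: "finite (blocks c xs)"
  by (induction c xs rule: blocks.induct) auto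

lemma blocks_Un: "blocks c xs \<union> blocks (\<not> c) xs = {..<sum_list xs}"
proof (induction xs arbitrary: c)
  case (Cons x xs)
  have "blocks c (x # xs) \<union> blocks (\<not> c) (x # xs) = {..<x} \<union> (+) x ` (blocks c xs \<union> blocks (\<not> c) xs)"
    by (cases c) auto
  also have "\<dots> = {..<sum_list (x # xs)}"
    unfolding Cons by (intro Set.set_eqI) (simp add: mem_plus_image, linarith)
  finally show ?case .
qed simp

lemma blocks_Int: "blocks c xs \<inter> blocks (\<not> c) xs = {}"
proof (induction xs arbitrary: c)
  case (Cons x xs)
  have "blocks c xs \<inter> blocks (\<not> c) xs = {}" by (rule Cons)
  then show ?case by (cases c) auto
qed simp

lemma blocks_append:
  "blocks c (xs @ ys) = blocks c xs \<union> (+) (sum_list xs) ` blocks (if even (length xs) then c else \<not> c) ys"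
  by (induction xs arbitrary: c) (auto simp: image_Un image_image add.assoc)

lemma blocks_subset: "blocks c xs \<subseteq> {..<sum_list xs}"
  using blocks_Un[of c xs] by blast

text \<open>Reversal mirrors the positions; whether the last block counts, now the first, is decided
  by the parity of the length.\<close>

lemma blocks_rev:
  "i \<in> blocks c (rev xs) \<longleftrightarrow> i < sum_list xs \<and> sum_list xs - 1 - i \<in> blocks (if odd (length xs) then c else \<not> c) xs"
proof (induction xs arbitrary: c i)
  case (Cons x xs)
  let ?s = "sum_list xs"
  show ?case
  proof (cases "i < ?s")
    case True
    then have "i \<notin> (+) ?s ` A" for A by auto
    then have "i \<in> blocks c (rev (x # xs)) \<longleftrightarrow> i \<in> blocks c (rev xs)"
      by (simp add: blocks_append)
    also have "\<dots> \<longleftrightarrow> ?s - 1 - i \<in> blocks (if odd (length xs) then c else \<not> c) xs" using True Cons by simp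
    also have "\<dots> \<longleftrightarrow> x + ?s - 1 - i \<in> (+) x ` blocks (if odd (length xs) then c else \<not> c) xs"
    proof -
      have "x + ?s - 1 - i = x + (?s - 1 - i)" using True by simp
      then show ?thesis by (simp add: image_iff)
    qed
    also have "\<dots> \<longleftrightarrow> x + ?s - 1 - i \<in> blocks (if odd (length (x # xs)) then c else \<not> c) (x # xs)"
      using True by auto
    finally show ?thesis using True by simp
  next
    case False
    then have ni: "i \<notin> blocks c (rev xs)" using blocks_subset[of c "rev xs"] by auto
    let ?d = "if even (length xs) then c else \<not> c"
    have "i \<in> blocks c (rev (x # xs)) \<longleftrightarrow> i \<in> (+) ?s ` blocks ?d [x]"
      using ni by (simp add: blocks_append)
    also have "\<dots> \<longleftrightarrow> ?d \<and> i < x + ?s" using False by (auto simp: mem_plus_image)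
    also have "\<dots> \<longleftrightarrow> i < x + ?s \<and> x + ?s - 1 - i \<in> blocks ?d (x # xs)"
      using False by (auto simp: mem_plus_image)
    finally show ?thesis by simp
  qed
qed simp

lemma entry_Cons: "entry (x # xs) (Suc i) = (if i = 0 then x else entry xs i)"
  by (auto simp: entry_def nth_Cons')

lemma psum_0 [simp]: "psum xs 0 = 0" by (simp add: psum_def)

lemma psum_Suc: "psum xs (Suc r) = psum xs r + entry xs (Suc r)"
  by (simp add: psum_def)

lemma psum_Cons: "psum (x # xs) (Suc r) = x + psum xs r"
proof (induction r)
  case 0
  then show ?case by (simp add: psum_Suc entry_Cons)
next
  case (Suc r)
  then show ?case by (simp add: psum_Suc[of "x # xs" "Suc r"] psum_Suc[of xs r] entry_Cons)
qed

lemma psum_Nil [simp]: "psum [] r = 0" by (simp add: psum_def entry_def)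

text \<open>The index r starts from 0, so an even r belongs to an entry with odd index.\<close>

lemma mem_blocks_iff:
  "i \<in> blocks c xs \<longleftrightarrow> (\<exists>r. (even r \<longleftrightarrow> c) \<and> psum xs r \<le> i \<and> i < psum xs (Suc r))"
proof (induction xs arbitrary: c i)
  case (Cons x xs)
  have "i \<in> blocks c (x # xs) \<longleftrightarrow> (c \<and> i < x) \<or> (x \<le> i \<and> i - x \<in> blocks (\<not> c) xs)"
    by (auto simp: mem_plus_image)
  also have "\<dots> \<longleftrightarrow> (c \<and> i < x) \<or> (\<exists>r. (odd r \<longleftrightarrow> c) \<and> psum (x # xs) (Suc r) \<le> i \<and> i < psum (x # xs) (Suc (Suc r)))"
  proof -
    have "x \<le> i \<and> psum xs r \<le> i - x \<and> i - x < psum xs (Suc r) \<longleftrightarrow> x + psum xs r \<le> i \<and> i < x + psum xs (Suc r)" for r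
      by linarith
    moreover have "x \<le> i \<and> i - x \<in> blocks (\<not> c) xs \<longleftrightarrow>
        (\<exists>r. (even r \<longleftrightarrow> \<not> c) \<and> (x \<le> i \<and> psum xs r \<le> i - x \<and> i - x < psum xs (Suc r)))"
      unfolding Cons by blast
    moreover have "(even r \<longleftrightarrow> \<not> c) \<longleftrightarrow> (odd r \<longleftrightarrow> c)" for r :: nat by blast
    ultimately show ?thesis unfolding psum_Cons by (simp only:)
  qed
  also have "\<dots> \<longleftrightarrow> (\<exists>r. (even r \<longleftrightarrow> c) \<and> psum (x # xs) r \<le> i \<and> i < psum (x # xs) (Suc r))"
  proof
    assume "(c \<and> i < x) \<or> (\<exists>r. (odd r \<longleftrightarrow> c) \<and> psum (x # xs) (Suc r) \<le> i \<and> i < psum (x # xs) (Suc (Suc r)))"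
    then show "\<exists>r. (even r \<longleftrightarrow> c) \<and> psum (x # xs) r \<le> i \<and> i < psum (x # xs) (Suc r)"
    proof
      assume "c \<and> i < x"
      then show ?thesis by (intro exI[of _ 0]) (simp add: psum_Cons)
    next
      assume "\<exists>r. (odd r \<longleftrightarrow> c) \<and> psum (x # xs) (Suc r) \<le> i \<and> i < psum (x # xs) (Suc (Suc r))"
      then obtain r where "(odd r \<longleftrightarrow> c) \<and> psum (x # xs) (Suc r) \<le> i \<and> i < psum (x # xs) (Suc (Suc r))" by blast
      then show ?thesis by (intro exI[of _ "Suc r"]) simp
    qed
  next
    assume "\<exists>r. (even r \<longleftrightarrow> c) \<and> psum (x # xs) r \<le> i \<and> i < psum (x # xs) (Suc r)"
    then obtain r where r: "(even r \<longleftrightarrow> c)" "psum (x # xs) r \<le> i" "i < psum (x # xs) (Suc r)" by blast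
    then show "(c \<and> i < x) \<or> (\<exists>r. (odd r \<longleftrightarrow> c) \<and> psum (x # xs) (Suc r) \<le> i \<and> i < psum (x # xs) (Suc (Suc r)))"
    proof (cases r)
      case 0
      then show ?thesis using r by (simp add: psum_Cons)
    next
      case (Suc r')
      then have "(odd r' \<longleftrightarrow> c) \<and> psum (x # xs) (Suc r') \<le> i \<and> i < psum (x # xs) (Suc (Suc r'))"
        using r by simp
      then show ?thesis by blast
    qed
  qed
  finally show ?case .
qed simp

text \<open>Entries beyond the end are 0 and form empty blocks. Hence a list may be padded with
  zeros until its length has the parity wanted.\<close>

lemma blocks_cong:
  assumes "\<And>r. entry xs r = entry ys r"
  shows "blocks c xs = blocks c ys"
  using assms by (intro Set.set_eqI) (simp add: mem_blocks_iff psum_def)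

lemma card_blocks_aux:
  "card (blocks True xs) = (\<Sum>i | i \<in> {1..length xs} \<and> odd i. entry xs i) \<and>
   card (blocks False xs) = (\<Sum>i | i \<in> {1..length xs} \<and> even i. entry xs i)"
proof (induction xs)
  case (Cons x xs)
  have inj: "inj_on ((+) x) A" for A by (auto simp: inj_on_def)
  have "{..<x} \<inter> (+) x ` blocks False xs = {}" by auto
  then have t: "card (blocks True (x # xs)) = x + card (blocks False xs)"
    by (simp add: card_Un_disjoint card_image[OF inj])
  have f: "card (blocks False (x # xs)) = card (blocks True xs)"
    by (simp add: card_image[OF inj])
  have o: "{i. i \<in> {1..length (x # xs)} \<and> odd i} = insert 1 (Suc ` {i. i \<in> {1..length xs} \<and> even i})"
  proof (intro equalityI subsetI)
    fix i assume i: "i \<in> {i. i \<in> {1..length (x # xs)} \<and> odd i}"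
    then obtain j where "i = Suc j" by (cases i) auto
    then show "i \<in> insert 1 (Suc ` {i. i \<in> {1..length xs} \<and> even i})" using i by (cases j) auto
  qed auto
  have e: "{i. i \<in> {1..length (x # xs)} \<and> even i} = Suc ` {i. i \<in> {1..length xs} \<and> odd i}"
  proof (intro equalityI subsetI)
    fix i assume i: "i \<in> {i. i \<in> {1..length (x # xs)} \<and> even i}"
    then obtain j where "i = Suc j" by (cases i) auto
    then show "i \<in> Suc ` {i. i \<in> {1..length xs} \<and> odd i}" using i by (cases j) auto
  qed auto
  have "(\<Sum>i | i \<in> {1..length (x # xs)} \<and> odd i. entry (x # xs) i) = x + (\<Sum>i | i \<in> {1..length xs} \<and> even i. entry xs i)"
    unfolding o by (subst sum.insert) (auto simp: sum.reindex entry_Cons intro!: sum.cong)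
  moreover have "(\<Sum>i | i \<in> {1..length (x # xs)} \<and> even i. entry (x # xs) i) = (\<Sum>i | i \<in> {1..length xs} \<and> odd i. entry xs i)"
    unfolding e by (auto simp: sum.reindex entry_Cons intro!: sum.cong)
  ultimately show ?case using t f Cons by simp
qed simp

lemma card_blocks: "card (blocks True xs) = odd_sum xs" "card (blocks False xs) = even_sum xs"
  using card_blocks_aux[of xs] by (simp_all add: odd_sum_def even_sum_def)

lemma odd_sum_add_even_sum: "odd_sum xs + even_sum xs = sum_list xs"
proof -
  have "odd_sum xs + even_sum xs = card (blocks True xs \<union> blocks (\<not> True) xs)"
    by (subst card_Un_disjoint) (simp_all add: card_blocks blocks_Int[of True, simplified])
  then show ?thesis by (simp only: blocks_Un card_lessThan)
qed

section \<open>The sequences t^+ and t^- as records of dents\<close>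

lemma mu_eq: "mu m = 2 * ((m + 1) div 2)"
proof -
  have "(real m + 1) / 2 = real (m + 1) / real 2" by simp
  then have "\<lfloor>(real m + 1) / 2\<rfloor> = int ((m + 1) div 2)"
    by (simp only: floor_divide_of_nat_eq)
  then show ?thesis by (simp only: mu_def nat_int)
qed

lemma mu'_eq:
  assumes "1 \<le> m"
  shows "mu' m = 2 * (m div 2)"
proof -
  have "\<lceil>(real m - 1) / 2\<rceil> = int (m div 2)"
  proof (rule ceiling_unique)
    have "m \<le> 2 * (m div 2) + 1" "2 * (m div 2) \<le> m" by linarith+
    then have "real m \<le> 2 * real (m div 2) + 1" "2 * real (m div 2) \<le> real m" by linarith+
    then show "of_int (int (m div 2)) - 1 < (real m - 1) / 2" "(real m - 1) / 2 \<le> of_int (int (m div 2))"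
      by (simp_all add: field_simps)
  qed
  then show ?thesis by (simp add: mu'_def)
qed

lemma entry_outside: "\<not> (1 \<le> r \<and> r \<le> length xs) \<Longrightarrow> entry xs r = 0"
  by (simp only: entry_def if_False)

lemma entry_map_upt:
  assumes "length xs \<le> N"
  shows "entry (map (entry xs) [1..<N + 1]) r = entry xs r"
proof (cases "1 \<le> r \<and> r \<le> N")
  case True
  then have "map (entry xs) [1..<N + 1] ! (r - 1) = entry xs ([1..<N + 1] ! (r - 1))"
    using True by (intro nth_map) auto
  also have "[1..<N + 1] ! (r - 1) = r" using True by (subst nth_upt) simp_all
  finally show ?thesis using True by (simp only: entry_def[of "map (entry xs) [1..<N + 1]"]) simp
next
  case False
  then have "entry (map (entry xs) [1..<N + 1]) r = 0" "\<not> (1 \<le> r \<and> r \<le> length xs)"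
    using assms by (intro entry_outside, auto)
  then show ?thesis by (simp only: entry_def[of xs] if_False)
qed

lemma blocks_map_upt: "length xs \<le> N \<Longrightarrow> blocks c (map (entry xs) [1..<N + 1]) = blocks c xs"
  by (rule blocks_cong) (rule entry_map_upt)

lemma sum_list_map_upt:
  assumes "length xs \<le> N"
  shows "sum_list (map (entry xs) [1..<N + 1]) = sum_list xs"
proof -
  have "{..<sum_list (map (entry xs) [1..<N + 1])} = {..<sum_list xs}"
    by (simp only: blocks_Un[of True, symmetric] blocks_map_upt[OF assms])
  then show ?thesis by (simp only: lessThan_eq_iff)
qed

text \<open>Positions of the up-pointing dents for c = True and of the down-pointing ones for c =
  False. The two ferns use opposite parities, and the eastern one is read from the end L of the
  line.\<close>

definition fern_set :: "bool \<Rightarrow> nat \<Rightarrow> nat list \<Rightarrow> nat list \<Rightarrow> nat set" where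
  "fern_set c L as bs = blocks (\<not> c) as \<union> {i. i < L \<and> L - 1 - i \<in> blocks c bs}"

text \<open>The even length of xs puts the gap g at an odd index, where nothing is removed.\<close>

lemma blocks_merge:
  assumes "even (length xs)" "odd (length ys)" and L: "L = sum_list xs + g + sum_list ys"
  shows "blocks False (xs @ [g] @ rev ys) = blocks False xs \<union> {i. i < L \<and> L - 1 - i \<in> blocks True ys}"
proof (rule Set.set_eqI)
  fix i
  have "i \<in> blocks False (xs @ [g] @ rev ys) \<longleftrightarrow> i \<in> blocks False xs \<or>
     (sum_list xs \<le> i \<and> g \<le> i - sum_list xs \<and> i - sum_list xs - g < sum_list ys \<and>
      sum_list ys - 1 - (i - sum_list xs - g) \<in> blocks True ys)"
    using assms(1,2) by (simp add: blocks_append blocks_rev mem_plus_image)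
  also have "(sum_list xs \<le> i \<and> g \<le> i - sum_list xs \<and> i - sum_list xs - g < sum_list ys \<and>
      sum_list ys - 1 - (i - sum_list xs - g) \<in> blocks True ys) \<longleftrightarrow> (i < L \<and> L - 1 - i \<in> blocks True ys)"
  proof (cases "sum_list xs + g \<le> i \<and> i < L")
    case True
    then have "sum_list ys - 1 - (i - sum_list xs - g) = L - 1 - i" unfolding L by linarith
    then show ?thesis using True unfolding L by auto
  next
    case False
    have "L - 1 - i \<notin> blocks True ys" if "i < L"
    proof
      assume "L - 1 - i \<in> blocks True ys"
      then have "L - 1 - i < sum_list ys" using blocks_subset[of True ys] by auto
      then show False using False that unfolding L by linarith
    qed
    then show ?thesis using False unfolding L by auto
  qed
  finally show "i \<in> blocks False (xs @ [g] @ rev ys) \<longleftrightarrow>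
      i \<in> blocks False xs \<union> {i. i < L \<and> L - 1 - i \<in> blocks True ys}" by simp
qed

text \<open>The fused middle entry consists of an a with odd index, the gap x + y and a b with even
  index. None of the three is removed above the line, so they form one block there.\<close>

lemma t_plus_blocks:
  fixes x y :: nat and as bs :: "nat list"
  defines "L \<equiv> x + y + sum_list as + sum_list bs"
  shows "blocks False (t_plus x y as bs) = fern_set True L as bs" "sum_list (t_plus x y as bs) = L"
proof -
  define m n where "m = seq_length as" and "n = seq_length bs"
  have m: "1 \<le> m" "length as \<le> m" "1 \<le> n" "length bs \<le> n"
    by (simp_all add: m_def n_def seq_length_def)
  \<comment> \<open>Lengths of the right parity without the fused entries. Padded with zeros, the
    sequences have M1 + 1 and N1 + 1 entries.\<close>
  define M1 N1 where "M1 = mu' m" and "N1 = mu n - 1"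
  have M1: "even M1" "length as \<le> M1 + 1" using m by (auto simp: M1_def mu'_eq)
  have N1: "odd N1" "length bs \<le> N1 + 1" "mu n = N1 + 1" using m by (auto simp: N1_def mu_eq)
  define xs ys where "xs = map (entry as) [1..<M1 + 1]" and "ys = map (entry bs) [1..<N1 + 1]"
  define p q where "p = entry as (M1 + 1)" and "q = entry bs (N1 + 1)"
  have A: "map (entry as) [1..<(M1 + 1) + 1] = xs @ [p]" by (simp add: xs_def p_def)
  have B: "map (entry bs) [1..<(N1 + 1) + 1] = ys @ [q]" by (simp add: ys_def q_def)
  have t: "t_plus x y as bs = xs @ [p + x + y + q] @ rev ys"
    by (simp add: t_plus_def Let_def xs_def ys_def p_def q_def M1_def m_def N1(3) n_def[symmetric] rev_map)
  have s: "sum_list as = sum_list xs + p" "sum_list bs = sum_list ys + q"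
    using sum_list_map_upt[OF M1(2)] sum_list_map_upt[OF N1(2)] unfolding A B by simp_all
  have len: "length xs = M1" "length ys = N1" by (simp_all add: xs_def ys_def)
  have b: "blocks False as = blocks False xs" "blocks True bs = blocks True ys"
    using blocks_map_upt[OF M1(2), of False] blocks_map_upt[OF N1(2), of True] M1(1) N1(1)
    unfolding A B by (simp_all add: blocks_append len)
  show "blocks False (t_plus x y as bs) = fern_set True L as bs"
    unfolding t fern_set_def b not_True_eq_False
    by (rule blocks_merge) (use M1(1) N1(1) in \<open>simp_all add: len L_def s\<close>)
  show "sum_list (t_plus x y as bs) = L" unfolding t L_def s by simp
qed

lemma mem_Suc_image: "i \<in> Suc ` A \<longleftrightarrow> 0 < i \<and> i - 1 \<in> A"
  by (cases i) auto

lemma blocks_merge_minus: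
  assumes "even (length xs)" "even (length ys)" and L: "L = h + sum_list xs + g + sum_list ys"
  shows "blocks False ([0, h + 1] @ xs @ [g] @ rev ys @ [z]) =
    insert 0 (Suc ` ({..<h} \<union> (+) h ` blocks False xs \<union> {i. i < L \<and> L - 1 - i \<in> blocks False ys})) \<union> {L + 1..<L + 1 + z}"
proof (rule Set.set_eqI)
  fix i
  have 1: "L - i < sum_list ys" if "L - i \<in> blocks False ys" for i
    using that blocks_subset[of False ys] by auto
  let ?j = "i - (h + 1)"
  have "i \<in> blocks False ([0, h + 1] @ xs @ [g] @ rev ys @ [z]) \<longleftrightarrow>
     i < h + 1 \<or> (h + 1 \<le> i \<and> (?j \<in> blocks False xs \<or> (sum_list xs \<le> ?j \<and> g \<le> ?j - sum_list xs \<and>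
       (?j - sum_list xs - g \<in> blocks True (rev ys) \<or>
        (sum_list ys \<le> ?j - sum_list xs - g \<and> ?j - sum_list xs - g - sum_list ys < z)))))"
    by (simp only: append.simps blocks.simps blocks_append not_True_eq_False not_False_eq_True if_True if_False
        Un_iff empty_iff mem_plus_image lessThan_iff assms(1,2) simp_thms length_rev sum_list_rev le0 diff_zero image_empty)
  also have "\<dots> \<longleftrightarrow> i < h + 1 \<or> (h + 1 \<le> i \<and> i - (h + 1) \<in> blocks False xs) \<or>
     (h + 1 + sum_list xs + g \<le> i \<and> i - (h + 1 + sum_list xs + g) < sum_list ys \<and>
       sum_list ys - 1 - (i - (h + 1 + sum_list xs + g)) \<in> blocks False ys) \<or>
     (L + 1 \<le> i \<and> i < L + 1 + z)"
  proof -
    have r: "a \<in> blocks True (rev ys) \<longleftrightarrow> a < sum_list ys \<and> sum_list ys - 1 - a \<in> blocks False ys" for a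
      using assms(2) by (simp add: blocks_rev)
    have e: "?j - sum_list xs - g = i - (h + 1 + sum_list xs + g)" by simp
    have c: "(h + 1 \<le> i \<and> sum_list xs \<le> ?j \<and> g \<le> ?j - sum_list xs) \<longleftrightarrow> h + 1 + sum_list xs + g \<le> i"
      by linarith
    have d: "(h + 1 + sum_list xs + g \<le> i \<and> sum_list ys \<le> i - (h + 1 + sum_list xs + g) \<and>
        i - (h + 1 + sum_list xs + g) - sum_list ys < z) \<longleftrightarrow> (L + 1 \<le> i \<and> i < L + 1 + z)"
      unfolding L by linarith
    show ?thesis unfolding e d[symmetric] c[symmetric] r by blast
  qed
  also have "\<dots> \<longleftrightarrow> i \<in> insert 0 (Suc ` ({..<h} \<union> (+) h ` blocks False xs \<union> {i. i < L \<and> L - 1 - i \<in> blocks False ys})) \<union> {L + 1..<L + 1 + z}"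
  proof -
    have "(h + 1 + sum_list xs + g \<le> i \<and> i - (h + 1 + sum_list xs + g) < sum_list ys \<and>
       sum_list ys - 1 - (i - (h + 1 + sum_list xs + g)) \<in> blocks False ys) \<longleftrightarrow>
       (0 < i \<and> i - 1 < L \<and> L - 1 - (i - 1) \<in> blocks False ys)"
    proof (cases "h + 1 + sum_list xs + g \<le> i \<and> i < L + 1")
      case True
      then have "sum_list ys - 1 - (i - (h + 1 + sum_list xs + g)) = L - i" "L - 1 - (i - 1) = L - i"
        unfolding L by simp_all
      then show ?thesis using True unfolding L by auto
    next
      case False
      show ?thesis
      proof (cases "0 < i \<and> i - 1 < L")
        case True
        then have "i < h + 1 + sum_list xs + g" using False by auto
        then have "\<not> L - i < sum_list ys" using True unfolding L by simp
        moreover have "L - 1 - (i - 1) = L - i" using True by simp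
        ultimately show ?thesis using \<open>i < h + 1 + sum_list xs + g\<close> 1[of i] by auto
      next
        case False
        then have "i = 0 \<or> L < i" by auto
        then show ?thesis unfolding L by auto
      qed
    qed
    moreover have "i < h + 1 \<longleftrightarrow> i = 0 \<or> (0 < i \<and> i - 1 < h)" by auto
    moreover have "(h + 1 \<le> i \<and> i - (h + 1) \<in> blocks False xs) \<longleftrightarrow> (0 < i \<and> h \<le> i - 1 \<and> i - 1 - h \<in> blocks False xs)"
      by (auto simp: diff_diff_eq)
    ultimately show ?thesis
      by (simp only: mem_Suc_image mem_plus_image insert_iff Un_iff lessThan_iff mem_Collect_eq atLeastLessThan_iff) blast
  qed
  finally show "i \<in> blocks False ([0, h + 1] @ xs @ [g] @ rev ys @ [z]) \<longleftrightarrow>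
     i \<in> insert 0 (Suc ` ({..<h} \<union> (+) h ` blocks False xs \<union> {i. i < L \<and> L - 1 - i \<in> blocks False ys})) \<union> {L + 1..<L + 1 + z}" .
qed

text \<open>The leading 0 shifts indices so that a_1 + 1 is removed; its extra unit is the first
  position of the longer lower base, and the final z is the bend in the east side. The fused entry
  joins parts that are not removed below the line.\<close>

lemma t_minus_blocks:
  fixes x y :: nat and as bs :: "nat list"
  defines "L \<equiv> x + y + sum_list as + sum_list bs"
  shows "blocks False (t_minus x y z as bs) = insert 0 (Suc ` fern_set False L as bs) \<union> {L + 1..<L + 1 + z}"
    "sum_list (t_minus x y z as bs) = L + 1 + z"
proof -
  define m n where "m = seq_length as" and "n = seq_length bs"
  have m: "1 \<le> m" "length as \<le> m" "1 \<le> n" "length bs \<le> n"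
    by (simp_all add: m_def n_def seq_length_def)
  \<comment> \<open>\<open>mu m\<close> is at least 2. Two entries are set apart: the first, which
    is increased by 1, and the last, which is fused.\<close>
  define M1 N1 where "M1 = mu m - 2" and "N1 = mu' n"
  have "1 \<le> (m + 1) div 2" using m(1) by linarith
  then have M1: "mu m = M1 + 2" unfolding M1_def mu_eq by linarith
  then have M1': "even M1" "length as \<le> M1 + 2" using m unfolding mu_eq by presburger+
  have N1: "even N1" "length bs \<le> N1 + 1" "mu' n = N1" using m by (auto simp: N1_def mu'_eq)
  define h where "h = entry as 1"
  define xs ys where "xs = map (entry as) [2..<M1 + 2]" and "ys = map (entry bs) [1..<N1 + 1]"
  define p q where "p = entry as (M1 + 2)" and "q = entry bs (N1 + 1)"
  have A: "map (entry as) [1..<(M1 + 2) + 1] = [h] @ xs @ [p]"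
  proof -
    have "[1..<(M1 + 2) + 1] = 1 # [2..<M1 + 2] @ [M1 + 2]"
      by (metis Suc_1 Suc_eq_plus1 le_add2 upt_Suc_append upt_conv_Cons append_Cons one_le_numeral trans_le_add2 less_Suc_eq_le)
    then show ?thesis by (simp only: xs_def p_def h_def list.map map_append append.simps)
  qed
  have B: "map (entry bs) [1..<(N1 + 1) + 1] = ys @ [q]" by (simp add: ys_def q_def)
  have len: "length xs = M1" "length ys = N1"
    by (simp_all add: xs_def ys_def del: upt_Suc)
  have t: "t_minus x y z as bs = [0, h + 1] @ xs @ [p + x + y + q] @ rev ys @ [z]"
    by (simp add: t_minus_def Let_def xs_def ys_def p_def q_def h_def m_def[symmetric] M1 n_def[symmetric] N1(3) rev_map)
  have s: "sum_list as = h + sum_list xs + p" "sum_list bs = sum_list ys + q"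
    using sum_list_map_upt[OF M1'(2)] sum_list_map_upt[OF N1(2)] unfolding A B by simp_all
  have b: "blocks True as = {..<h} \<union> (+) h ` blocks False xs" "blocks False bs = blocks False ys"
    using blocks_map_upt[OF M1'(2), of True] blocks_map_upt[OF N1(2), of False] M1'(1) N1(1)
    unfolding A B by (simp_all add: blocks_append len)
  have "L = h + sum_list xs + (p + x + y + q) + sum_list ys" by (simp add: L_def s)
  then show "blocks False (t_minus x y z as bs) = insert 0 (Suc ` fern_set False L as bs) \<union> {L + 1..<L + 1 + z}"
    unfolding t fern_set_def using blocks_merge_minus[of xs ys L h "p + x + y + q" z] M1'(1) N1(1)
    by (simp only: len b not_False_eq_True)
  show "sum_list (t_minus x y z as bs) = L + 1 + z" unfolding t L_def s by simp
qed

section \<open>\<open>Q\<close> and \<open>K'\<close> as trapezoid counts\<close>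

lemma half_tri_0_disjoint:
  assumes "s \<in> cells (quarter_polygon J n)"
  shows "s \<notin> cells (half_tri 0)"
proof -
  have "s \<in> unit_triangles" using assms by (simp add: cells_def)
  then show ?thesis
  proof (cases rule: unit_triangle_cases)
    case (1 u k)
    have "0 \<le> real_of_int k / 2" "- 1/2 \<le> u" using assms west_bounds(1)[of J k] by (simp_all add: 1 up_in_quarter_polygon)
    then have "\<not> u + 1 \<le> real 0 - of_int k / 2" by linarith
    then show ?thesis by (simp only: 1 up_in_half_tri) blast
  next
    case (2 u k)
    have "0 \<le> real_of_int k / 2" "- 1/2 \<le> u" using assms west_bounds(1)[of J k] by (simp_all add: 2 down_in_quarter_polygon)
    then have "\<not> u + 1 \<le> real 0 - of_int k / 2" by linarith
    then show ?thesis by (simp only: 2 down_in_half_tri) blast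
  qed
qed

definition even_dents :: "nat list \<Rightarrow> (nat \<times> nat) set" where
  "even_dents t = (\<lambda>i. (psum t (2 * i - 1), entry t (2 * i))) ` {1..length t div 2}"

lemma polygon_minus_dents:
  "cells (quarter_polygon J n) - dent_union (even_dents t) 0 {} = cells (quarter_polygon J n) - dents t"
proof -
  have "dent_union (even_dents t) 0 {} = dents t \<union> cells (half_tri 0)"
    by (simp add: dent_union_def even_dents_def dents_def)
  then show ?thesis using half_tri_0_disjoint by blast
qed

lemma entry_le_even_sum:
  assumes "even r"
  shows "entry t r \<le> even_sum t"
proof (cases "r \<in> {1..length t}")
  case True
  then show ?thesis unfolding even_sum_def using assms by (intro member_le_sum) auto
next
  case False
  then have "entry t r = 0" by (auto simp: entry_def)
  then show ?thesis by simp
qed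

lemma even_dents_le: "(p, s) \<in> even_dents t \<Longrightarrow> s \<le> even_sum t"
  by (auto simp: even_dents_def entry_le_even_sum)

lemma mem_even_dents: "i \<in> blocks False t \<longleftrightarrow> (\<exists>(p, s)\<in>even_dents t. p \<le> i \<and> i < p + s)"
proof
  assume "i \<in> blocks False t"
  then obtain r where r: "odd r" "psum t r \<le> i" "i < psum t (Suc r)" by (auto simp: mem_blocks_iff)
  from r(1) obtain k where k: "r = 2 * k + 1" by (rule oddE)
  have e: "i < psum t r + entry t (Suc r)" using r(3) by (simp add: psum_Suc)
  then have "entry t (2 * (k + 1)) \<noteq> 0" using r(2) k by (intro notI) simp
  then have "2 * (k + 1) \<le> length t" by (auto simp: entry_def split: if_splits)
  then have "k + 1 \<in> {1..length t div 2}" by auto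
  then have "(psum t (2 * (k + 1) - 1), entry t (2 * (k + 1))) \<in> even_dents t"
    unfolding even_dents_def by (rule imageI)
  then show "\<exists>(p, s)\<in>even_dents t. p \<le> i \<and> i < p + s"
    by (rule rev_bexI) (use r(2) e k in simp)
next
  assume "\<exists>(p, s)\<in>even_dents t. p \<le> i \<and> i < p + s"
  then obtain k where k: "1 \<le> k" "psum t (2 * k - 1) \<le> i" "i < psum t (2 * k - 1) + entry t (2 * k)"
    by (auto simp: even_dents_def)
  have "Suc (2 * k - 1) = 2 * k" using k(1) by simp
  moreover from this have "psum t (2 * k) = psum t (2 * k - 1) + entry t (2 * k)"
    using psum_Suc[of t "2 * k - 1"] by (simp only:)
  ultimately have "odd (2 * k - 1)" "psum t (2 * k - 1) \<le> i" "i < psum t (Suc (2 * k - 1))"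
    using k by simp_all
  then show "i \<in> blocks False t" unfolding mem_blocks_iff by blast
qed

lemma Q_eq_trapezoid_matchings:
  "real (Q t) = trapezoid_matchings 1 (odd_sum t) (2 * even_sum t) (blocks False t)"
proof -
  let ?J = "2 * even_sum t" let ?n = "odd_sum t + even_sum t"
  have "west_Q k = west ?J k" for k by (simp add: west_Q_def west_def)
  then have "region_Q t = cells (quarter_polygon ?J ?n) - dents t"
    by (simp add: region_Q_def quarter_polygon_def)
  then have "real (Q t) = weighted_matchings lozenges (\<lambda>_. 1) (cells (quarter_polygon ?J ?n) - dents t)"
    by (simp add: Q_def weighted_matchings_def tilings_def)
  also have "\<dots> = 1 ^ (0 - 1) * weighted_matchings lozenges (\<lambda>_. 1) (cells (quarter_polygon ?J ?n) - dent_union (even_dents t) 0 {})"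
    by (simp add: polygon_minus_dents)
  also have "\<dots> = trapezoid_matchings 1 (odd_sum t) ?J (blocks False t)"
    by (rule dent_union_matchings[symmetric]) (auto simp: mem_even_dents dest: even_dents_le)
  finally show ?thesis .
qed

lemma west_weight_vertical:
  "west_weight Z {up u k, down u k} =
    (if {(u, k), (u + 1/2, k + 1)} \<in> Z \<and> {(u, k), (u + 1/2, k - 1)} \<in> Z then 1/2 else 1)"
  by (simp add: west_weight_def doubleton_eq_iff)

lemma west_weight_other: "u \<noteq> u' \<Longrightarrow> west_weight Z {up u k, down u' k'} = 1"
  by (simp add: west_weight_def doubleton_eq_iff)

lemma zigzag_mem_north:
  "{(u, k), (v, k + 1)} \<in> zigzag f p q \<longleftrightarrow> p \<le> k \<and> k < q \<and> f k = u \<and> f (k + 1) = v"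
proof
  assume "{(u, k), (v, k + 1)} \<in> zigzag f p q"
  then obtain m where m: "{(u, k), (v, k + 1)} = {(f m, m), (f (m + 1), m + 1)}" "p \<le> m" "m < q"
    unfolding zigzag_def mem_Collect_eq by (elim exE conjE)
  from m(1) have "(u, k) = (f m, m) \<and> (v, k + 1) = (f (m + 1), m + 1) \<or>
      (u, k) = (f (m + 1), m + 1) \<and> (v, k + 1) = (f m, m)"
    by (simp only: doubleton_eq_iff)
  then show "p \<le> k \<and> k < q \<and> f k = u \<and> f (k + 1) = v" using m(2,3) by auto
next
  assume "p \<le> k \<and> k < q \<and> f k = u \<and> f (k + 1) = v"
  then show "{(u, k), (v, k + 1)} \<in> zigzag f p q"
    unfolding zigzag_def mem_Collect_eq by (intro exI[of _ k]) simp
qed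

lemma zigzag_mem_south:
  "{(u, k), (v, k - 1)} \<in> zigzag f p q \<longleftrightarrow> p \<le> k - 1 \<and> k - 1 < q \<and> f (k - 1) = v \<and> f k = u"
proof -
  have "{(u, k), (v, k - 1)} = {(v, k - 1), (u, (k - 1) + 1)}" by (simp add: insert_commute)
  then show ?thesis using zigzag_mem_north[of v "k - 1" u f p q] by simp
qed

lemma K'_eq_trapezoid_matchings:
  assumes "0 < even_sum t"
  shows "K' t = trapezoid_matchings (1/2) (odd_sum t) (2 * even_sum t - 1) (blocks False t)"
proof -
  let ?J = "2 * even_sum t - 1" let ?n = "odd_sum t + even_sum t"
  let ?w = "west_weight (zigzag west_K 0 (2 * int (even_sum t) - 1))"
  have J: "odd ?J" "int ?J = 2 * int (even_sum t) - 1" using assms by auto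
  have w: "west_K k = west ?J k" for k using J(1) by (simp add: west_K_def west_def)
  then have "region_K t = cells (quarter_polygon ?J ?n) - dents t"
    using J(2) by (simp add: region_K_def quarter_polygon_def)
  then have "K' t = (1/2) ^ (0 - 1) * weighted_matchings lozenges ?w (cells (quarter_polygon ?J ?n) - dent_union (even_dents t) 0 {})"
    by (simp add: K'_def M_eq_weighted_matchings polygon_minus_dents)
  also have "\<dots> = trapezoid_matchings (1/2) (odd_sum t) ?J (blocks False t)"
  proof (rule dent_union_matchings[symmetric])
    show "?n = odd_sum t + (?J + 1) div 2" using assms by simp
    show "s \<le> ?J" if "(p, s) \<in> even_dents t" for p s using even_dents_le[OF that] assms by simp
    show "odd ?J \<or> (1/2 :: real) = 1" using J(1) by simp
    show "?w {up u k, down u k} = (if u = 0 \<and> even k then 1/2 else 1)" if k: "1 \<le> k" "k < int ?J" for u k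
      unfolding west_weight_vertical zigzag_mem_north zigzag_mem_south
      using k J(2) by (auto simp: west_K_def)
    show "?w {up u k, down u' k'} = 1" if "u \<noteq> u'" for u k u' k' using that by (rule west_weight_other)
  qed (simp_all add: mem_even_dents)
  finally show ?thesis .
qed

section \<open>Cutting the region along the line\<close>

text \<open>Turns the part of the region below the line upside down, with the west end of its
  base moved to the origin.\<close>

definition flip :: "point \<Rightarrow> point" where
  "flip = (\<lambda>(u, k). (u - 1, - k))"

lemma inj_flip: "inj flip"
  by (rule injI) (simp add: flip_def case_prod_unfold prod_eq_iff)

lemma flip_up: "flip ` up u k = down (u - 1) (- k)"
  by (simp add: up_def down_def flip_def)

lemma flip_down: "flip ` down u k = up (u - 1) (- k)"
  by (simp add: up_def down_def flip_def)

lemma flip_lattice: "(u - 1, - k) \<in> Defs.lattice \<longleftrightarrow> (u, k) \<in> Defs.lattice"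
proof -
  have "u - 1 - real_of_int (- k) / 2 = (u - of_int k / 2) + of_int (k - 1)"
    "u - of_int k / 2 = (u - 1 - real_of_int (- k) / 2) + of_int (1 - k)" by (simp_all add: field_simps)
  then show ?thesis unfolding Defs.lattice_def mem_Collect_eq case_prod_conv
    by (metis Ints_add Ints_of_int)
qed

lemma flip_unit_triangle: "t \<in> unit_triangles \<Longrightarrow> flip ` t \<in> unit_triangles"
  by (erule unit_triangle_cases) (simp_all add: flip_up flip_down flip_lattice)

lemma unit_triangle_flip:
  assumes "s \<in> unit_triangles"
  obtains t where "t \<in> unit_triangles" "s = flip ` t"
  using assms
proof (cases rule: unit_triangle_cases)
  case (1 u k)
  show thesis
    by (rule that[of "down (u + 1) (- k)"])
      (use 1 flip_lattice[of "u + 1" "- k"] in \<open>simp_all add: flip_down\<close>)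
next
  case (2 u k)
  show thesis
    by (rule that[of "up (u + 1) (- k)"])
      (use 2 flip_lattice[of "u + 1" "- k"] in \<open>simp_all add: flip_up\<close>)
qed

lemma flip_in_cells: "t \<in> unit_triangles \<Longrightarrow> flip ` t \<in> cells S \<longleftrightarrow> t \<in> cells (flip -` S)"
  by (simp add: cells_def flip_unit_triangle image_subset_iff_subset_vimage)

lemma flip_matchings:
  assumes "finite R" "R \<subseteq> unit_triangles"
  shows "weighted_matchings lozenges w ((`) flip ` R) = weighted_matchings lozenges (\<lambda>l. w ((`) flip ` l)) R"
proof (rule weighted_matchings_image[OF assms(1)])
  show "inj_on ((`) flip) R"
    by (rule inj_onI) (simp only: inj_image_eq_iff[OF inj_flip])
  show "card l = 2" if "l \<in> lozenges" for l using that by (rule card_lozenge)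
  show "card l = 2" if "l \<in> lozenges" for l using that by (rule card_lozenge)
  fix s t assume st: "s \<in> R" "t \<in> R"
  then have u: "s \<in> unit_triangles" "t \<in> unit_triangles" using assms(2) by auto
  have "card (flip ` s \<inter> flip ` t) = card (s \<inter> t)"
    unfolding image_Int[OF inj_flip, symmetric] by (rule card_image) (rule inj_on_subset[OF inj_flip subset_UNIV])
  then show "{flip ` s, flip ` t} \<in> lozenges \<longleftrightarrow> {s, t} \<in> lozenges"
    unfolding doubleton_in_lozenges using u by (simp add: flip_unit_triangle)
qed simp

lemma flip_vimage_up_tri: "flip -` down_tri p s = up_tri (p + 1) s"
  unfolding down_tri_def up_tri_def flip_def vimage_def mem_Collect_eq case_prod_unfold fst_conv snd_conv
  by (intro Collect_cong conj_cong) (simp_all, linarith+)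

text \<open>The base of the reflected lower part begins at -1, which adds one unit to a_1.\<close>

lemma flip_vimage_half: "flip -` NR_half_triangle as = half_tri (entry as 1 + 1)"
  unfolding NR_half_triangle_def half_tri_def flip_def vimage_def mem_Collect_eq case_prod_unfold fst_conv snd_conv
  by (intro Collect_cong conj_cong) (simp_all, linarith+)

section \<open>The two sides of the line and their dents\<close>

definition upper_part :: "triangle \<Rightarrow> bool" where
  "upper_part s \<longleftrightarrow> s \<subseteq> {(u, k). 0 \<le> k}"

definition lower_part :: "triangle \<Rightarrow> bool" where
  "lower_part s \<longleftrightarrow> s \<subseteq> {(u, k). k \<le> 0}"

lemma not_upper_and_lower: "s \<in> unit_triangles \<Longrightarrow> \<not> (upper_part s \<and> lower_part s)"
  unfolding upper_part_def lower_part_def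
  by (erule unit_triangle_cases) (simp_all add: up_subset_iff down_subset_iff)

lemma cells_upper_part: "s \<in> cells S \<Longrightarrow> S \<subseteq> {(u, k). 0 \<le> k} \<Longrightarrow> upper_part s"
  unfolding cells_def upper_part_def mem_Collect_eq by (elim conjE) (rule subset_trans)

lemma cells_lower_part: "s \<in> cells S \<Longrightarrow> S \<subseteq> {(u, k). k \<le> 0} \<Longrightarrow> lower_part s"
  unfolding cells_def lower_part_def mem_Collect_eq by (elim conjE) (rule subset_trans)

lemma part_subsets:
  "NR_upper x y as bs \<subseteq> {(u, k). 0 \<le> k}" "up_tri p s \<subseteq> {(u, k). 0 \<le> k}"
  "NR_lower x y z as bs \<subseteq> {(u, k). k \<le> 0}" "down_tri p s \<subseteq> {(u, k). k \<le> 0}"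
  "NR_half_triangle as \<subseteq> {(u, k). k \<le> 0}"
  unfolding NR_upper_def NR_lower_def up_tri_def down_tri_def NR_half_triangle_def by auto

definition upper_dents :: "nat \<Rightarrow> nat list \<Rightarrow> nat list \<Rightarrow> (nat \<times> nat) set" where
  "upper_dents L as bs = (\<lambda>i. (psum as (i - 1), entry as i)) ` {i \<in> {2..seq_length as}. even i} \<union>
     (\<lambda>j. (L - psum bs j, entry bs j)) ` {j \<in> {1..seq_length bs}. odd j}"

text \<open>Starting points are shifted by one with the origin. The first entry of the western fern
  is left out because it is the half triangle, and the bend of the east side appears as a triangle
  of side z beyond the end of the line.\<close>

definition lower_dents :: "nat \<Rightarrow> nat \<Rightarrow> nat list \<Rightarrow> nat list \<Rightarrow> (nat \<times> nat) set" where
  "lower_dents z L as bs = (\<lambda>i. (psum as (i - 1) + 1, entry as i)) ` {i \<in> {2..seq_length as}. odd i} \<union>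
     (\<lambda>j. (L - psum bs j + 1, entry bs j)) ` {j \<in> {1..seq_length bs}. even j} \<union> {(L + 1, z)}"

lemma base_in_dent_union:
  "up (real i) 0 \<in> dent_union P h S \<longleftrightarrow> (\<exists>(p, s)\<in>P. p \<le> i \<and> i < p + s) \<or> i < h \<or> i \<in> S"
proof -
  have "up (real i) 0 \<in> cells (up_tri p s) \<longleftrightarrow> p \<le> i \<and> i < p + s" for p s
    by (auto simp: up_in_up_tri Defs.lattice_def)
  moreover have "up (real i) 0 \<in> cells (half_tri h) \<longleftrightarrow> i < h"
    by (auto simp: up_in_half_tri Defs.lattice_def)
  ultimately show ?thesis unfolding up_in_dent_union by auto
qed

lemma psum_le_sum_list: "psum t r \<le> sum_list t"
proof (induction t arbitrary: r)
  case (Cons a t)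
  then show ?case by (cases r) (simp_all add: psum_Cons)
qed simp

lemma entry_le_odd_sum:
  assumes "odd r"
  shows "entry t r \<le> odd_sum t"
proof (cases "r \<in> {1..length t}")
  case True
  then show ?thesis unfolding odd_sum_def using assms by (intro member_le_sum) auto
next
  case False
  then have "entry t r = 0" by (auto simp: entry_def)
  then show ?thesis by simp
qed

lemma mem_blocks_entry:
  "i \<in> blocks c t \<longleftrightarrow> (\<exists>r\<in>{1..seq_length t}. (odd r \<longleftrightarrow> c) \<and> psum t (r - 1) \<le> i \<and> i < psum t (r - 1) + entry t r)"
proof
  assume "i \<in> blocks c t"
  then obtain r where r: "even r \<longleftrightarrow> c" "psum t r \<le> i" "i < psum t r + entry t (Suc r)"
    unfolding mem_blocks_iff psum_Suc by blast
  have "entry t (Suc r) \<noteq> 0" using r(2,3) by linarith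
  then have "Suc r \<le> length t" using entry_outside[of "Suc r" t] by linarith
  then show "\<exists>r\<in>{1..seq_length t}. (odd r \<longleftrightarrow> c) \<and> psum t (r - 1) \<le> i \<and> i < psum t (r - 1) + entry t r"
    by (intro bexI[of _ "Suc r"]) (use r in \<open>simp_all add: seq_length_def\<close>)
next
  assume "\<exists>r\<in>{1..seq_length t}. (odd r \<longleftrightarrow> c) \<and> psum t (r - 1) \<le> i \<and> i < psum t (r - 1) + entry t r"
  then obtain r where r: "1 \<le> r" "odd r \<longleftrightarrow> c" "psum t (r - 1) \<le> i" "i < psum t (r - 1) + entry t r" by auto
  obtain r' where r': "r = Suc r'" using r(1) by (cases r) simp_all
  have "(even r' \<longleftrightarrow> c) \<and> psum t r' \<le> i \<and> i < psum t (Suc r')"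
    using r unfolding r' psum_Suc by simp
  then show "i \<in> blocks c t" unfolding mem_blocks_iff by blast
qed

lemma mem_mirrored_blocks:
  assumes "i < L" "sum_list t \<le> L"
  shows "L - 1 - i \<in> blocks c t \<longleftrightarrow>
    (\<exists>r\<in>{1..seq_length t}. (odd r \<longleftrightarrow> c) \<and> L - psum t r \<le> i \<and> i < L - psum t r + entry t r)"
proof -
  have "(psum t (r - 1) \<le> L - 1 - i \<and> L - 1 - i < psum t (r - 1) + entry t r) \<longleftrightarrow>
      (L - psum t r \<le> i \<and> i < L - psum t r + entry t r)" if "r \<in> {1..seq_length t}" for r
  proof -
    have "psum t (Suc (r - 1)) = psum t (r - 1) + entry t (Suc (r - 1))" by (rule psum_Suc)
    moreover have "Suc (r - 1) = r" using that by simp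
    moreover have "psum t r \<le> L" using psum_le_sum_list[of t r] assms(2) by linarith
    ultimately show ?thesis using assms(1) by (simp only:) linarith
  qed
  then show ?thesis unfolding mem_blocks_entry by (intro bex_cong refl) blast
qed

lemma upper_part_iff: "upper_part (up u k) \<longleftrightarrow> 0 \<le> k" "upper_part (down u k) \<longleftrightarrow> 1 \<le> k"
  unfolding upper_part_def up_subset_iff down_subset_iff by auto

lemma lower_part_iff: "lower_part (up u k) \<longleftrightarrow> k \<le> - 1" "lower_part (down u k) \<longleftrightarrow> k \<le> 0"
  unfolding lower_part_def up_subset_iff down_subset_iff by auto

lemma fern_set_Un:
  assumes "L = x + y + sum_list as + sum_list bs"
  shows "fern_set True L as bs \<union> fern_set False L as bs = {..<L} - {sum_list as..<sum_list as + x + y}"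
proof (rule Set.set_eqI)
  fix i
  have "blocks False as \<union> blocks True as = {..<sum_list as}" "blocks True bs \<union> blocks False bs = {..<sum_list bs}"
    using blocks_Un[of False as] blocks_Un[of True bs] by simp_all
  then have "i \<in> blocks False as \<or> i \<in> blocks True as \<longleftrightarrow> i < sum_list as"
    "L - 1 - i \<in> blocks True bs \<or> L - 1 - i \<in> blocks False bs \<longleftrightarrow> L - 1 - i < sum_list bs"
    by (simp_all only: Un_iff[symmetric] lessThan_iff)
  then have "i \<in> fern_set True L as bs \<union> fern_set False L as bs \<longleftrightarrow> i < sum_list as \<or> (i < L \<and> L - 1 - i < sum_list bs)"
    unfolding fern_set_def not_True_eq_False not_False_eq_True Un_iff mem_Collect_eq by blast
  also have "\<dots> \<longleftrightarrow> i \<in> {..<L} - {sum_list as..<sum_list as + x + y}"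
    unfolding Diff_iff lessThan_iff atLeastLessThan_iff assms by linarith
  finally show "i \<in> fern_set True L as bs \<union> fern_set False L as bs \<longleftrightarrow> i \<in> {..<L} - {sum_list as..<sum_list as + x + y}" .
qed

lemma fern_set_Int:
  assumes "L = x + y + sum_list as + sum_list bs"
  shows "fern_set True L as bs \<inter> fern_set False L as bs = {}"
proof (rule equals0I)
  fix i assume "i \<in> fern_set True L as bs \<inter> fern_set False L as bs"
  then have "(i \<in> blocks False as \<or> i < L \<and> L - 1 - i \<in> blocks True bs) \<and>
      (i \<in> blocks True as \<or> i < L \<and> L - 1 - i \<in> blocks False bs)"
    unfolding fern_set_def by simp
  moreover have "i < sum_list as" if "i \<in> blocks c as" for c using that blocks_subset[of c as] by auto
  moreover have "L - 1 - i < sum_list bs" if "L - 1 - i \<in> blocks c bs" for c using that blocks_subset[of c bs] by auto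
  moreover have "\<not> (i \<in> blocks False as \<and> i \<in> blocks True as)"
    using blocks_Int[of False as] by auto
  moreover have "\<not> (L - 1 - i \<in> blocks True bs \<and> L - 1 - i \<in> blocks False bs)"
    using blocks_Int[of True bs] by auto
  moreover have "\<not> (i < sum_list as \<and> i < L \<and> L - 1 - i < sum_list bs)" unfolding assms by linarith
  ultimately show False by blast
qed

lemma card_fern_set:
  assumes "L = x + y + sum_list as + sum_list bs"
  shows "card (fern_set True L as bs) = even_sum as + odd_sum bs" "card (fern_set False L as bs) = odd_sum as + even_sum bs"
proof -
  have "card (fern_set c L as bs) = card (blocks (\<not> c) as) + card (blocks c bs)" for c
  proof -
    have sub: "i < sum_list bs" if "i \<in> blocks c bs" for i using that blocks_subset[of c bs] by auto
    have m: "{i. i < L \<and> L - 1 - i \<in> blocks c bs} = (\<lambda>i. L - 1 - i) ` blocks c bs"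
    proof (intro equalityI subsetI)
      fix i assume "i \<in> {i. i < L \<and> L - 1 - i \<in> blocks c bs}"
      then have "i = L - 1 - (L - 1 - i)" "L - 1 - i \<in> blocks c bs" by auto
      then show "i \<in> (\<lambda>i. L - 1 - i) ` blocks c bs" by (rule image_eqI)
    next
      fix i assume "i \<in> (\<lambda>i. L - 1 - i) ` blocks c bs"
      then obtain j where j: "i = L - 1 - j" "j \<in> blocks c bs" by (rule imageE)
      then have "j < L" using sub[of j] assms by linarith
      then show "i \<in> {i. i < L \<and> L - 1 - i \<in> blocks c bs}" using j by auto
    qed
    have "inj_on (\<lambda>i. L - 1 - i) (blocks c bs)"
    proof (rule inj_onI)
      fix i j assume "i \<in> blocks c bs" "j \<in> blocks c bs" "L - 1 - i = L - 1 - j"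
      then show "i = j" using sub[of i] sub[of j] assms by linarith
    qed
    then have "card {i. i < L \<and> L - 1 - i \<in> blocks c bs} = card (blocks c bs)"
      unfolding m by (rule card_image)
    moreover have "blocks (\<not> c) as \<inter> {i. i < L \<and> L - 1 - i \<in> blocks c bs} = {}"
    proof (rule equals0I)
      fix i assume "i \<in> blocks (\<not> c) as \<inter> {i. i < L \<and> L - 1 - i \<in> blocks c bs}"
      then have "i < sum_list as" "i < L" "L - 1 - i < sum_list bs"
        using blocks_subset[of "\<not> c" as] sub[of "L - 1 - i"] by auto
      then show False using assms by linarith
    qed
    moreover have "finite {i. i < L \<and> L - 1 - i \<in> blocks c bs}" by simp
    ultimately show ?thesis unfolding fern_set_def by (simp add: card_Un_disjoint)
  qed
  from this[of True] this[of False] show "card (fern_set True L as bs) = even_sum as + odd_sum bs"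
    "card (fern_set False L as bs) = odd_sum as + even_sum bs"
    by (simp_all add: card_blocks)
qed

lemma finite_fern_set [simp]: "finite (fern_set c L as bs)"
  by (simp add: fern_set_def)

text \<open>\<open>e1\<close> and \<open>e2\<close> are the numbers of dents that the heights of the
  two sides demand: in each case y more than the fixed dents provide, which is what forces y
  lozenges to cross.\<close>

locale nr_region =
  fixes x y z :: nat and as bs :: "nat list"
begin

definition "L = x + y + sum_list as + sum_list bs"
definition "e1 = y + even_sum as + odd_sum bs"
definition "e2 = y + z + odd_sum as + even_sum bs + 1"
definition "J1 = 2 * e1"
definition "J2 = 2 * e2 - 1"
definition "h = entry as 1 + 1"
definition "A S = cells (quarter_polygon J1 L) - dent_union (upper_dents L as bs) 0 S"
definition "B S = cells (quarter_polygon J2 (L + 1 + z)) - dent_union (lower_dents z L as bs) h S"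
definition "Z = zigzag NR_beta (- int (NR_B y z as bs)) 0"

lemma J2: "odd J2" "int J2 = int (NR_B y z as bs)" "(J2 + 1) div 2 = e2" "0 < J2"
  by (auto simp: J2_def e2_def NR_B_def)

lemma le_L: "e1 \<le> L" "e2 \<le> L + 1 + z"
  using odd_sum_add_even_sum[of as] odd_sum_add_even_sum[of bs] by (simp_all add: e1_def e2_def L_def)

lemma cells_NR_upper: "cells (NR_upper x y as bs) = cells (quarter_polygon J1 L)"
proof -
  have "NR_alpha k = west J1 k" for k by (simp add: NR_alpha_def west_def J1_def)
  then have "NR_upper x y as bs = quarter_polygon J1 L"
    by (simp add: NR_upper_def quarter_polygon_def NR_A_def NR_L_def L_def J1_def e1_def)
  then show ?thesis by simp
qed

text \<open>The bent east side is a straight one cut by a half plane; the next lemma recognises the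
  part cut off as a dent of side z.\<close>

lemma flip_vimage_lower:
  "flip -` NR_lower x y z as bs = quarter_polygon J2 (L + 1 + z) \<inter> {(u, k). u \<le> real L + 1 + of_int k / 2}"
proof -
  have "NR_beta (- k) = west J2 k - 1" for k using J2(1) by (simp add: NR_beta_def west_def)
  then have "flip (u, k) \<in> NR_lower x y z as bs \<longleftrightarrow>
      (u, k) \<in> quarter_polygon J2 (L + 1 + z) \<inter> {(u, k). u \<le> real L + 1 + of_int k / 2}" for u k
    unfolding flip_def NR_lower_def quarter_polygon_def mem_Collect_eq case_prod_conv Int_iff J2(2)
    by (simp add: NR_L_def L_def) linarith
  then show ?thesis by (intro Set.set_eqI) (simp add: vimage_def split_paired_all)
qed

lemma cells_flipped_lower:
  assumes t: "t \<in> unit_triangles"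
  shows "flip ` t \<in> cells (NR_lower x y z as bs) \<longleftrightarrow>
    t \<in> cells (quarter_polygon J2 (L + 1 + z)) \<and> t \<notin> cells (up_tri (L + 1) z)"
proof -
  let ?H = "{(u, k). u \<le> real L + 1 + of_int k / 2} :: point set"
  have "flip ` t \<in> cells (NR_lower x y z as bs) \<longleftrightarrow> t \<in> cells (quarter_polygon J2 (L + 1 + z)) \<and> t \<subseteq> ?H"
    unfolding flip_in_cells[OF t] flip_vimage_lower by (auto simp: cells_def)
  also have "\<dots> \<longleftrightarrow> t \<in> cells (quarter_polygon J2 (L + 1 + z)) \<and> t \<notin> cells (up_tri (L + 1) z)"
  proof -
    \<comment> \<open>Lattice points have integral u - k/2, so a unit triangle lies entirely on one
      side of the cutting line.\<close>
    have int: "u + 1 \<le> real L + 1 + of_int k / 2 \<longleftrightarrow> \<not> real (L + 1) + of_int k / 2 \<le> u"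
      if "(u, k) \<in> Defs.lattice" for u k
    proof -
      have "u - of_int k / 2 \<in> \<int>" using that by (simp add: Defs.lattice_def)
      then obtain m where "u - of_int k / 2 = of_int m" by (rule Ints_cases)
      then have m: "u = of_int m + of_int k / 2" by linarith
      have "u + 1 \<le> real L + 1 + of_int k / 2 \<longleftrightarrow> of_int m \<le> real L" unfolding m by linarith
      also have "\<dots> \<longleftrightarrow> \<not> real (L + 1) \<le> of_int m"
      proof -
        have "real L = of_int (int L)" "real (L + 1) = of_int (int L + 1)" by simp_all
        then show ?thesis by (simp only: of_int_le_iff) linarith
      qed
      also have "\<dots> \<longleftrightarrow> \<not> real (L + 1) + of_int k / 2 \<le> u" unfolding m by linarith
      finally show ?thesis .
    qed
    have hk: "real_of_int (k + 1) / 2 = of_int k / 2 + 1/2" "real_of_int (k - 1) / 2 = of_int k / 2 - 1/2" for k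
      by (simp_all add: field_simps)
    have n: "real (L + 1 + z) = real (L + 1) + real z" by simp
    from t show ?thesis
    proof (cases rule: unit_triangle_cases)
      case (1 u k)
      have "t \<subseteq> ?H \<longleftrightarrow> u + 1 \<le> real L + 1 + of_int k / 2"
        unfolding 1 up_subset_iff mem_Collect_eq case_prod_conv hk
        by (intro iffI; (elim conjE)?; (intro conjI)?; linarith)
      moreover have "t \<in> cells (up_tri (L + 1) z) \<longleftrightarrow> real (L + 1) + of_int k / 2 \<le> u"
        if "t \<in> cells (quarter_polygon J2 (L + 1 + z))"
        using that unfolding 1 up_in_quarter_polygon up_in_up_tri n
        by (elim conjE, intro iffI; (elim conjE)?; (intro conjI)?; (assumption | linarith))
      ultimately show ?thesis using int[OF 1(2)] by blast
    next
      case (2 u k)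
      have "t \<subseteq> ?H \<longleftrightarrow> u + 1 \<le> real L + 1 + of_int k / 2"
        unfolding 2 down_subset_iff mem_Collect_eq case_prod_conv hk
        by (intro iffI; (elim conjE)?; (intro conjI)?; linarith)
      moreover have "t \<in> cells (up_tri (L + 1) z) \<longleftrightarrow> real (L + 1) + of_int k / 2 \<le> u"
        if "t \<in> cells (quarter_polygon J2 (L + 1 + z))"
        using that unfolding 2 down_in_quarter_polygon down_in_up_tri n
        by (elim conjE, intro iffI; (elim conjE)?; (intro conjI)?; (assumption | linarith))
      ultimately show ?thesis using int[OF 2(2)] by blast
    qed
  qed
  finally show ?thesis .
qed

lemma NR_upper_iff:
  assumes "s \<in> unit_triangles" "upper_part s"
  shows "s \<in> NR x y z as bs \<longleftrightarrow> s \<in> A {}"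
proof -
  have nl: "\<not> lower_part s" using not_upper_and_lower assms by blast
  have 1: "s \<notin> cells (NR_lower x y z as bs)" "s \<notin> cells (NR_half_triangle as)"
    "\<And>p q. s \<notin> cells (down_tri p q)"
    by (rule notI, drule cells_lower_part[OF _ part_subsets(3)], simp add: nl,
      rule notI, drule cells_lower_part[OF _ part_subsets(5)], simp add: nl,
      rule notI, drule cells_lower_part[OF _ part_subsets(4)], simp add: nl)
  have 2: "s \<in> NR_removed_a as \<longleftrightarrow> (\<exists>i\<in>{2..seq_length as}. even i \<and> s \<in> cells (up_tri (psum as (i - 1)) (entry as i)))"
    unfolding NR_removed_a_def UN_iff using 1(3) by (intro bex_cong refl) simp
  have 3: "s \<in> NR_removed_b (NR_L x y as bs) bs \<longleftrightarrow>
      (\<exists>j\<in>{1..seq_length bs}. odd j \<and> s \<in> cells (up_tri (L - psum bs j) (entry bs j)))"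
    unfolding NR_removed_b_def UN_iff using 1(3) by (intro bex_cong refl) (simp add: NR_L_def L_def)
  have 4: "s \<in> dent_union (upper_dents L as bs) 0 {} \<longleftrightarrow>
      (\<exists>i\<in>{2..seq_length as}. even i \<and> s \<in> cells (up_tri (psum as (i - 1)) (entry as i))) \<or>
      (\<exists>j\<in>{1..seq_length bs}. odd j \<and> s \<in> cells (up_tri (L - psum bs j) (entry bs j))) \<or> s \<in> cells (half_tri 0)"
    by (simp only: dent_union_def upper_dents_def Un_iff UN_iff bex_Un bex_simps case_prod_conv image_empty empty_iff)
      (simp only: Bex_def mem_Collect_eq conj_assoc disj_assoc simp_thms)
  show ?thesis
    unfolding NR_def A_def Diff_iff Un_iff cells_NR_upper 2 3 4 using 1 half_tri_0_disjoint[of s J1 L] by blast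
qed

lemma NR_lower_iff:
  assumes t: "t \<in> unit_triangles" and l: "lower_part (flip ` t)"
  shows "flip ` t \<in> NR x y z as bs \<longleftrightarrow> t \<in> B {}"
proof -
  let ?s = "flip ` t"
  have nl: "\<not> upper_part ?s" using not_upper_and_lower[OF flip_unit_triangle[OF t]] l by blast
  have 1: "?s \<notin> cells (NR_upper x y as bs)" "\<And>p q. ?s \<notin> cells (up_tri p q)"
    by (rule notI, drule cells_upper_part[OF _ part_subsets(1)], simp add: nl,
      rule notI, drule cells_upper_part[OF _ part_subsets(2)], simp add: nl)
  have d: "?s \<in> cells (down_tri p q) \<longleftrightarrow> t \<in> cells (up_tri (p + 1) q)" for p q
    using flip_in_cells[OF t] by (simp only: flip_vimage_up_tri)
  have hf: "?s \<in> cells (NR_half_triangle as) \<longleftrightarrow> t \<in> cells (half_tri h)"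
    using flip_in_cells[OF t] by (simp only: flip_vimage_half h_def)
  have 2: "?s \<in> NR_removed_a as \<longleftrightarrow> (\<exists>i\<in>{2..seq_length as}. odd i \<and> t \<in> cells (up_tri (psum as (i - 1) + 1) (entry as i)))"
    unfolding NR_removed_a_def UN_iff using 1(2) d by (intro bex_cong refl) simp
  have 3: "?s \<in> NR_removed_b (NR_L x y as bs) bs \<longleftrightarrow>
      (\<exists>j\<in>{1..seq_length bs}. even j \<and> t \<in> cells (up_tri (L - psum bs j + 1) (entry bs j)))"
    unfolding NR_removed_b_def UN_iff using 1(2) d by (intro bex_cong refl) (simp add: NR_L_def L_def)
  have 4: "t \<in> dent_union (lower_dents z L as bs) h {} \<longleftrightarrow>
      (\<exists>i\<in>{2..seq_length as}. odd i \<and> t \<in> cells (up_tri (psum as (i - 1) + 1) (entry as i))) \<or>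
      (\<exists>j\<in>{1..seq_length bs}. even j \<and> t \<in> cells (up_tri (L - psum bs j + 1) (entry bs j))) \<or>
      t \<in> cells (up_tri (L + 1) z) \<or> t \<in> cells (half_tri h)"
    by (simp only: dent_union_def lower_dents_def Un_iff UN_iff bex_Un bex_simps case_prod_conv image_empty empty_iff)
      (simp only: Bex_def mem_Collect_eq conj_assoc disj_assoc simp_thms)
  show ?thesis
    unfolding NR_def B_def Diff_iff Un_iff 2 3 4 hf cells_flipped_lower[OF t] using 1(1) by blast
qed

lemma A_upper: "s \<in> A S \<Longrightarrow> s \<in> unit_triangles \<and> upper_part s"
proof -
  assume "s \<in> A S"
  then have c: "s \<in> cells (NR_upper x y as bs)" by (simp add: A_def cells_NR_upper)
  then show ?thesis using cells_upper_part[OF c part_subsets(1)] by (simp add: cells_def)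
qed

lemma B_lower: "t \<in> B S \<Longrightarrow> t \<in> unit_triangles \<and> lower_part (flip ` t)"
proof -
  assume "t \<in> B S"
  then have t: "t \<in> unit_triangles" "t \<subseteq> quarter_polygon J2 (L + 1 + z)" by (simp_all add: B_def cells_def)
  have "flip ` quarter_polygon J2 (L + 1 + z) \<subseteq> {(u, k). k \<le> 0}"
    unfolding quarter_polygon_def flip_def by auto
  then have "lower_part (flip ` t)" unfolding lower_part_def using t(2) by blast
  then show ?thesis using t(1) by simp
qed

lemma NR_unit: "s \<in> NR x y z as bs \<Longrightarrow> s \<in> unit_triangles \<and> (upper_part s \<or> lower_part s)"
proof -
  assume "s \<in> NR x y z as bs"
  then have "s \<in> cells (NR_upper x y as bs) \<or> s \<in> cells (NR_lower x y z as bs)" unfolding NR_def by blast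
  then show ?thesis using cells_upper_part[OF _ part_subsets(1)] cells_lower_part[OF _ part_subsets(3)]
    by (auto simp only: cells_def mem_Collect_eq)
qed

lemma NR_eq: "NR x y z as bs = A {} \<union> (`) flip ` B {}"
proof (intro equalityI subsetI)
  fix s assume s: "s \<in> NR x y z as bs"
  from NR_unit[OF s] have u: "s \<in> unit_triangles" and "upper_part s \<or> lower_part s" by blast+
  from this(2) show "s \<in> A {} \<union> (`) flip ` B {}"
  proof
    assume "upper_part s"
    then show ?thesis using NR_upper_iff[OF u] s by simp
  next
    assume l: "lower_part s"
    obtain t where t: "t \<in> unit_triangles" "s = flip ` t" using unit_triangle_flip[OF u] .
    then have "t \<in> B {}" using NR_lower_iff[OF t(1)] l s by simp
    then show ?thesis using t(2) by (intro UnI2) (rule image_eqI)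
  qed
next
  fix s assume "s \<in> A {} \<union> (`) flip ` B {}"
  then show "s \<in> NR x y z as bs"
  proof
    assume s: "s \<in> A {}"
    then show ?thesis using NR_upper_iff[of s] A_upper[OF s] by simp
  next
    assume "s \<in> (`) flip ` B {}"
    then obtain t where t: "s = flip ` t" "t \<in> B {}" by (rule imageE)
    then show ?thesis using NR_lower_iff[of t] B_lower[OF t(2)] by simp
  qed
qed

lemma mem_upper_dents:
  assumes "i < L"
  shows "i \<in> fern_set True L as bs \<longleftrightarrow> (\<exists>(p, s)\<in>upper_dents L as bs. p \<le> i \<and> i < p + s)"
proof -
  have "sum_list bs \<le> L" by (simp add: L_def)
  note m = mem_mirrored_blocks[OF assms this, of True]
  have "i \<in> blocks False as \<longleftrightarrow> (\<exists>r\<in>{2..seq_length as}. even r \<and> psum as (r - 1) \<le> i \<and> i < psum as (r - 1) + entry as r)"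
  proof -
    have "(\<exists>r\<in>{1..n}. (odd r \<longleftrightarrow> False) \<and> Y r) \<longleftrightarrow> (\<exists>r\<in>{2..n}. even r \<and> Y r)" for Y and n :: nat
    proof
      assume "\<exists>r\<in>{1..n}. (odd r \<longleftrightarrow> False) \<and> Y r"
      then obtain r where r: "r \<in> {1..n}" "even r" "Y r" by blast
      from r(2) have "r \<noteq> 1" by (intro notI) simp
      then have "r \<in> {2..n}" using r(1) by simp
      then show "\<exists>r\<in>{2..n}. even r \<and> Y r" using r by blast
    next
      assume "\<exists>r\<in>{2..n}. even r \<and> Y r"
      then obtain r where r: "r \<in> {2..n}" "even r" "Y r" by blast
      then have "r \<in> {1..n}" by simp
      then show "\<exists>r\<in>{1..n}. (odd r \<longleftrightarrow> False) \<and> Y r" using r by blast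
    qed
    then show ?thesis unfolding mem_blocks_entry .
  qed
  then show ?thesis
    unfolding fern_set_def upper_dents_def bex_Un bex_simps case_prod_conv Un_iff mem_Collect_eq not_True_eq_False m
    using assms by (simp only: Bex_def mem_Collect_eq conj_assoc simp_thms)
qed

lemma mem_lower_dents:
  assumes "i < L + 1 + z"
  shows "i \<in> insert 0 (Suc ` fern_set False L as bs) \<union> {L + 1..<L + 1 + z} \<longleftrightarrow>
    (\<exists>(p, s)\<in>lower_dents z L as bs. p \<le> i \<and> i < p + s) \<or> i < h"
proof (cases "i = 0")
  case True
  then show ?thesis by (simp add: h_def)
next
  case False
  then obtain k where k: "i = Suc k" by (cases i) auto
  have a: "k \<in> blocks True as \<longleftrightarrow> k < entry as 1 \<or>
      (\<exists>r\<in>{2..seq_length as}. odd r \<and> psum as (r - 1) \<le> k \<and> k < psum as (r - 1) + entry as r)"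
  proof -
    have "{1..seq_length as} = insert 1 {2..seq_length as}" by (auto simp: seq_length_def)
    then show ?thesis unfolding mem_blocks_entry by simp
  qed
  have b: "(k < L \<and> L - 1 - k \<in> blocks False bs) \<longleftrightarrow>
     (\<exists>r\<in>{1..seq_length bs}. even r \<and> L - psum bs r \<le> k \<and> k < L - psum bs r + entry bs r)"
  proof (cases "k < L")
    case True
    then show ?thesis using mem_mirrored_blocks[OF True, of bs False] by (simp add: L_def)
  next
    case False
    have "\<not> k < L - psum bs r + entry bs r" if "r \<in> {1..seq_length bs}" for r
    proof -
      have "Suc (r - 1) = r" using that by simp
      then have "psum bs r = psum bs (r - 1) + entry bs r" using psum_Suc[of bs "r - 1"] by simp
      moreover have "psum bs r \<le> sum_list bs" "sum_list bs \<le> L"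
        by (simp_all add: psum_le_sum_list L_def)
      ultimately show ?thesis using False by linarith
    qed
    then show ?thesis using False by blast
  qed
  have "i \<in> insert 0 (Suc ` fern_set False L as bs) \<union> {L + 1..<L + 1 + z} \<longleftrightarrow>
      k \<in> blocks True as \<or> (k < L \<and> L - 1 - k \<in> blocks False bs) \<or> (L + 1 \<le> i \<and> i < L + 1 + z)"
    unfolding k fern_set_def by (simp add: mem_Suc_image)
  also have "\<dots> \<longleftrightarrow> (\<exists>(p, s)\<in>lower_dents z L as bs. p \<le> i \<and> i < p + s) \<or> i < h"
    unfolding a b lower_dents_def bex_Un bex_simps case_prod_conv
    by (simp only: Bex_def mem_Collect_eq conj_assoc simp_thms k h_def add_Suc Suc_eq_plus1[symmetric]
        Suc_le_mono Suc_less_eq) blast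
  finally show ?thesis .
qed

definition "window = {i. up (real i) 0 \<in> A {} \<and> up (real (Suc i)) 0 \<in> B {}}"

abbreviation "dn_fern \<equiv> insert 0 (Suc ` fern_set False L as bs) \<union> {L + 1..<L + 1 + z}"

lemma A_minus: "A S = A {} - (\<lambda>i. up (real i) 0) ` S"
  unfolding A_def dent_union_def by blast

lemma B_minus: "B S = B {} - (\<lambda>i. up (real i) 0) ` S"
  unfolding B_def dent_union_def by blast

lemma finite_AB: "finite (A S)" "finite (B S)"
  by (simp_all add: A_def B_def finite_quarter_polygon)

text \<open>Lozenges can cross exactly in the gap between the ferns, unless the upper part has
  height 0 and hence no triangles.\<close>

lemma window_eq:
  "window = (if e1 = 0 then {} else {sum_list as..<sum_list as + x + y})"
proof (rule Set.set_eqI)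
  fix i
  have lat: "(real i, 0) \<in> Defs.lattice" "(real (Suc i), 0) \<in> Defs.lattice" by (simp_all add: Defs.lattice_def)
  have 1: "up (real i) 0 \<in> A {} \<longleftrightarrow> 0 < e1 \<and> i < L \<and> i \<notin> fern_set True L as bs"
  proof (cases "i < L")
    case True
    have "up (real i) 0 \<in> cells (quarter_polygon J1 L) \<longleftrightarrow> 0 < e1"
      using lat True by (auto simp: up_in_quarter_polygon west_def J1_def)
    then show ?thesis using True by (simp add: A_def base_in_dent_union mem_upper_dents)
  next
    case False
    then have "up (real i) 0 \<notin> cells (quarter_polygon J1 L)" by (simp add: up_in_quarter_polygon)
    then show ?thesis using False by (simp add: A_def)
  qed
  have 2: "up (real (Suc i)) 0 \<in> B {} \<longleftrightarrow> i \<notin> fern_set False L as bs" if "i < L"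
  proof -
    have "up (real (Suc i)) 0 \<in> cells (quarter_polygon J2 (L + 1 + z))"
      using lat that J2(4) by (simp add: up_in_quarter_polygon west_def)
    moreover have "Suc i < L + 1 + z" using that by simp
    ultimately have "up (real (Suc i)) 0 \<in> B {} \<longleftrightarrow> Suc i \<notin> dn_fern"
      unfolding mem_lower_dents[OF \<open>Suc i < L + 1 + z\<close>] by (simp only: B_def base_in_dent_union Diff_iff empty_iff simp_thms)
    also have "\<dots> \<longleftrightarrow> i \<notin> fern_set False L as bs" using that by auto
    finally show ?thesis .
  qed
  have "i \<in> fern_set True L as bs \<or> i \<in> fern_set False L as bs \<longleftrightarrow> i < L \<and> i \<notin> {sum_list as..<sum_list as + x + y}"
    using fern_set_Un[OF L_def] by (simp only: Un_iff[symmetric] Diff_iff lessThan_iff)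
  moreover have "i \<in> {sum_list as..<sum_list as + x + y} \<Longrightarrow> i < L" by (simp add: L_def)
  ultimately show "i \<in> window \<longleftrightarrow> i \<in> (if e1 = 0 then {} else {sum_list as..<sum_list as + x + y})"
    unfolding window_def mem_Collect_eq 1 using 2 by auto
qed

lemma flip_up_Suc: "flip ` up (real (Suc i)) 0 = down (real i) 0"
  by (simp add: flip_up)

lemma down_in_flip_B: "down (real i) 0 \<in> (`) flip ` B S \<longleftrightarrow> up (real (Suc i)) 0 \<in> B S"
  unfolding flip_up_Suc[symmetric] by (rule inj_image_mem_iff) (rule injI, simp only: inj_image_eq_iff[OF inj_flip])

text \<open>A lozenge crossing at position i takes the base triangle i above and, in reflected
  coordinates, the base triangle i + 1 below; hence \<open>Suc\<close> on one side only.\<close>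

lemma cut_matchings:
  "M_NR x y z as bs = (\<Sum>S\<in>Pow window. weighted_matchings lozenges (west_weight Z) (A S) *
     weighted_matchings lozenges (west_weight Z) ((`) flip ` B (Suc ` S)))"
proof -
  let ?w = "west_weight Z" let ?FB = "(`) flip ` B {}"
  let ?g = "\<lambda>i. {up (real i) 0, down (real i) 0}"
  let ?C = "?g ` window"
  have win: "up (real i) 0 \<in> A {}" "down (real i) 0 \<in> ?FB" if "i \<in> window" for i
    using that by (simp_all only: window_def mem_Collect_eq down_in_flip_B)
  have FB: "s \<in> unit_triangles \<and> lower_part s" if "s \<in> ?FB" for s
  proof -
    from that obtain t where "s = flip ` t" "t \<in> B {}" by (rule imageE)
    then show ?thesis using B_lower[of t "{}"] flip_unit_triangle[of t] by simp
  qed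
  have dis: "A {} \<inter> ?FB = {}"
  proof (rule equals0I)
    fix s assume "s \<in> A {} \<inter> ?FB"
    then show False using A_upper[of s "{}"] FB[of s] not_upper_and_lower[of s] by simp
  qed
  have injg: "inj ?g" by (rule injI) (simp add: doubleton_eq_iff)
  have "M_NR x y z as bs = weighted_matchings lozenges ?w (A {} \<union> ?FB)"
    by (simp only: M_NR_def Z_def M_eq_weighted_matchings NR_eq)
  also have "\<dots> = (\<Sum>X\<in>Pow ?C. (\<Prod>l\<in>X. ?w l) * (weighted_matchings lozenges ?w (A {} - \<Union>X) * weighted_matchings lozenges ?w (?FB - \<Union>X)))"
  proof (rule weighted_matchings_cut)
    show "finite (A {})" "finite ?FB" by (simp_all add: finite_AB)
    show "A {} \<inter> ?FB = {}" by (rule dis)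
    show "{} \<notin> lozenges" using card_lozenge[of "{}"] by fastforce
    show "?C \<subseteq> lozenges"
    proof (rule image_subsetI)
      fix i assume "i \<in> window"
      have "(real i, 0) \<in> Defs.lattice" by (simp add: Defs.lattice_def)
      then show "?g i \<in> lozenges" by (simp add: up_down_in_lozenges)
    qed
    show "l \<subseteq> A {} \<union> ?FB" if "l \<in> ?C" for l
    proof -
      from that obtain i where "l = ?g i" "i \<in> window" by (rule imageE)
      then show ?thesis using win[of i] by simp
    qed
    show "disjoint ?C"
    proof (rule disjointI)
      fix l l' assume l: "l \<in> ?C" "l' \<in> ?C" "l \<noteq> l'"
      from l(1) obtain i where i: "l = ?g i" by (rule imageE)
      from l(2) obtain j where j: "l' = ?g j" by (rule imageE)
      have "i \<noteq> j"
      proof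
        assume "i = j"
        then have "l = l'" using i j by simp
        then show False using l(3) by contradiction
      qed
      then show "l \<inter> l' = {}" unfolding i j by simp
    qed
    show "l \<in> ?C \<longleftrightarrow> \<not> l \<subseteq> A {} \<and> \<not> l \<subseteq> ?FB" if l: "l \<in> lozenges" "l \<subseteq> A {} \<union> ?FB" for l
    proof
      assume "l \<in> ?C"
      then obtain i where i: "l = ?g i" "i \<in> window" by (rule imageE)
      have "down (real i) 0 \<notin> A {}" "up (real i) 0 \<notin> ?FB" using win[OF i(2)] dis by (simp_all add: disjoint_iff, blast+)
      then show "\<not> l \<subseteq> A {} \<and> \<not> l \<subseteq> ?FB" unfolding i(1) by simp
    next
      assume n: "\<not> l \<subseteq> A {} \<and> \<not> l \<subseteq> ?FB"
      from l(1) obtain u k u' k' where e: "l = {up u k, down u' k'}"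
        and adj: "(u' = u \<and> k' = k) \<or> (k' = k + 1 \<and> (u' = u + 1/2 \<or> u' = u - 1/2))"
        by (rule lozenge_cases)
      have kk: "k' = k \<or> k' = k + 1" using adj by (elim disjE conjE) simp_all
      have "up u k \<in> A {} \<or> up u k \<in> ?FB" "down u' k' \<in> A {} \<or> down u' k' \<in> ?FB" using l(2) e by simp_all
      then have "(up u k \<in> A {} \<and> down u' k' \<in> ?FB) \<or> (up u k \<in> ?FB \<and> down u' k' \<in> A {})"
        using n unfolding e by simp blast
      then have "up u k \<in> A {} \<and> down u' k' \<in> ?FB"
      proof
        assume c: "up u k \<in> ?FB \<and> down u' k' \<in> A {}"
        then have "k \<le> - 1" "1 \<le> k'" using FB[of "up u k"] A_upper[of "down u' k'" "{}"]
          by (simp_all add: upper_part_iff lower_part_iff)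
        then show ?thesis using kk by linarith
      qed
      then have c: "up u k \<in> A {}" "down u' k' \<in> ?FB" by simp_all
      then have "0 \<le> k" "k' \<le> 0" using A_upper[of "up u k" "{}"] FB[of "down u' k'"]
        by (simp_all add: upper_part_iff lower_part_iff)
      then have k0: "k = 0" "k' = 0" using kk by linarith+
      then have u: "u' = u" using adj by simp
      have "(u, 0) \<in> Defs.lattice" "west J1 0 \<le> u" using c(1) k0 by (simp_all add: A_def up_in_quarter_polygon)
      then obtain i where i: "u = west J1 0 + real i" by (rule lattice_position)
      then have ui: "u = real i" by (simp add: west_def)
      have "i \<in> window" using c unfolding k0 u ui window_def mem_Collect_eq down_in_flip_B by simp
      then show "l \<in> ?C" unfolding e k0 u ui by (rule imageI)
    qed
  qed
  also have "Pow ?C = (`) ?g ` Pow window" by (rule image_Pow_surj[symmetric]) (rule refl)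
  also have "(\<Sum>X\<in>(`) ?g ` Pow window. (\<Prod>l\<in>X. ?w l) * (weighted_matchings lozenges ?w (A {} - \<Union>X) * weighted_matchings lozenges ?w (?FB - \<Union>X)))
    = (\<Sum>S\<in>Pow window. (\<Prod>l\<in>?g ` S. ?w l) * (weighted_matchings lozenges ?w (A {} - \<Union>(?g ` S)) * weighted_matchings lozenges ?w (?FB - \<Union>(?g ` S))))"
    by (rule sum.reindex_cong[OF inj_on_image_Pow[OF inj_on_subset[OF injg subset_UNIV]] refl refl])
  also have "\<dots> = (\<Sum>S\<in>Pow window. weighted_matchings lozenges ?w (A S) * weighted_matchings lozenges ?w ((`) flip ` B (Suc ` S)))"
  proof (rule sum.cong[OF refl])
    fix S assume "S \<in> Pow window"
    have p: "(\<Prod>l\<in>?g ` S. ?w l) = 1"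
    proof (rule prod.neutral, rule ballI)
      fix l assume "l \<in> ?g ` S"
      then obtain i where l: "l = ?g i" by (rule imageE)
      \<comment> \<open>The zigzag \<open>Z\<close> ends at the line, so a crossing lozenge never
        has both western sides on it.\<close>
      have "{(real i, 0), (real i + 1/2, 0 + 1)} \<notin> Z" unfolding Z_def zigzag_mem_north by simp
      then show "?w l = 1" unfolding l west_weight_vertical by (simp only: simp_thms if_False)
    qed
    have U: "\<Union>(?g ` S) = (\<lambda>i. up (real i) 0) ` S \<union> (\<lambda>i. down (real i) 0) ` S" by blast
    have a: "A {} - \<Union>(?g ` S) = A S"
    proof -
      have "(\<lambda>i. down (real i) 0) ` S \<inter> A {} = {}"
      proof (rule equals0I)
        fix s assume "s \<in> (\<lambda>i. down (real i) 0) ` S \<inter> A {}"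
        then obtain i where "down (real i) 0 \<in> A {}" by blast
        then show False using A_upper[of "down (real i) 0" "{}"] by (simp add: upper_part_iff)
      qed
      then show ?thesis unfolding U A_minus[of S] by blast
    qed
    have b: "?FB - \<Union>(?g ` S) = (`) flip ` B (Suc ` S)"
    proof -
      have 1: "(\<lambda>i. up (real i) 0) ` S \<inter> ?FB = {}"
      proof (rule equals0I)
        fix s assume "s \<in> (\<lambda>i. up (real i) 0) ` S \<inter> ?FB"
        then obtain i where "up (real i) 0 \<in> ?FB" by blast
        then show False using FB[of "up (real i) 0"] by (simp add: lower_part_iff)
      qed
      have 2: "?FB - (\<lambda>i. up (real i) 0) ` S = ?FB" by (rule Diff_triv) (simp only: Int_commute 1)
      have "(`) flip ` B (Suc ` S) = ?FB - (`) flip ` ((\<lambda>i. up (real i) 0) ` Suc ` S)"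
        unfolding B_minus[of "Suc ` S"] by (rule image_set_diff) (rule injI, simp only: inj_image_eq_iff[OF inj_flip])
      also have "(`) flip ` ((\<lambda>i. up (real i) 0) ` Suc ` S) = (\<lambda>i. down (real i) 0) ` S"
        unfolding image_image flip_up_Suc ..
      finally have 3: "(`) flip ` B (Suc ` S) = ?FB - (\<lambda>i. down (real i) 0) ` S" .
      show ?thesis unfolding U Diff_Un 2 3 by (rule Int_absorb1) (rule Diff_subset)
    qed
    show "(\<Prod>l\<in>?g ` S. ?w l) * (weighted_matchings lozenges ?w (A {} - \<Union>(?g ` S)) * weighted_matchings lozenges ?w (?FB - \<Union>(?g ` S))) =
      weighted_matchings lozenges ?w (A S) * weighted_matchings lozenges ?w ((`) flip ` B (Suc ` S))"
      by (simp only: p a b mult_1)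
  qed
  finally show ?thesis .
qed

lemma A_matchings:
  "weighted_matchings lozenges (west_weight Z) (A S) = trapezoid_matchings 1 (L - e1) J1 (fern_set True L as bs \<union> S)"
proof -
  have "trapezoid_matchings 1 (L - e1) J1 (fern_set True L as bs \<union> S) = 1 ^ (0 - 1) *
    weighted_matchings lozenges (west_weight Z) (cells (quarter_polygon J1 L) - dent_union (upper_dents L as bs) 0 S)"
  proof (rule dent_union_matchings)
    show "L = L - e1 + (J1 + 1) div 2" using le_L(1) by (simp add: J1_def)
    show "s \<le> J1" if "(p, s) \<in> upper_dents L as bs" for p s
    proof -
      have "s \<le> even_sum as \<or> s \<le> odd_sum bs"
        using that by (auto simp: upper_dents_def entry_le_even_sum entry_le_odd_sum)
      then show ?thesis by (auto simp: J1_def e1_def)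
    qed
    show "west_weight Z {up u k, down u k} = (if u = 0 \<and> even k then 1 else 1)" if "1 \<le> k" for u k
      unfolding west_weight_vertical Z_def zigzag_mem_north using that by simp
    show "west_weight Z {up u k, down u' k'} = 1" if "u \<noteq> u'" for u k u' k'
      using that by (rule west_weight_other)
    show "i \<in> fern_set True L as bs \<union> S \<longleftrightarrow> (\<exists>(p, s)\<in>upper_dents L as bs. p \<le> i \<and> i < p + s) \<or> i < 0 \<or> i \<in> S"
      if "i < L" for i
      unfolding Un_iff mem_upper_dents[OF that] by simp
  qed simp_all
  then show ?thesis by (simp add: A_def)
qed

text \<open>The trapezoid counts a_1 forced lozenges of weight 1/2 inside the half triangle, which
  the region does not contain; the power of 2 takes them back.\<close>

lemma B_matchings:
  "weighted_matchings lozenges (west_weight Z) ((`) flip ` B S) =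
    2 ^ (entry as 1) * trapezoid_matchings (1/2) (L + 1 + z - e2) J2 (dn_fern \<union> S)"
proof -
  let ?w = "\<lambda>l. west_weight Z ((`) flip ` l)"
  have "trapezoid_matchings (1/2) (L + 1 + z - e2) J2 (dn_fern \<union> S) = (1/2) ^ (h - 1) *
    weighted_matchings lozenges ?w (cells (quarter_polygon J2 (L + 1 + z)) - dent_union (lower_dents z L as bs) h S)"
  proof (rule dent_union_matchings)
    show "L + 1 + z = L + 1 + z - e2 + (J2 + 1) div 2" using le_L(2) J2(3) by simp
    have h: "h \<le> e2" using entry_le_odd_sum[of 1 as] by (simp add: h_def e2_def)
    then show "2 * h \<le> J2 + 1" by (simp add: J2_def)
    show "s \<le> J2" if "(p, s) \<in> lower_dents z L as bs" for p s
    proof -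
      have "s \<le> odd_sum as \<or> s \<le> even_sum bs \<or> s = z"
        using that by (auto simp: lower_dents_def entry_le_even_sum entry_le_odd_sum)
      then show ?thesis by (auto simp: J2_def e2_def)
    qed
    show "odd J2 \<or> (1/2 :: real) = 1" using J2(1) by simp
    show "?w {up u k, down u k} = (if u = 0 \<and> even k then 1/2 else 1)" if k: "1 \<le> k" "k < int J2" for u k
    proof -
      \<comment> \<open>Reflection exchanges the two halves of a vertical lozenge and sends u = 0 to
        -1, where \<open>NR_beta\<close> is at even heights.\<close>
      have e: "(`) flip ` {up u k, down u k} = {up (u - 1) (- k), down (u - 1) (- k)}"
        by (simp add: flip_up flip_down insert_commute)
      have "u - 1 + 1/2 = u - 1/2" by simp
      then show ?thesis
        unfolding e west_weight_vertical Z_def zigzag_mem_north zigzag_mem_south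
        using k J2(2) by (auto simp: NR_beta_def)
    qed
    show "?w {up u k, down u' k'} = 1" if "u \<noteq> u'" for u k u' k'
    proof -
      have e: "(`) flip ` {up u k, down u' k'} = {up (u' - 1) (- k'), down (u - 1) (- k)}"
        by (simp add: flip_up flip_down insert_commute)
      show ?thesis unfolding e by (rule west_weight_other) (use that in simp)
    qed
    show "i \<in> dn_fern \<union> S \<longleftrightarrow> (\<exists>(p, s)\<in>lower_dents z L as bs. p \<le> i \<and> i < p + s) \<or> i < h \<or> i \<in> S"
      if "i < L + 1 + z" for i
      unfolding Un_iff[of i dn_fern] mem_lower_dents[OF that] by blast
  qed
  moreover have "weighted_matchings lozenges (west_weight Z) ((`) flip ` B S) = weighted_matchings lozenges ?w (B S)"
    by (rule flip_matchings[OF finite_AB(2)]) (use B_lower in blast)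
  ultimately show ?thesis by (simp add: B_def h_def power_one_over)
qed

end

section \<open>The product formula\<close>

text \<open>The mixed factors with U and with D combine to one product over their union, which
  consists of two intervals. The element 0 of the union gives s^2, and the linear factor gives
  another s.\<close>

lemma square_vandermonde_products:
  assumes fin: "finite U" "finite D" and UD: "U \<inter> D = {}" "U \<union> D = {0..a} \<union> {N + 1..N + B}" and "a \<le> N"
    and S: "S \<subseteq> {a + 1..N}"
  shows "(\<Prod>l\<in>U \<union> S. real l) * square_vandermonde (U \<union> S) * square_vandermonde (D \<union> S) =
    (\<Prod>l\<in>U. real l) * square_vandermonde U * square_vandermonde D *
    ((\<Prod>s\<in>S. selberg_weight a N B s) * (square_vandermonde S)\<^sup>2)"
proof -
  let ?d = "\<lambda>s u. \<bar>(real s)\<^sup>2 - (real u)\<^sup>2\<bar>"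
  have fS: "finite S" using S by (rule finite_subset) simp
  have dS: "U \<inter> S = {}" "D \<inter> S = {}"
  proof -
    have "(U \<union> D) \<inter> S = {}" unfolding UD(2) using S by fastforce
    then show "U \<inter> S = {}" "D \<inter> S = {}" by blast+
  qed
  have w: "real s * ((\<Prod>u\<in>U. ?d s u) * (\<Prod>u\<in>D. ?d s u)) = selberg_weight a N B s" if "s \<in> S" for s
  proof -
    have s: "a < s" "s \<le> N" using S that by auto
    have "(\<Prod>u\<in>U. ?d s u) * (\<Prod>u\<in>D. ?d s u) = (\<Prod>u\<in>U \<union> D. ?d s u)"
      by (rule prod.union_disjoint[OF fin UD(1), symmetric])
    also have "\<dots> = (\<Prod>u\<in>{0..a}. ?d s u) * (\<Prod>u\<in>{N + 1..N + B}. ?d s u)"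
      unfolding UD(2) by (rule prod.union_disjoint) (use \<open>a \<le> N\<close> in auto)
    also have "{0..a} = insert 0 {1..a}" by auto
    also have "(\<Prod>u\<in>insert 0 {1..a}. ?d s u) = (real s)\<^sup>2 * (\<Prod>u\<in>{1..a}. ?d s u)"
      by simp
    also have "(\<Prod>u\<in>{1..a}. ?d s u) = (\<Prod>u\<in>{1..a}. (real s)\<^sup>2 - (real u)\<^sup>2)"
      using s by (intro prod.cong refl abs_of_nonneg) (simp add: power_mono)
    also have "(\<Prod>u\<in>{N + 1..N + B}. ?d s u) = (\<Prod>u\<in>{N + 1..N + B}. (real u)\<^sup>2 - (real s)\<^sup>2)"
    proof (intro prod.cong refl)
      fix u assume "u \<in> {N + 1..N + B}"
      then have "(real s)\<^sup>2 \<le> (real u)\<^sup>2" using s by (intro power_mono) auto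
      then show "?d s u = (real u)\<^sup>2 - (real s)\<^sup>2" by simp
    qed
    finally show ?thesis by (simp add: selberg_weight_def power2_eq_square power3_eq_cube mult_ac)
  qed
  have "(\<Prod>l\<in>U \<union> S. real l) = (\<Prod>l\<in>U. real l) * (\<Prod>s\<in>S. real s)"
    by (rule prod.union_disjoint[OF fin(1) fS dS(1)])
  moreover have "(\<Prod>s\<in>S. selberg_weight a N B s) =
      (\<Prod>s\<in>S. real s) * ((\<Prod>s\<in>S. \<Prod>u\<in>U. ?d s u) * (\<Prod>s\<in>S. \<Prod>u\<in>D. ?d s u))"
    unfolding prod.distrib[symmetric] by (rule prod.cong) (simp_all add: w)
  ultimately show ?thesis
    unfolding square_vandermonde_union[OF fin(1) fS dS(1)] square_vandermonde_union[OF fin(2) fS dS(2)]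
    by (simp add: power2_eq_square mult_ac)
qed

lemma T_pos: "0 < T (Suc x) n y"
  unfolding T_def by (intro prod_pos) (auto intro!: pochhammer_pos)

lemma T_ratio_0: "T_ratio a 0 y B = 1"
  using T_pos[of 0 "2*a + B + 2*y" y] T_pos[of a "B + 2*y" y] by (simp add: T_ratio_def)

lemma selberg_value_factor: "selberg_value a x y B = selberg_value a 0 y B * T_ratio a x y B"
  by (simp add: selberg_value_def T_ratio_0)

lemma selberg_value_0: "selberg_value a x 0 B = 1"
  using H_pos[of "2 * a + B + 1"] H_pos[of B] by (simp add: selberg_value_def T_ratio_def T_def)

lemma H2_pos: "0 < H2 n"
  unfolding H2_def by (intro prod_pos) auto

context nr_region
begin

definition "up_value = (\<Prod>l\<in>Suc ` fern_set True L as bs. real l) * square_vandermonde (Suc ` fern_set True L as bs)"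
definition "dn_value = square_vandermonde dn_fern"

lemma card_dn_fern: "card dn_fern = odd_sum as + even_sum bs + z + 1"
proof -
  have sub: "fern_set False L as bs \<subseteq> {..<L}" using fern_set_Un[OF L_def] by blast
  have "insert 0 (Suc ` fern_set False L as bs) \<inter> {L + 1..<L + 1 + z} = {}" using sub by auto
  then have "card dn_fern = card (insert 0 (Suc ` fern_set False L as bs)) + z"
    by (simp add: card_Un_disjoint)
  also have "card (insert 0 (Suc ` fern_set False L as bs)) = Suc (card (fern_set False L as bs))"
    by (simp add: card_image)
  finally show ?thesis by (simp add: card_fern_set(2)[OF L_def])
qed

lemma dn_fern_subset: "dn_fern \<subseteq> {..<L + 1 + z}"
proof -
  have "fern_set False L as bs \<subseteq> {..<L}" using fern_set_Un[OF L_def] by blast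
  then show ?thesis by auto
qed

lemma Q_t_plus: "real (Q (t_plus x y as bs)) = up_value / H2 (2 * (even_sum as + odd_sum bs) + 1)"
proof -
  let ?t = "t_plus x y as bs"
  have b: "blocks False ?t = fern_set True L as bs" "sum_list ?t = L"
    using t_plus_blocks[of x y as bs] by (simp_all add: L_def)
  have e: "even_sum ?t = even_sum as + odd_sum bs"
    using card_blocks(2)[of ?t] card_fern_set(1)[OF L_def] b by simp
  have o: "odd_sum ?t + even_sum ?t = L" using odd_sum_add_even_sum[of ?t] b by simp
  have "real (Q ?t) = trapezoid_matchings 1 (odd_sum ?t) (2 * even_sum ?t) (fern_set True L as bs)"
    unfolding Q_eq_trapezoid_matchings b ..
  also have "\<dots> = (if card (fern_set True L as bs) = even_sum ?t then up_value / H2 (2 * even_sum ?t + 1) else 0)"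
    unfolding up_value_def
  proof (rule trapezoid_matchings_full)
    show "fern_set True L as bs \<subseteq> {..<odd_sum ?t + even_sum ?t}"
      unfolding o using fern_set_Un[OF L_def] by blast
    show "fern_set True L as bs = {}" if "even_sum ?t = 0"
      using that e card_fern_set(1)[OF L_def] by simp
  qed
  finally show ?thesis using e card_fern_set(1)[OF L_def] by simp
qed

lemma K'_t_minus: "K' (t_minus x y z as bs) = dn_value / H2 (2 * (odd_sum as + even_sum bs + z + 1))"
proof -
  let ?t = "t_minus x y z as bs"
  have b: "blocks False ?t = dn_fern" "sum_list ?t = L + 1 + z"
    using t_minus_blocks[of x y z as bs] by (simp_all add: L_def)
  have e: "even_sum ?t = odd_sum as + even_sum bs + z + 1"
    using card_blocks(2)[of ?t] card_dn_fern b by simp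
  have o: "odd_sum ?t + even_sum ?t = L + 1 + z" using odd_sum_add_even_sum[of ?t] b by simp
  have "K' ?t = trapezoid_matchings (1/2) (odd_sum ?t) (2 * even_sum ?t - 1) dn_fern"
    using K'_eq_trapezoid_matchings[of ?t] e b by simp
  also have "\<dots> = (if card dn_fern = even_sum ?t then dn_value / H2 (2 * even_sum ?t) else 0)"
    unfolding dn_value_def
  proof (rule trapezoid_matchings_half)
    show "dn_fern \<subseteq> {..<odd_sum ?t + even_sum ?t}" unfolding o by (rule dn_fern_subset)
    show "0 < even_sum ?t" unfolding e by simp
  qed
  finally show ?thesis using e card_dn_fern by simp
qed

lemma values_pos: "0 < up_value" "0 < dn_value"
  unfolding up_value_def dn_value_def
  by (auto intro!: mult_pos_pos prod_pos square_vandermonde_pos)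

theorem M_NR_eq_selberg:
  "M_NR x y z as bs = 2 ^ (entry as 1) * (up_value / H2 (2 * e1 + 1)) * (dn_value / H2 (2 * e2)) *
     selberg_value (sum_list as) x y (sum_list bs + z)"
proof -
  let ?a = "sum_list as" let ?B = "sum_list bs + z" let ?U = "fern_set True L as bs"
  let ?W = "{?a..<?a + x + y}" let ?N = "?a + x + y"
  let ?up = "\<lambda>S. trapezoid_matchings 1 (L - e1) J1 (?U \<union> S)"
  let ?dn = "\<lambda>S. trapezoid_matchings (1/2) (L + 1 + z - e2) J2 (dn_fern \<union> Suc ` S)"
  have WL: "?W \<subseteq> {..<L}" by (auto simp: L_def)
  have Usub: "?U \<subseteq> {..<L}" and UW: "?U \<inter> ?W = {}" and DW: "fern_set False L as bs \<inter> ?W = {}"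
    using fern_set_Un[OF L_def] by blast+
  \<comment> \<open>The upper side alone fixes the number of crossing lozenges: any other number
    gives a determinant of the wrong size, hence 0.\<close>
  have up: "?up S = (if card S = y then (\<Prod>l\<in>Suc ` (?U \<union> S). real l) * square_vandermonde (Suc ` (?U \<union> S)) / H2 (2 * e1 + 1) else 0)"
    if S: "S \<subseteq> ?W" "e1 = 0 \<Longrightarrow> S = {}" for S
  proof -
    have fS: "finite S" using S(1) by (rule finite_subset) simp
    have "?U \<inter> S = {}" using S(1) UW by blast
    then have c: "card (?U \<union> S) = even_sum as + odd_sum bs + card S"
      using fS by (simp add: card_Un_disjoint card_fern_set(1)[OF L_def])
    have "?up S = (if card (?U \<union> S) = e1 then (\<Prod>l\<in>Suc ` (?U \<union> S). real l) * square_vandermonde (Suc ` (?U \<union> S)) / H2 (2 * e1 + 1) else 0)"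
      unfolding J1_def
    proof (rule trapezoid_matchings_full)
      show "?U \<union> S \<subseteq> {..<L - e1 + e1}" using le_L(1) Usub S(1) WL by auto
      show "?U \<union> S = {}" if "e1 = 0"
        using S(2)[OF that] that card_fern_set(1)[OF L_def] by (simp add: e1_def)
    qed
    then show ?thesis using c by (simp add: e1_def)
  qed
  have dn: "?dn S = square_vandermonde (dn_fern \<union> Suc ` S) / H2 (2 * e2)"
    if S: "S \<subseteq> ?W" "card S = y" for S
  proof -
    have fS: "finite S" using S(1) by (rule finite_subset) simp
    have "dn_fern \<inter> Suc ` S = {}"
    proof (rule equals0I)
      fix i assume "i \<in> dn_fern \<inter> Suc ` S"
      then obtain j where j: "i = Suc j" "j \<in> S" "i \<in> dn_fern" by blast
      then have "j < L" "j \<notin> fern_set False L as bs" using S(1) WL DW by blast+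
      then show False using j by auto
    qed
    then have c: "card (dn_fern \<union> Suc ` S) = e2"
      using fS S(2) card_dn_fern by (subst card_Un_disjoint) (simp_all add: card_image e2_def)
    have "?dn S = (if card (dn_fern \<union> Suc ` S) = e2 then square_vandermonde (dn_fern \<union> Suc ` S) / H2 (2 * e2) else 0)"
      unfolding J2_def
    proof (rule trapezoid_matchings_half)
      have "Suc ` S \<subseteq> {..<L + 1 + z}" using S(1) WL by fastforce
      then show "dn_fern \<union> Suc ` S \<subseteq> {..<L + 1 + z - e2 + e2}"
        using le_L(2) dn_fern_subset by simp
      show "0 < e2" by (simp add: e2_def)
    qed
    then show ?thesis using c by simp
  qed
  let ?g = "\<lambda>S. (\<Prod>l\<in>Suc ` ?U \<union> S. real l) * square_vandermonde (Suc ` ?U \<union> S) * square_vandermonde (dn_fern \<union> S)"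
  let ?c = "2 ^ (entry as 1) / H2 (2 * e1 + 1) / H2 (2 * e2)"
  have term_eq: "?up S * (2 ^ (entry as 1) * ?dn S) = (if card S = y then ?c * ?g (Suc ` S) else 0)"
    if "S \<subseteq> ?W" "e1 = 0 \<Longrightarrow> S = {}" for S
    using up[OF that] dn[OF that(1)] by (simp add: image_Un)
  have "M_NR x y z as bs = (\<Sum>S\<in>Pow window. ?up S * (2 ^ (entry as 1) * ?dn S))"
    unfolding cut_matchings A_matchings B_matchings ..
  also have "\<dots> = (\<Sum>S\<in>Pow window. if card S = y then ?c * ?g (Suc ` S) else 0)"
    by (rule sum.cong[OF refl], rule term_eq) (auto simp: window_eq split: if_splits)
  also have "\<dots> = (\<Sum>S\<in>Pow ?W. if card S = y then ?c * ?g (Suc ` S) else 0)"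
  proof (cases "e1 = 0")
    \<comment> \<open>The upper part is empty and y = 0. The larger sum has further sets S, but only
      the empty one has y elements.\<close>
    case True
    then have y: "y = 0" by (simp add: e1_def)
    have "card S = 0 \<longleftrightarrow> S = {}" if "S \<in> Pow ?W" for S
      using that finite_subset[of S ?W] by auto
    then have "(\<Sum>S\<in>Pow ?W. if card S = y then ?c * ?g (Suc ` S) else 0) =
      (\<Sum>S\<in>{{}}. if card S = y then ?c * ?g (Suc ` S) else 0)"
      unfolding y by (intro sum.mono_neutral_right) auto
    moreover have "Pow window = {{}}" using True by (simp add: window_eq)
    ultimately show ?thesis by (simp only:)
  qed (simp add: window_eq)
  also have "\<dots> = (\<Sum>S | S \<subseteq> ?W \<and> card S = y. ?c * ?g (Suc ` S))"
  proof -
    have "{S \<in> Pow ?W. card S = y} = {S. S \<subseteq> ?W \<and> card S = y}" by blast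
    then show ?thesis using sum.inter_filter[of "Pow ?W" "\<lambda>S. ?c * ?g (Suc ` S)" "\<lambda>S. card S = y"] by simp
  qed
  also have "\<dots> = (\<Sum>S | S \<subseteq> {?a + 1..?N} \<and> card S = y. ?c * ?g S)"
  proof (rule sum.reindex_bij_betw)
    have W: "Suc ` ?W = {?a + 1..?N}" by (simp add: atLeastLessThanSuc_atLeastAtMost)
    show "bij_betw ((`) Suc) {S. S \<subseteq> ?W \<and> card S = y} {S. S \<subseteq> {?a + 1..?N} \<and> card S = y}"
      unfolding bij_betw_def
    proof
      show "inj_on ((`) Suc) {S. S \<subseteq> ?W \<and> card S = y}"
        by (rule inj_onI) (simp only: inj_image_eq_iff[OF inj_Suc])
      show "(`) Suc ` {S. S \<subseteq> ?W \<and> card S = y} = {S. S \<subseteq> {?a + 1..?N} \<and> card S = y}"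
      proof (intro equalityI subsetI)
        fix S assume "S \<in> (`) Suc ` {S. S \<subseteq> ?W \<and> card S = y}"
        then obtain S' where S': "S = Suc ` S'" "S' \<subseteq> ?W" "card S' = y" by blast
        have "S \<subseteq> Suc ` ?W" unfolding S'(1) by (rule image_mono) (rule S'(2))
        moreover have "card S = y" using S'(1,3) by (simp add: card_image)
        ultimately show "S \<in> {S. S \<subseteq> {?a + 1..?N} \<and> card S = y}"
          unfolding W by (intro CollectI conjI)
      next
        fix S assume "S \<in> {S. S \<subseteq> {?a + 1..?N} \<and> card S = y}"
        then have S: "S \<subseteq> Suc ` ?W" "card S = y" by (simp_all only: W mem_Collect_eq)
        from S(1) obtain S' where S': "S' \<subseteq> ?W" "S = Suc ` S'" by (rule subset_imageE)
        then show "S \<in> (`) Suc ` {S. S \<subseteq> ?W \<and> card S = y}"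
          using S(2) by (intro image_eqI[of _ _ S']) (simp_all add: card_image)
      qed
    qed
  qed
  also have "\<dots> = (\<Sum>S | S \<subseteq> {?a + 1..?N} \<and> card S = y.
      ?c * (up_value * dn_value * ((\<Prod>s\<in>S. selberg_weight ?a ?N ?B s) * (square_vandermonde S)\<^sup>2)))"
  proof (rule sum.cong[OF refl])
    fix S assume "S \<in> {S. S \<subseteq> {?a + 1..?N} \<and> card S = y}"
    then have S: "S \<subseteq> {?a + 1..?N}" by simp
    have disj: "Suc ` ?U \<inter> dn_fern = {}"
    proof (rule equals0I)
      fix i assume "i \<in> Suc ` ?U \<inter> dn_fern"
      then obtain j where j: "i = Suc j" "j \<in> ?U" "i \<in> dn_fern" by blast
      then have "j < L" "j \<notin> fern_set False L as bs" using Usub fern_set_Int[OF L_def] by blast+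
      then show False using j by auto
    qed
    \<comment> \<open>Position 0 completes the western interval, and the z dents of the bend prolong
      the eastern one to length b + z.\<close>
    have un: "Suc ` ?U \<union> dn_fern = {0..?a} \<union> {?N + 1..?N + ?B}"
    proof -
      have "Suc ` ?U \<union> dn_fern = insert 0 (Suc ` (?U \<union> fern_set False L as bs)) \<union> {L + 1..<L + 1 + z}"
        unfolding image_Un by blast
      also have "?U \<union> fern_set False L as bs = {..<?a} \<union> {?N..<L}"
        unfolding fern_set_Un[OF L_def] by (auto simp: L_def)
      also have "Suc ` ({..<?a} \<union> {?N..<L}) = {1..?a} \<union> {?N + 1..L}"
        by (simp add: image_Un lessThan_atLeast0 atLeastLessThanSuc_atLeastAtMost)
      also have "insert 0 ({1..?a} \<union> {?N + 1..L}) \<union> {L + 1..<L + 1 + z} = {0..?a} \<union> {?N + 1..?N + ?B}"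
        by (auto simp: L_def)
      finally show ?thesis .
    qed
    have fin: "finite (Suc ` ?U)" "finite dn_fern" and aN: "?a \<le> ?N" by simp_all
    show "?c * ?g S = ?c * (up_value * dn_value * ((\<Prod>s\<in>S. selberg_weight ?a ?N ?B s) * (square_vandermonde S)\<^sup>2))"
      unfolding square_vandermonde_products[OF fin disj un aN S] up_value_def dn_value_def ..
  qed
  also have "\<dots> = ?c * (up_value * dn_value * selberg_value ?a x y ?B)"
    by (simp only: sum_distrib_left[symmetric] selberg_sum)
  finally show ?thesis by simp
qed

text \<open>\<open>Q\<close> and \<open>K'\<close> have the heights that belong to y = 0 and carry
  the corresponding \<open>H2\<close> factors; exchanging them for those of the region gives the
  quotient.\<close>

theorem M_NR_eq_Q_K':
  "M_NR x y z as bs = 2 ^ (entry as 1) * real (Q (t_plus x y as bs)) * K' (t_minus x y z as bs) *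
    ((H2 (2 * even_sum as + 2 * odd_sum bs + 1) * H2 (2 * odd_sum as + 2 * even_sum bs + 2 * z + 2)) /
     (H2 (2 * even_sum as + 2 * odd_sum bs + 2 * y + 1) * H2 (2 * odd_sum as + 2 * even_sum bs + 2 * y + 2 * z + 2))) *
    selberg_value (sum_list as) x y (sum_list bs + z)"
proof -
  have "2 * even_sum as + 2 * odd_sum bs + 1 = 2 * (even_sum as + odd_sum bs) + 1"
    "2 * odd_sum as + 2 * even_sum bs + 2 * z + 2 = 2 * (odd_sum as + even_sum bs + z + 1)"
    "2 * even_sum as + 2 * odd_sum bs + 2 * y + 1 = 2 * e1 + 1"
    "2 * odd_sum as + 2 * even_sum bs + 2 * y + 2 * z + 2 = 2 * e2"
    by (simp_all add: e1_def e2_def)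
  then show ?thesis
    unfolding M_NR_eq_selberg Q_t_plus K'_t_minus
    using H2_pos[of "2 * (even_sum as + odd_sum bs) + 1"] H2_pos[of "2 * (odd_sum as + even_sum bs + z + 1)"]
    by (simp only:) (simp add: field_simps)
qed

text \<open>Allows cancellation in the quotient of the first equality, whose denominator is a
  multiple of such a product.\<close>

lemma Q_K'_neq_0: "real (Q (t_plus x y as bs)) * K' (t_minus x y z as bs) \<noteq> 0"
  unfolding Q_t_plus K'_t_minus using values_pos H2_pos by (simp add: less_imp_neq[symmetric])

end

theorem theorem2p16:
  fixes x y z :: nat and as bs :: "nat list"
  defines "a \<equiv> sum_list as" and "b \<equiv> sum_list bs"
    and "oa \<equiv> odd_sum as" and "ea \<equiv> even_sum as"
    and "ob \<equiv> odd_sum bs" and "eb \<equiv> even_sum bs"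
  shows
    "M_NR x y z as bs =
       M_NR (x + y) 0 z as bs * M_NR 0 y z as bs / M_NR y 0 z as bs
       * ((T (x + 1) (2*a + b + 2*y + z) y * T (x + a + 1) (b + 2*y + z) y)
          / (T 1 (2*a + b + 2*y + z) y * T (a + 1) (b + 2*y + z) y))
     \<and>
     M_NR (x + y) 0 z as bs * M_NR 0 y z as bs / M_NR y 0 z as bs
       * ((T (x + 1) (2*a + b + 2*y + z) y * T (x + a + 1) (b + 2*y + z) y)
          / (T 1 (2*a + b + 2*y + z) y * T (a + 1) (b + 2*y + z) y))
     = 2 powi (int (entry as 1) - int y) * real (Q (t_plus x y as bs)) * K' (t_minus x y z as bs)
       * (fact (a + y) / fact a)
       * ((H2 (2*ea + 2*ob + 1) * H2 (2*oa + 2*eb + 2*z + 2))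
          / (H2 (2*ea + 2*ob + 2*y + 1) * H2 (2*oa + 2*eb + 2*y + 2*z + 2)))
       * ((H (2*a + b + 2*y + z + 1) * H (b + y + z))
          / (H (2*a + b + y + z + 1) * H (b + z)))
       * ((T (x + 1) (2*a + b + 2*y + z) y * T (x + a + 1) (b + 2*y + z) y)
          / (T 1 (2*a + b + 2*y + z) y * T (a + 1) (b + 2*y + z) y))"
proof -
  define B where "B = b + z"
  define R where "R = (H2 (2*ea + 2*ob + 1) * H2 (2*oa + 2*eb + 2*z + 2))
          / (H2 (2*ea + 2*ob + 2*y + 1) * H2 (2*oa + 2*eb + 2*y + 2*z + 2))"
  define QK where "QK x y = real (Q (t_plus x y as bs)) * K' (t_minus x y z as bs)" for x y
  \<comment> \<open>x and y occur in t^+ and t^- only in the fused entry, as a sum.\<close>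
  have QK: "QK (x + y) 0 = QK x y" for x y
    by (simp add: QK_def t_plus_def t_minus_def add.assoc)
  have neq: "QK x y \<noteq> 0" for x y
    unfolding QK_def by (rule nr_region.Q_K'_neq_0)
  have M0: "M_NR x 0 z as bs = 2 ^ (entry as 1) * QK x 0" for x
    unfolding nr_region.M_NR_eq_Q_K'[of x 0 z as bs] QK_def selberg_value_0
    using H2_pos[of "2 * even_sum as + 2 * odd_sum bs + 1"] H2_pos[of "2 * odd_sum as + 2 * even_sum bs + 2 * z + 2"]
    by simp
  have My: "M_NR x y z as bs = 2 ^ (entry as 1) * QK x y * R * selberg_value a x y B" for x
    unfolding nr_region.M_NR_eq_Q_K'[of x y z as bs] QK_def R_def B_def a_def b_def oa_def ea_def ob_def eb_def
    by (simp only: mult.assoc)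
  have args: "2*a + B + 2*y = 2*a + b + 2*y + z" "B + 2*y = b + 2*y + z"
    "2*a + B + 2*y + 1 = 2*a + b + 2*y + z + 1" "B + y = b + y + z" "2*a + B + y + 1 = 2*a + b + y + z + 1"
    by (simp_all add: B_def)
  have Tr: "(T (x + 1) (2*a + b + 2*y + z) y * T (x + a + 1) (b + 2*y + z) y)
          / (T 1 (2*a + b + 2*y + z) y * T (a + 1) (b + 2*y + z) y) = T_ratio a x y B"
    by (simp only: T_ratio_def args)
  \<comment> \<open>The last two regions share \<open>QK 0 y\<close>, so their quotient leaves only
    \<open>R\<close> and the Selberg value at x = 0; the first region supplies
    \<open>QK x y\<close>.\<close>
  have quot: "M_NR (x + y) 0 z as bs * M_NR 0 y z as bs / M_NR y 0 z as bs =
      2 ^ (entry as 1) * QK x y * R * selberg_value a 0 y B"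
    unfolding M0 My[of 0] using QK[of x y] QK[of 0 y] neq[of 0 y] by simp
  have sv: "selberg_value a 0 y B = (1/2) ^ y * (fact (a + y) / fact a) *
     ((H (2*a + b + 2*y + z + 1) * H (b + y + z)) / (H (2*a + b + y + z + 1) * H (b + z)))"
    unfolding selberg_value_def T_ratio_0 args by (simp add: B_def)
  \<comment> \<open>The exponent may be negative; its two parts come from the half triangle and from
    the Selberg sum.\<close>
  have pw: "2 powi (int (entry as 1) - int y) = 2 ^ (entry as 1) * (1/2 :: real) ^ y"
    by (simp add: power_int_diff power_one_over divide_simps)
  show ?thesis
  proof
    show "M_NR x y z as bs = M_NR (x + y) 0 z as bs * M_NR 0 y z as bs / M_NR y 0 z as bs
       * ((T (x + 1) (2*a + b + 2*y + z) y * T (x + a + 1) (b + 2*y + z) y)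
          / (T 1 (2*a + b + 2*y + z) y * T (a + 1) (b + 2*y + z) y))"
      unfolding Tr quot My[of x] selberg_value_factor[of a x y B] by (simp only: mult.assoc)
    show "M_NR (x + y) 0 z as bs * M_NR 0 y z as bs / M_NR y 0 z as bs
       * ((T (x + 1) (2*a + b + 2*y + z) y * T (x + a + 1) (b + 2*y + z) y)
          / (T 1 (2*a + b + 2*y + z) y * T (a + 1) (b + 2*y + z) y))
     = 2 powi (int (entry as 1) - int y) * real (Q (t_plus x y as bs)) * K' (t_minus x y z as bs)
       * (fact (a + y) / fact a)
       * ((H2 (2*ea + 2*ob + 1) * H2 (2*oa + 2*eb + 2*z + 2))
          / (H2 (2*ea + 2*ob + 2*y + 1) * H2 (2*oa + 2*eb + 2*y + 2*z + 2)))
       * ((H (2*a + b + 2*y + z + 1) * H (b + y + z))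
          / (H (2*a + b + y + z + 1) * H (b + z)))
       * ((T (x + 1) (2*a + b + 2*y + z) y * T (x + a + 1) (b + 2*y + z) y)
          / (T 1 (2*a + b + 2*y + z) y * T (a + 1) (b + 2*y + z) y))"
      unfolding Tr quot sv pw R_def[symmetric] QK_def by (simp only: mult_ac)
  qed
qed

end
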